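(* Fix the perturbation bandwidth $h>0$, let $\theta=h\pi+\sqrt{h^2\pi^2+1}$ and, for sample size $n$, set the polynomial degree to $l=\lceil 2\log n/\log\theta\rceil$. Let $\hat\eta_1,\hat\eta_2$ be the polynomial ERM estimates (defined in the context) computed from $n$ i.i.d. 2-snapshots, and let the recalibrated predictor be $$\hat T(x)=\big(\hat\eta_1(S(x)),\ \max(0,\ \hat\eta_2(S(x))-\hat\eta_1(S(x))^2)\big),$$ where $S(x)$ is the perturbed score. Then $\mathbb{E}[\mathrm{CE}_2(\hat T)]=O(\log^{3/2}n/\sqrt n)$ as $n\to\infty$, the outer expectation being over the sample used to compute $\hat\eta_1,\hat\eta_2$.
   Context: Setting: $X$ is a random input, $f^*(x)=P(Y=1\mid X=x)$ for a binary label $Y\in\{0,1\}$; no assumptions on $f^*$ or the law of $X$. The data are $n$ i.i.d. 2-snapshots $(X_i,Y_i^{(1)},Y_i^{(2)})$, where $Y_i^{(1)},Y_i^{(2)}$ given $X_i$ are i.i.d. $\mathrm{Bernoulli}(f^*(X_i))$. A higher-order predictor maps $x\mapsto(m_{\mathrm{orig}}(x),\sigma^2_{\mathrm{orig}}(x))$ with $m_{\mathrm{orig}}\in[0,1]$, $\sigma^2_{\mathrm{orig}}\in[0,m_{\mathrm{orig}}(1-m_{\mathrm{orig}})]$. Perturbation: for $s\in[a,b]$, $k_h(t\mid s)=\mathrm{sech}((t-s)/h)\mathbf 1_{[a,b]}(t)\big/\int_a^b\mathrm{sech}((u-s)/h)\,du$. The perturbed score $S(X)\in\mathcal R=[0,1]\times[0,\tfrac14]$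 has coordinates drawn independently (and independently of the labels given the original score) from $k_h(\cdot\mid m_{\mathrm{orig}}(X))$ on $[0,1]$ and $k_h(\cdot\mid\sigma^2_{\mathrm{orig}}(X))$ on $[0,\tfrac14]$. Estimates: let $S_i$ be the perturbed score of sample $i$ and $P_i=Y_i^{(1)}Y_i^{(2)}$. Let $\mathcal P_l$ be the class of functions on $\mathcal R$ of the form $\mathrm{clip}_{[0,1]}(\beta^\top\phi)$, where $\phi$ is the tensor-product polynomial basis of degree $l$ in each variable ($(l+1)^2$ components), $\beta\in\mathbb R^{(l+1)^2}$, and $\mathrm{clip}_{[0,1]}$ is projection to $[0,1]$. Then $\hat\eta_1\in\arg\min_{f\in\mathcal P_l}\frac1n\sum_{i=1}^n(Y_i^{(1)}-f(S_i))^2$ and $\hat\eta_2\in\arg\min_{f\in\mathcal P_l}\frac1n\sum_{i=1}^n(P_i-f(S_i))^2$. Calibration error: for a (possibly randomized) predictor $T=(m',(\sigma^2)')$, evaluated on a fresh $(X,Y)$ with its perturbation noise, $\mathrm{CE}_2(T)=\mathbb E\big[|\mathbb E[Y\mid T]-m'|\big]+\mathbb E\big[|\mathbb E[f^*(X)^2\mid T]-((m')^2+(\sigma^2)')|\big]$. For $\hat T$ these inner expectations are taken with the training sample (hence $\hat\eta_1,\hat\eta_2$) held fixed. *)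

theory Defs
  imports "HOL-Probability.Probability"
begin

subsection \<open>Score perturbation\<close>

definition sech :: "real \<Rightarrow> real" where
  "sech x = 1 / cosh x"

definition sech_kernel :: "real \<Rightarrow> real \<Rightarrow> real \<Rightarrow> real \<Rightarrow> real \<Rightarrow> real" where
  "sech_kernel h a b s t =
     sech ((t - s) / h) * indicator {a..b} t / (LBINT u:{a..b}. sech ((u - s) / h))"

text \<open>Density at \<open>t\<close> of the perturbed score when the original score is \<open>s\<close>.\<close>

definition score_kernel :: "real \<Rightarrow> real \<times> real \<Rightarrow> real \<times> real \<Rightarrow> real" where
  "score_kernel h s t = sech_kernel h 0 1 (fst s) (fst t) * sech_kernel h 0 (1/4) (snd s) (snd t)"


subsection \<open>Data\<close>

definition ho_predictor :: "'a measure \<Rightarrow> ('a \<Rightarrow> real) \<Rightarrow> ('a \<Rightarrow> real) \<Rightarrow> bool" where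
  "ho_predictor \<mu> m v \<longleftrightarrow>
     m \<in> borel_measurable \<mu> \<and> v \<in> borel_measurable \<mu> \<and>
     (\<forall>x\<in>space \<mu>. m x \<in> {0..1} \<and> v x \<in> {0..m x * (1 - m x)})"

type_synonym 'a snapshot = "'a \<times> bool \<times> bool \<times> (real \<times> real)"

text \<open>
  Joint law of \<open>(X, Y\<^sup>1, Y\<^sup>2, S)\<close>: given \<open>X\<close>, the two labels and the two coordinates of the
  perturbed score are independent, hence the product form of the density. The measure \<open>\<mu>\<close> is
  the law of \<open>X\<close>, and \<open>f\<close> is the true conditional label probability.
\<close>

definition snapshot_law ::
    "real \<Rightarrow> 'a measure \<Rightarrow> ('a \<Rightarrow> real) \<Rightarrow> ('a \<Rightarrow> real) \<Rightarrow> ('a \<Rightarrow> real) \<Rightarrow> 'a snapshot measure" where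
  "snapshot_law h \<mu> f m v =
     density (\<mu> \<Otimes>\<^sub>M count_space UNIV \<Otimes>\<^sub>M count_space UNIV \<Otimes>\<^sub>M lborel)
       (\<lambda>(x, y1, y2, s). ennreal
          (pmf (bernoulli_pmf (f x)) y1 * pmf (bernoulli_pmf (f x)) y2 * score_kernel h (m x, v x) s))"

definition sample_law ::
    "real \<Rightarrow> 'a measure \<Rightarrow> ('a \<Rightarrow> real) \<Rightarrow> ('a \<Rightarrow> real) \<Rightarrow> ('a \<Rightarrow> real) \<Rightarrow> nat \<Rightarrow>
     (nat \<Rightarrow> 'a snapshot) measure" where
  "sample_law h \<mu> f m v n = (\<Pi>\<^sub>M i\<in>{..<n}. snapshot_law h \<mu> f m v)"

text \<open>Joint law of a fresh \<open>(X, Y, S)\<close> with a single label.\<close>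

definition test_law ::
    "real \<Rightarrow> 'a measure \<Rightarrow> ('a \<Rightarrow> real) \<Rightarrow> ('a \<Rightarrow> real) \<Rightarrow> ('a \<Rightarrow> real) \<Rightarrow>
     ('a \<times> bool \<times> (real \<times> real)) measure" where
  "test_law h \<mu> f m v =
     density (\<mu> \<Otimes>\<^sub>M count_space UNIV \<Otimes>\<^sub>M lborel)
       (\<lambda>(x, y, s). ennreal (pmf (bernoulli_pmf (f x)) y * score_kernel h (m x, v x) s))"


subsection \<open>Polynomial empirical risk minimization\<close>

definition clip01 :: "real \<Rightarrow> real" where
  "clip01 x = max 0 (min 1 x)"

text \<open>The span of a tensor-product basis does not depend on the basis; monomials are used.\<close>

definition clipped_polys :: "nat \<Rightarrow> (real \<times> real \<Rightarrow> real) set" where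
  "clipped_polys l =
     {g. \<exists>\<beta> :: nat \<times> nat \<Rightarrow> real.
        g = (\<lambda>(s, t). clip01 (\<Sum>(i, j)\<in>{..l} \<times> {..l}. \<beta> (i, j) * (s ^ i * t ^ j)))}"

definition perturbed_score :: "'a snapshot \<Rightarrow> real \<times> real" where
  "perturbed_score = (\<lambda>(x, y1, y2, s). s)"

definition first_label :: "'a snapshot \<Rightarrow> real" where
  "first_label = (\<lambda>(x, y1, y2, s). of_bool y1)"

definition label_product :: "'a snapshot \<Rightarrow> real" where
  "label_product = (\<lambda>(x, y1, y2, s). of_bool y1 * of_bool y2)"

definition emp_risk ::
    "('a snapshot \<Rightarrow> real) \<Rightarrow> nat \<Rightarrow> (nat \<Rightarrow> 'a snapshot) \<Rightarrow> (real \<times> real \<Rightarrow> real) \<Rightarrow> real" where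
  "emp_risk Z n D g = (1 / real n) * (\<Sum>i<n. (Z (D i) - g (perturbed_score (D i)))\<^sup>2)"

text \<open>
  A minimizer need not be unique, so an estimator is any choice of one for each sample \<open>D\<close>.
  The choice has to be jointly measurable for the expectation over the sample to make sense.
\<close>

definition erm_estimator ::
    "(nat \<Rightarrow> 'a snapshot) measure \<Rightarrow> ('a snapshot \<Rightarrow> real) \<Rightarrow> nat \<Rightarrow> nat \<Rightarrow>
     ((nat \<Rightarrow> 'a snapshot) \<Rightarrow> real \<times> real \<Rightarrow> real) \<Rightarrow> bool" where
  "erm_estimator P Z n l \<eta> \<longleftrightarrow>
     (\<lambda>(D, s). \<eta> D s) \<in> borel_measurable (P \<Otimes>\<^sub>M borel) \<and>
     (\<forall>D\<in>space P. is_arg_min (emp_risk Z n D) (\<lambda>g. g \<in> clipped_polys l) (\<eta> D))"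

definition poly_degree :: "real \<Rightarrow> nat \<Rightarrow> nat" where
  "poly_degree h n =
     (let \<theta> = h * pi + sqrt (h\<^sup>2 * pi\<^sup>2 + 1) in nat \<lceil>2 * ln (real n) / ln \<theta>\<rceil>)"


subsection \<open>Calibration error\<close>

text \<open>
  On the probability space \<open>M\<close>, \<open>Y\<close> is the label, \<open>F\<close> the true label probability \<open>f(X)\<close>, and
  \<open>T\<close> the prediction, all as random variables.
\<close>

definition CE2 ::
    "'w measure \<Rightarrow> ('w \<Rightarrow> real) \<Rightarrow> ('w \<Rightarrow> real) \<Rightarrow> ('w \<Rightarrow> real \<times> real) \<Rightarrow> real" where
  "CE2 M Y F T =
     (let G = vimage_algebra (space M) T borel in
        (LINT \<omega>|M. \<bar>real_cond_exp M G Y \<omega> - fst (T \<omega>)\<bar>) +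
        (LINT \<omega>|M. \<bar>real_cond_exp M G (\<lambda>\<omega>. (F \<omega>)\<^sup>2) \<omega> - ((fst (T \<omega>))\<^sup>2 + snd (T \<omega>))\<bar>))"

definition recalibrated ::
    "(real \<times> real \<Rightarrow> real) \<Rightarrow> (real \<times> real \<Rightarrow> real) \<Rightarrow> real \<times> real \<Rightarrow> real \<times> real" where
  "recalibrated g1 g2 s = (g1 s, max 0 (g2 s - (g1 s)\<^sup>2))"

definition recalibration_error ::
    "real \<Rightarrow> 'a measure \<Rightarrow> ('a \<Rightarrow> real) \<Rightarrow> ('a \<Rightarrow> real) \<Rightarrow> ('a \<Rightarrow> real) \<Rightarrow>
     (real \<times> real \<Rightarrow> real) \<Rightarrow> (real \<times> real \<Rightarrow> real) \<Rightarrow> real" where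
  "recalibration_error h \<mu> f m v g1 g2 =
     CE2 (test_law h \<mu> f m v) (\<lambda>(x, y, s). of_bool y) (\<lambda>(x, y, s). f x)
       (\<lambda>(x, y, s). recalibrated g1 g2 s)"

end

(*
  Write eta1 and eta2 for the conditional means of f and of f^2 given the perturbed score S.
  Conditioning on the prediction is a contraction and eta1^2 <= eta2, so the calibration error is
  at most 3 E|eta1_hat - eta1| + E|eta2_hat - eta2|, and it suffices to bound the excess risks.

  Estimation. A class of clipped linear combinations of d functions, restricted to a sample of n
  points and their n ghosts, is covered up to 1/n in sup norm by the sign patterns of 2 n^2
  hyperplanes in d dimensions, that is, by at most (2 n^2 + 1)^d functions. Symmetrization of the
  excess loss, offset by its square (Bernstein condition), then gives an excess risk of order
  d ln n / n with exponential moments only and without any concentration inequality.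

  Approximation. eta1 and eta2 are quotients of averages of sech((s - m)/h) sech((t - v)/h). For
  complex s and t with imaginary parts below h pi / 4 the arguments of the two factors add up to
  less than pi / 2, so the denominator has positive real part and the quotient is bounded and
  holomorphic there. This strip contains the Bernstein ellipse of parameter sqrt theta, so
  polynomials of degree l approximate it up to O(theta^(-l/2)) = O(1/n). With d of order (ln n)^2
  the excess risks are O((ln n)^3 / n).
*)
theory Submission
  imports Defs "HOL-Complex_Analysis.Complex_Analysis"
begin

subsection \<open>Sign patterns of affine families\<close>

text \<open>Nothing is assumed about the law of the input or about \<open>f\<close>, so all
  regularity has to come from the perturbation: averaging against the sech kernel makes the
  regression functions analytic, with constants that depend on \<open>h\<close> alone. The delicate
  point is their denominator. A single factor has its first poles at imaginary height h pi / 2,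
  which is what the ellipse with parameter \<theta> just reaches, whereas the argument that keeps an
  average of products of two factors away from zero works only below h pi / 4. Hence the drop to
  sqrt \<theta>, which the factor 2 in the degree makes up for. The other obstacle is uniformity
  over a class that grows with n. As the loss is summed over n points, a change of 1/n in a function
  moves the sum by a constant only, so finitely many functions suffice. They are read off from
  sample and ghost sample together and thus serve all exchanges between the two. For each of them
  the quadratic penalty keeps the average over exchanges of the exponential at most 1, which yields
  a rate of d ln n / n and not merely its square root.\<close>

lemma card_le_card_traces:
  assumes "finite F"
  shows "card F \<le> card ((\<lambda>A. A - {j}) ` F) + card {A \<in> F. j \<notin> A \<and> insert j A \<in> F}"
proof -
  let ?G = "{A \<in> F. j \<notin> A \<and> insert j A \<in> F}"
  have "card F = card (F - ?G) + card ?G"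
    by (rule card_Int_Diff[OF assms, of ?G, THEN trans]) (simp add: Int_absorb1 Int_def add.commute conj_commute)
  \<comment> \<open>Two distinct members with the same trace are \<open>A\<close> and
    \<open>insert j A\<close>, and the one without \<open>j\<close> left the family together with
    \<open>?G\<close>. This counting of pairs is the step of the Sauer-Shelah induction.\<close>
  moreover have "inj_on (\<lambda>A. A - {j}) (F - ?G)"
  proof (rule inj_onI)
    fix A B assume A: "A \<in> F - ?G" and B: "B \<in> F - ?G" and eq: "A - {j} = B - {j}"
    have *: "j \<in> A \<longleftrightarrow> j \<in> B"
    proof
      assume "j \<in> A"
      show "j \<in> B"
      proof (rule ccontr)
        assume "j \<notin> B"
        then have "insert j B = A" using eq \<open>j \<in> A\<close> by auto
        then show False using A B \<open>j \<notin> B\<close> by auto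
      qed
    next
      assume "j \<in> B"
      show "j \<in> A"
      proof (rule ccontr)
        assume "j \<notin> A"
        then have "insert j A = B" using eq \<open>j \<in> B\<close> by auto
        then show False using A B \<open>j \<notin> A\<close> by auto
      qed
    qed
    then show "A = B" using eq by blast
  qed
  then have "card (F - ?G) = card ((\<lambda>A. A - {j}) ` (F - ?G))"
    by (simp add: card_image)
  moreover have "card ((\<lambda>A. A - {j}) ` (F - ?G)) \<le> card ((\<lambda>A. A - {j}) ` F)"
    using assms by (intro card_mono) auto
  ultimately show ?thesis by linarith
qed

text \<open>A new hyperplane splits only the cells that it meets, and these are cells of an
  arrangement of one dimension less inside that hyperplane.\<close>

lemma card_sign_patterns:
  fixes a :: "'k \<Rightarrow> 'i \<Rightarrow> real" and c :: "'i \<Rightarrow> real"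
  assumes "finite I" "finite K"
  shows "card (range (\<lambda>\<beta>. {i\<in>I. c i + (\<Sum>k\<in>K. \<beta> k * a k i) \<ge> 0})) \<le> (card I + 1) ^ card K"
  using assms
proof (induction I arbitrary: K a c rule: finite_induct)
  case empty
  then show ?case by (simp add: image_constant_conv)
next
  case (insert j I)
  define L where "L \<beta> i = c i + (\<Sum>k\<in>K. \<beta> k * a k i)" for \<beta> i
  define pat where "pat \<beta> = {i\<in>insert j I. L \<beta> i \<ge> 0}" for \<beta>
  let ?F = "range pat"
  let ?G = "{A \<in> ?F. j \<notin> A \<and> insert j A \<in> ?F}"
  have finF: "finite ?F"
    by (rule finite_subset[of _ "Pow (insert j I)"]) (use insert in \<open>auto simp: pat_def\<close>)
  have "(\<lambda>A. A - {j}) ` ?F = range (\<lambda>\<beta>. {i\<in>I. c i + (\<Sum>k\<in>K. \<beta> k * a k i) \<ge> 0})"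
    unfolding image_image pat_def L_def using insert.hyps by (intro image_cong) auto
  then have tr: "card ((\<lambda>A. A - {j}) ` ?F) \<le> (card I + 1) ^ card K"
    using insert.IH[OF insert.prems, of c a] by simp
  \<comment> \<open>Two cells that differ only in the sign of form \<open>j\<close> share a wall:
    the segment between points of these cells crosses hyperplane \<open>j\<close>, and by convexity
    all other signs persist along it.\<close>
  have zero: "\<exists>\<beta>. L \<beta> j = 0 \<and> {i\<in>I. L \<beta> i \<ge> 0} = A" if A: "A \<in> ?G" for A
  proof -
    from A obtain \<beta>0 \<beta>1 where b: "A = pat \<beta>0" "insert j A = pat \<beta>1" "j \<notin> A" by auto
    have n0: "L \<beta>0 j < 0" and n1: "L \<beta>1 j \<ge> 0" using b unfolding pat_def by auto
    \<comment> \<open>The zero of the affine function \<open>L _ j\<close> on the segment.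
      \<open>L \<beta>1 j = 0\<close> is possible and gives \<open>t = 1\<close>;
      \<open>0 < t\<close> is what keeps the negative forms strictly negative.\<close>
    define t where "t = L \<beta>0 j / (L \<beta>0 j - L \<beta>1 j)"
    have t: "0 < t" "t \<le> 1" unfolding t_def using n0 n1 by (auto simp: divide_simps)
    define \<beta> where "\<beta> k = (1 - t) * \<beta>0 k + t * \<beta>1 k" for k
    have L: "L \<beta> i = (1 - t) * L \<beta>0 i + t * L \<beta>1 i" for i
      unfolding L_def \<beta>_def by (simp add: algebra_simps sum.distrib sum_distrib_left sum_subtractf)
    have "L \<beta> j = 0" unfolding L t_def using n0 n1 by (simp add: field_simps)
    moreover have "{i\<in>I. L \<beta> i \<ge> 0} = A"
    proof -
      have "L \<beta> i \<ge> 0 \<longleftrightarrow> i \<in> A" if i: "i \<in> I" for i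
      proof -
        have "i \<noteq> j" using i insert.hyps by auto
        then have m: "i \<in> pat \<beta>0 \<longleftrightarrow> i \<in> A" "i \<in> pat \<beta>1 \<longleftrightarrow> i \<in> A"
          using b(1,2) by blast+
        have s: "i \<in> A \<longleftrightarrow> L \<beta>0 i \<ge> 0" "i \<in> A \<longleftrightarrow> L \<beta>1 i \<ge> 0"
          using m i by (simp_all add: pat_def)
        show ?thesis
        proof (cases "i \<in> A")
          case True
          then have "L \<beta>0 i \<ge> 0" "L \<beta>1 i \<ge> 0" using s by auto
          then show ?thesis using True t unfolding L by simp
        next
          case False
          then have "L \<beta>0 i < 0" "L \<beta>1 i < 0" using s by auto
          then have "(1 - t) * L \<beta>0 i \<le> 0" "t * L \<beta>1 i < 0" using t
            by (auto simp: mult_le_0_iff mult_less_0_iff)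
          then show ?thesis using False unfolding L by simp
        qed
      qed
      moreover have "A \<subseteq> insert j I" unfolding b(1) pat_def by blast
      then have "A \<subseteq> I" using b(3) by blast
      ultimately show ?thesis by auto
    qed
    ultimately show ?thesis by blast
  qed
  show ?case
  proof (cases "\<exists>k0\<in>K. a k0 j \<noteq> 0")
    \<comment> \<open>A degenerate hyperplane: form \<open>j\<close> does not depend on
      \<open>\<beta>\<close>, its sign never changes and no cell is split.\<close>
    case False
    then have "L \<beta> j = c j" for \<beta> unfolding L_def by simp
    then have "j \<in> A \<longleftrightarrow> c j \<ge> 0" if "A \<in> ?F" for A
      using that unfolding pat_def by fastforce
    then have "?G = {}" by (metis (no_types, lifting) empty_Collect_eq insertI1)
    then have "card ?G = 0" by (simp only: card.empty)
    then have "card ?F \<le> (card I + 1) ^ card K"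
      using card_le_card_traces[OF finF, of j] tr by linarith
    also have "\<dots> \<le> (card (insert j I) + 1) ^ card K" using insert.hyps by (intro power_mono) auto
    finally show ?thesis unfolding pat_def L_def .
  next
    case True
    then obtain k0 where k0: "k0 \<in> K" "a k0 j \<noteq> 0" by blast
    \<comment> \<open>Solving \<open>L \<beta> j = 0\<close> for \<open>\<beta> k0\<close> and
      substituting the result: \<open>a'\<close> and \<open>c'\<close> are the coefficients of the
      remaining forms on the hyperplane, with one parameter fewer.\<close>
    define a' where "a' k i = a k i - a k0 i * a k j / a k0 j" for k i
    define c' where "c' i = c i - a k0 i * c j / a k0 j" for i
    have "?G \<subseteq> range (\<lambda>\<beta>. {i\<in>I. c' i + (\<Sum>k\<in>K-{k0}. \<beta> k * a' k i) \<ge> 0})"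
    proof
      fix A assume A: "A \<in> ?G"
      obtain \<beta> where \<beta>: "L \<beta> j = 0" "{i\<in>I. L \<beta> i \<ge> 0} = A" using zero[OF A] by blast
      have split: "L \<beta> i = c i + \<beta> k0 * a k0 i + (\<Sum>k\<in>K-{k0}. \<beta> k * a k i)" for i
        unfolding L_def using insert.prems k0 by (simp add: sum.remove)
      have \<beta>k0: "\<beta> k0 = - (c j + (\<Sum>k\<in>K-{k0}. \<beta> k * a k j)) / a k0 j"
        using \<beta>(1) k0 unfolding split by (simp add: field_simps)
      have eq: "L \<beta> i = c' i + (\<Sum>k\<in>K-{k0}. \<beta> k * a' k i)" for i
      proof -
        have "(\<Sum>k\<in>K-{k0}. \<beta> k * a' k i) = (\<Sum>k\<in>K-{k0}. \<beta> k * a k i)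
            - (\<Sum>k\<in>K-{k0}. \<beta> k * a k j) * (a k0 i / a k0 j)"
          unfolding a'_def by (simp add: algebra_simps sum_subtractf sum_distrib_left sum_divide_distrib)
        then show ?thesis unfolding split \<beta>k0 c'_def using k0(2) by (simp add: field_simps)
      qed
      show "A \<in> range (\<lambda>\<beta>. {i\<in>I. c' i + (\<Sum>k\<in>K-{k0}. \<beta> k * a' k i) \<ge> 0})"
        by (rule range_eqI, rule \<beta>(2)[unfolded eq, symmetric])
    qed
    moreover have "finite (range (\<lambda>\<beta>. {i\<in>I. c' i + (\<Sum>k\<in>K-{k0}. \<beta> k * a' k i) \<ge> 0}))"
    proof (rule finite_subset)
      show "range (\<lambda>\<beta>. {i\<in>I. c' i + (\<Sum>k\<in>K-{k0}. \<beta> k * a' k i) \<ge> 0}) \<subseteq> Pow I" by blast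
    qed (simp add: insert.hyps(1))
    ultimately have "card ?G \<le> card (range (\<lambda>\<beta>. {i\<in>I. c' i + (\<Sum>k\<in>K-{k0}. \<beta> k * a' k i) \<ge> 0}))"
      by (rule card_mono[rotated])
    also have "\<dots> \<le> (card I + 1) ^ card (K - {k0})"
      by (rule insert.IH) (simp add: insert.prems)
    finally have "card ?G \<le> (card I + 1) ^ card (K - {k0})" .
    \<comment> \<open>With \<open>N = card I\<close> and \<open>k = card K\<close> the recursion is
      \<open>(N + 1) ^ k + (N + 1) ^ (k - 1) = (N + 1) ^ (k - 1) * (N + 2)\<close>, which is at most
      \<open>(N + 2) ^ k\<close>.\<close>
    then have "card ?F \<le> (card I + 1) ^ card K + (card I + 1) ^ (card K - 1)"
      using card_le_card_traces[OF finF, of j] tr unfolding card_Diff_singleton[OF k0(1)] by linarith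
    also have "\<dots> = (card I + 1) ^ (card K - 1) * (card I + 2)"
      using k0 insert.prems by (cases "card K") auto
    also have "\<dots> \<le> (card I + 2) ^ (card K - 1) * (card I + 2)"
      by (intro mult_right_mono power_mono) auto
    also have "\<dots> = (card (insert j I) + 1) ^ card K"
      using k0 insert.prems insert.hyps by (cases "card K") auto
    finally show ?thesis unfolding pat_def L_def .
  qed
qed

section \<open>Exponential moments of Rademacher sums\<close>

lemma cosh_le_exp_square:
  fixes x :: real
  assumes "\<bar>x\<bar> \<le> 1"
  shows "exp x + exp (- x) \<le> 2 * exp (x\<^sup>2)"
proof -
  \<comment> \<open>Quadratic upper bounds for exp on [0, 1] are enough. They give the exponent
    \<open>x\<^sup>2\<close> where the sharp one is half of it, a loss that only affects
    constants.\<close>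
  have *: "exp y + exp (- y) \<le> 2 * exp (y\<^sup>2)" if y: "0 \<le> y" "y \<le> 1" for y :: real
  proof -
    have "exp y \<le> 1 + y + y\<^sup>2" using exp_bound[OF y] .
    moreover have "exp (- y) \<le> 1 - y + y\<^sup>2"
    proof -
      \<comment> \<open>The product on the right is \<open>1 + y ^ 3\<close>.\<close>
      have "1 \<le> (1 - y + y\<^sup>2) * (1 + y)" using y by (simp add: algebra_simps power2_eq_square)
      also have "\<dots> \<le> (1 - y + y\<^sup>2) * exp y"
        using y exp_ge_add_one_self[of y] by (intro mult_left_mono) auto
      finally show ?thesis by (simp add: exp_minus divide_simps)
    qed
    ultimately show ?thesis using exp_ge_add_one_self[of "y\<^sup>2"] by linarith
  qed
  show ?thesis
  proof (cases "x \<ge> 0")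
    case True then show ?thesis using * assms by auto
  next
    case False then show ?thesis using *[of "-x"] assms by auto
  qed
qed

text \<open>The set \<open>A\<close> collects the indices with negative Rademacher sign.\<close>

lemma sum_Pow_exp_rademacher:
  fixes u v :: "nat \<Rightarrow> real"
  assumes "\<And>i. i < n \<Longrightarrow> \<bar>u i\<bar> \<le> 1" "\<And>i. i < n \<Longrightarrow> (u i)\<^sup>2 \<le> v i"
  shows "(\<Sum>A\<in>Pow {..<n}. exp (\<Sum>i<n. (if i \<in> A then - u i else u i) - v i)) \<le> 2 ^ n"
proof -
  have "(\<Sum>A\<in>Pow {..<n}. exp (\<Sum>i<n. (if i \<in> A then - u i else u i) - v i))
      = (\<Sum>A\<in>Pow {..<n}. (\<Prod>i\<in>A. exp (- u i - v i)) * (\<Prod>i\<in>{..<n} - A. exp (u i - v i)))"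
  proof (intro sum.cong refl)
    fix A assume "A \<in> Pow {..<n}"
    then have A: "A \<subseteq> {..<n}" by auto
    have "exp (\<Sum>i<n. (if i \<in> A then - u i else u i) - v i)
        = (\<Prod>i<n. exp ((if i \<in> A then - u i else u i) - v i))" by (simp add: exp_sum)
    also have "\<dots> = (\<Prod>i\<in>A. exp ((if i \<in> A then - u i else u i) - v i)) *
        (\<Prod>i\<in>{..<n}-A. exp ((if i \<in> A then - u i else u i) - v i))"
      using A by (metis (no_types, lifting) finite_lessThan mult.commute prod.subset_diff)
    finally show "exp (\<Sum>i<n. (if i \<in> A then - u i else u i) - v i)
       = (\<Prod>i\<in>A. exp (- u i - v i)) * (\<Prod>i\<in>{..<n} - A. exp (u i - v i))" by simp
  qed
  \<comment> \<open>Expanding a product of two-term sums runs over all subsets; this is the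
    independence of the signs.\<close>
  also have "\<dots> = (\<Prod>i<n. exp (- u i - v i) + exp (u i - v i))"
    by (simp add: prod_add)
  also have "\<dots> \<le> (\<Prod>i<n. 2)"
  proof (rule prod_mono, intro conjI)
    fix i assume i: "i \<in> {..<n}"
    have "exp (- u i - v i) + exp (u i - v i) = (exp (u i) + exp (- u i)) * exp (- v i)"
      by (simp add: algebra_simps flip: exp_add)
    also have "\<dots> \<le> (2 * exp ((u i)\<^sup>2)) * exp (- v i)"
      using assms i by (intro mult_right_mono cosh_le_exp_square) auto
    also have "\<dots> = 2 * exp ((u i)\<^sup>2 - v i)" by (simp flip: exp_add)
    also have "\<dots> \<le> 2 * exp 0" using assms i by (simp)
    finally show "exp (- u i - v i) + exp (u i - v i) \<le> 2" by simp
  qed (simp add: add_nonneg_nonneg)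
  finally show ?thesis by simp
qed

subsection \<open>Least squares over clipped linear classes\<close>

lemma clip01_bounds: "0 \<le> clip01 x" "clip01 x \<le> 1"
  by (auto simp: clip01_def)

lemma clip01_measurable [measurable]: "clip01 \<in> borel_measurable borel"
  unfolding clip01_def by measurable

lemma continuous_clip01: "isCont clip01 x"
  unfolding clip01_def by (intro continuous_intros)

lemma abs_clip01_diff_le:
  assumes y: "0 \<le> y" "y \<le> 1"
  shows "\<bar>clip01 x - y\<bar> \<le> \<bar>x - y\<bar>"
  using assms by (auto simp: clip01_def)

text \<open>The thresholds j / n cut [0, 1] into pieces of length 1 / n. For linear combinations,
  comparison with a threshold is the sign of an affine form in the coefficients, so this is what
  turns sign patterns into a cover in sup norm.\<close>

lemma clip01_close_if_same_levels:
  fixes x y :: real and n :: nat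
  assumes n: "n \<ge> 1"
    and same: "\<And>j. j \<in> {1..n} \<Longrightarrow> x \<ge> real j / real n \<longleftrightarrow> y \<ge> real j / real n"
  shows "clip01 x \<le> clip01 y + 1 / real n"
proof (rule ccontr)
  assume "\<not> ?thesis"
  then have lt: "clip01 y + 1 / real n < clip01 x" by simp
  \<comment> \<open>The first grid index strictly above \<open>real n * clip01 y\<close>. If the
    claim failed, the grid point \<open>j / n\<close> would separate the two clipped values.\<close>
  define j where "j = nat \<lfloor>real n * clip01 y\<rfloor> + 1"
  have f: "real (nat \<lfloor>real n * clip01 y\<rfloor>) = of_int \<lfloor>real n * clip01 y\<rfloor>"
    using clip01_bounds[of y] by simp
  have j1: "real j > real n * clip01 y" unfolding j_def of_nat_add f by linarith
  have j2: "real j \<le> real n * clip01 y + 1" unfolding j_def of_nat_add f by linarith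
  have "real n * clip01 y + 1 < real n * clip01 x" using lt n by (simp add: field_simps)
  then have j3: "real j < real n * clip01 x" using j2 by linarith
  also have "\<dots> \<le> real n" using clip01_bounds[of x] by (simp add: mult_left_le)
  finally have "j \<le> n" by simp
  then have jin: "j \<in> {1..n}" unfolding j_def by simp
  have jx: "real j / real n < clip01 x" using j3 n by (simp add: field_simps)
  have "0 < real j / real n" using n jin by simp
  then have "real j / real n \<le> x" using jx by (auto simp: clip01_def max_def min_def split: if_splits)
  then have "real j / real n \<le> y" using same[OF jin] by simp
  moreover have "real j / real n \<le> 1" using jin n by simp
  ultimately have "real j / real n \<le> clip01 y" by (simp add: clip01_def)
  then show False using j1 n by (simp add: field_simps)
qed

text \<open>Here \<open>\<eta>\<close> is the conditional mean of \<open>Z\<close> given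
  \<open>S\<close>. The assumption \<open>regression\<close> expresses this by bounded test
  functions of \<open>S\<close>, so that the estimation argument never has to handle a conditional
  expectation operator.\<close>

locale clipped_regression = prob_space L
  for L :: "'z measure" +
  fixes N :: "'s measure" and S :: "'z \<Rightarrow> 's" and Z :: "'z \<Rightarrow> real" and \<eta> :: "'s \<Rightarrow> real"
    and \<phi> :: "'k \<Rightarrow> 's \<Rightarrow> real" and K :: "'k set"
  assumes S_measurable [measurable]: "S \<in> L \<rightarrow>\<^sub>M N"
    and Z_measurable [measurable]: "Z \<in> borel_measurable L"
    and Z01: "0 \<le> Z z" "Z z \<le> 1"
    and eta_measurable [measurable]: "\<eta> \<in> borel_measurable N"
    and eta01: "0 \<le> \<eta> s" "\<eta> s \<le> 1"
    and phi_measurable: "k \<in> K \<Longrightarrow> \<phi> k \<in> borel_measurable N"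
    and finite_K: "finite K"
    and regression: "\<psi> \<in> borel_measurable N \<Longrightarrow> (\<And>s. \<bar>\<psi> s\<bar> \<le> 1) \<Longrightarrow>
      (\<integral>z. Z z * \<psi> (S z) \<partial>L) = (\<integral>z. \<eta> (S z) * \<psi> (S z) \<partial>L)"
begin

definition clin :: "('k \<Rightarrow> real) \<Rightarrow> 's \<Rightarrow> real" where
  "clin \<beta> s = clip01 (\<Sum>k\<in>K. \<beta> k * \<phi> k s)"

definition ell :: "('s \<Rightarrow> real) \<Rightarrow> 'z \<Rightarrow> real" where
  "ell q z = (Z z - q (S z))\<^sup>2 - (Z z - \<eta> (S z))\<^sup>2"

definition risk :: "('s \<Rightarrow> real) \<Rightarrow> real" where
  "risk q = (\<integral>z. (q (S z) - \<eta> (S z))\<^sup>2 \<partial>L)"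

text \<open>Entries below \<open>n\<close> are the sample, the remaining ones a ghost sample. The negative
  quadratic term comes from the Bernstein condition \<open>E ell\<^sup>2 \<le> 4 E ell\<close>.\<close>

definition Q :: "nat \<Rightarrow> ('s \<Rightarrow> real) \<Rightarrow> (nat \<Rightarrow> 'z) \<Rightarrow> real" where
  "Q n q \<omega> = (\<Sum>i<n. 2 * ell q (\<omega> (n + i)) - (ell q (\<omega> (n + i)))\<^sup>2 / 4 - 2 * ell q (\<omega> i))"

definition swap_ghost :: "nat \<Rightarrow> nat set \<Rightarrow> nat \<Rightarrow> nat" where
  "swap_ghost n A i = (if i < n then (if i \<in> A then n + i else i) else (if i - n \<in> A then i - n else i))"

lemma clin_measurable [measurable]: "clin \<beta> \<in> borel_measurable N"
  unfolding clin_def[abs_def] using phi_measurable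
  by (intro measurable_compose[OF _ clip01_measurable] borel_measurable_sum borel_measurable_times) auto

lemma clin01: "0 \<le> clin \<beta> s" "clin \<beta> s \<le> 1"
  unfolding clin_def by (rule clip01_bounds)+

lemma ell_alt: "ell q z = (\<eta> (S z) - q (S z)) * (2 * Z z - q (S z) - \<eta> (S z))"
  unfolding ell_def by (simp add: power2_eq_square algebra_simps)

lemma abs_ell_le: 
  assumes "0 \<le> q (S z)" "q (S z) \<le> 1"
  shows "\<bar>ell q z\<bar> \<le> 1"
proof -
  have "(Z z - q (S z))\<^sup>2 \<le> 1" "(Z z - \<eta> (S z))\<^sup>2 \<le> 1"
    using assms Z01[of z] eta01[of "S z"] by (auto simp: abs_square_le_1 abs_if)
  then show ?thesis unfolding ell_def using zero_le_power2[of "Z z - q (S z)"] zero_le_power2[of "Z z - \<eta> (S z)"]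
    by linarith
qed

text \<open>The pointwise half of the Bernstein condition: \<open>ell\<close> is the difference of
  the two predictions times a factor bounded by 2. The mean of the right side is four times the
  risk, which \<open>integral_ell\<close> identifies with the mean of \<open>ell\<close>.\<close>

lemma ell_square_le:
  assumes "0 \<le> q (S z)" "q (S z) \<le> 1"
  shows "(ell q z)\<^sup>2 \<le> 4 * (q (S z) - \<eta> (S z))\<^sup>2"
proof -
  have "\<bar>2 * Z z - q (S z) - \<eta> (S z)\<bar> \<le> 2"
    using assms Z01[of z] eta01[of "S z"] by (simp add: abs_if)
  then have "(2 * Z z - q (S z) - \<eta> (S z))\<^sup>2 \<le> 2\<^sup>2" by (metis abs_le_square_iff abs_numeral)
  then have "(\<eta> (S z) - q (S z))\<^sup>2 * (2 * Z z - q (S z) - \<eta> (S z))\<^sup>2 \<le> (\<eta> (S z) - q (S z))\<^sup>2 * 4"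
    by (intro mult_left_mono) auto
  then show ?thesis unfolding ell_alt power_mult_distrib by (simp add: power2_commute)
qed

lemma abs_ell_diff_le:
  assumes "0 \<le> q (S z)" "q (S z) \<le> 1" "0 \<le> q' (S z)" "q' (S z) \<le> 1" "\<bar>q (S z) - q' (S z)\<bar> \<le> e"
  shows "\<bar>ell q z - ell q' z\<bar> \<le> 2 * e"
proof -
  have e: "0 \<le> e" using assms(5) by (meson abs_ge_zero order_trans)
  have "ell q z - ell q' z = (q' (S z) - q (S z)) * (2 * Z z - q (S z) - q' (S z))"
    unfolding ell_def by (simp add: power2_eq_square algebra_simps)
  also have "\<bar>\<dots>\<bar> = \<bar>q (S z) - q' (S z)\<bar> * \<bar>2 * Z z - q (S z) - q' (S z)\<bar>"
    by (simp add: abs_mult abs_minus_commute)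
  also have "\<dots> \<le> e * 2"
    using assms e Z01[of z] by (intro mult_mono) (auto simp: abs_if)
  finally show ?thesis by simp
qed

lemma ell_measurable:
  assumes [measurable]: "q \<in> borel_measurable N"
  shows "ell q \<in> borel_measurable L"
  unfolding ell_def[abs_def] by measurable

text \<open>The excess loss is \<open>(q - \<eta>)\<^sup>2\<close> plus the cross term
  \<open>2 * (\<eta> - Z) * (q - \<eta>)\<close>, and the cross term vanishes on average by
  \<open>regression\<close>.\<close>

lemma integral_ell:
  assumes [measurable]: "q \<in> borel_measurable N" and q: "\<And>s. 0 \<le> q s" "\<And>s. q s \<le> 1"
  shows "(\<integral>z. ell q z \<partial>L) = risk q"
proof -
  have b: "\<bar>q s - \<eta> s\<bar> \<le> 1" for s
    using q[of s] eta01[of s] by (simp add: abs_le_iff)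
  have i1: "integrable L (\<lambda>z. Z z * (q (S z) - \<eta> (S z)))"
  proof (rule integrable_const_bound[where B=1])
    show "AE z in L. norm (Z z * (q (S z) - \<eta> (S z))) \<le> 1"
      using Z01 b by (auto simp: abs_mult intro!: mult_le_one)
  qed measurable
  have i2: "integrable L (\<lambda>z. \<eta> (S z) * (q (S z) - \<eta> (S z)))"
  proof (rule integrable_const_bound[where B=1])
    show "AE z in L. norm (\<eta> (S z) * (q (S z) - \<eta> (S z))) \<le> 1"
      using eta01 b by (auto simp: abs_mult intro!: mult_le_one)
  qed measurable
  have i3: "integrable L (\<lambda>z. (q (S z) - \<eta> (S z))\<^sup>2)"
  proof (rule integrable_const_bound[where B=1])
    show "AE z in L. norm ((q (S z) - \<eta> (S z))\<^sup>2) \<le> 1"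
      using b by (simp add: abs_square_le_1)
  qed measurable
  have "(\<integral>z. ell q z \<partial>L) = (\<integral>z. (q (S z) - \<eta> (S z))\<^sup>2
      + 2 * (\<eta> (S z) * (q (S z) - \<eta> (S z))) - 2 * (Z z * (q (S z) - \<eta> (S z))) \<partial>L)"
    unfolding ell_def by (intro Bochner_Integration.integral_cong) (auto simp: power2_eq_square algebra_simps)
  also have "\<dots> = risk q + 2 * (\<integral>z. \<eta> (S z) * (q (S z) - \<eta> (S z)) \<partial>L)
      - 2 * (\<integral>z. Z z * (q (S z) - \<eta> (S z)) \<partial>L)"
    unfolding risk_def using i1 i2 i3 by simp
  also have "(\<integral>z. Z z * (q (S z) - \<eta> (S z)) \<partial>L) = (\<integral>z. \<eta> (S z) * (q (S z) - \<eta> (S z)) \<partial>L)"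
    using b by (intro regression) measurable
  finally show ?thesis by simp
qed

text \<open>The penalty of \<open>Q\<close> sits on the ghost points alone. It is divided into a
  part that changes sign when \<open>i\<close> and \<open>n + i\<close> are exchanged and a part
  that the exchange leaves alone; only in this form can random signs be introduced.\<close>

lemma Q_symmetric_form:
  "Q n q \<omega> = (\<Sum>i<n. (2 * ell q (\<omega> (n + i)) - (ell q (\<omega> (n + i)))\<^sup>2 / 8
      - (2 * ell q (\<omega> i) - (ell q (\<omega> i))\<^sup>2 / 8))
      - ((ell q (\<omega> (n + i)))\<^sup>2 + (ell q (\<omega> i))\<^sup>2) / 8)"
  unfolding Q_def by (intro sum.cong refl) (simp add: field_simps)

text \<open>The reason for the radius 1 / n: \<open>Q\<close> has \<open>n\<close> summands, so such
  a change costs a constant, independent of \<open>n\<close>.\<close>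

lemma Q_Lipschitz:
  assumes q: "\<And>s. 0 \<le> q s" "\<And>s. q s \<le> 1" "\<And>s. 0 \<le> q' s" "\<And>s. q' s \<le> 1"
    and close: "\<And>i. i < 2 * n \<Longrightarrow> \<bar>q (S (\<omega> i)) - q' (S (\<omega> i))\<bar> \<le> 1 / n"
  shows "Q n q \<omega> \<le> Q n q' \<omega> + 10"
proof -
  have sq: "a\<^sup>2 \<le> b\<^sup>2 + 2 * \<bar>b - a\<bar>" if "\<bar>a\<bar> \<le> 1" "\<bar>b\<bar> \<le> 1" for a b :: real
  proof -
    have "a\<^sup>2 - b\<^sup>2 = (a - b) * (a + b)" by (simp add: power2_eq_square algebra_simps)
    also have "\<dots> \<le> \<bar>a - b\<bar> * \<bar>a + b\<bar>" by (metis abs_ge_self abs_mult)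
    also have "\<dots> \<le> \<bar>a - b\<bar> * 2" using that by (intro mult_left_mono) auto
    finally show ?thesis by (simp add: abs_minus_commute)
  qed
  have "Q n q \<omega> - Q n q' \<omega> = (\<Sum>i<n. (2 * ell q (\<omega> (n + i)) - (ell q (\<omega> (n + i)))\<^sup>2 / 4 - 2 * ell q (\<omega> i)) -
     (2 * ell q' (\<omega> (n + i)) - (ell q' (\<omega> (n + i)))\<^sup>2 / 4 - 2 * ell q' (\<omega> i)))"
    unfolding Q_def by (simp add: sum_subtractf)
  \<comment> \<open>Each of the two linear terms changes by at most 4 / n and the penalty by at most
    1 / n, so 10 / n leaves some room.\<close>
  also have "\<dots> \<le> (\<Sum>i<n. 10 / real n)"
  proof (rule sum_mono)
    fix i assume i: "i \<in> {..<n}"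
    have *: "\<bar>ell q (\<omega> j) - ell q' (\<omega> j)\<bar> \<le> 2 * (1 / n)" if "j < 2 * n" for j
      using that q close[OF that] by (intro abs_ell_diff_le) auto
    have d1: "\<bar>ell q (\<omega> (n + i)) - ell q' (\<omega> (n + i))\<bar> \<le> 2 * (1 / n)" using i by (intro *) auto
    have d2: "\<bar>ell q (\<omega> i) - ell q' (\<omega> i)\<bar> \<le> 2 * (1 / n)" using i by (intro *) auto
    have d3: "(ell q' (\<omega> (n + i)))\<^sup>2 \<le> (ell q (\<omega> (n + i)))\<^sup>2 + 2 * \<bar>ell q (\<omega> (n + i)) - ell q' (\<omega> (n + i))\<bar>"
      using q by (intro sq abs_ell_le)
    have r: "10 / real n = 10 * (1 / real n)" by simp
    have "0 \<le> 1 / real n" by simp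
    with d1 d2 d3 show "(2 * ell q (\<omega> (n + i)) - (ell q (\<omega> (n + i)))\<^sup>2 / 4 - 2 * ell q (\<omega> i)) -
     (2 * ell q' (\<omega> (n + i)) - (ell q' (\<omega> (n + i)))\<^sup>2 / 4 - 2 * ell q' (\<omega> i)) \<le> 10 / real n"
      unfolding r by argo
  qed
  also have "\<dots> \<le> 10" by simp
  finally show ?thesis by simp
qed

lemma Q_swap:
  "Q n q (\<lambda>i\<in>{..<2*n}. \<omega> (swap_ghost n A i)) =
    (\<Sum>i<n. (if i \<in> A then - (2 * ell q (\<omega> (n + i)) - (ell q (\<omega> (n + i)))\<^sup>2 / 8
        - (2 * ell q (\<omega> i) - (ell q (\<omega> i))\<^sup>2 / 8))
        else (2 * ell q (\<omega> (n + i)) - (ell q (\<omega> (n + i)))\<^sup>2 / 8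
        - (2 * ell q (\<omega> i) - (ell q (\<omega> i))\<^sup>2 / 8)))
      - ((ell q (\<omega> (n + i)))\<^sup>2 + (ell q (\<omega> i))\<^sup>2) / 8)"
  unfolding Q_symmetric_form by (intro sum.cong refl) (auto simp: swap_ghost_def)

lemma sum_exp_Q_swap_le:
  assumes q: "\<And>s. 0 \<le> q s" "\<And>s. q s \<le> 1"
  shows "(\<Sum>A\<in>Pow {..<n}. exp (Q n q (\<lambda>i\<in>{..<2*n}. \<omega> (swap_ghost n A i)) / 80)) \<le> 2 ^ n"
proof -
  define w where "w i = 2 * ell q (\<omega> i) - (ell q (\<omega> i))\<^sup>2 / 8" for i
  \<comment> \<open>Origin of 80: the squared difference of the \<open>w\<close> is at most 10 times
    the sum of the two squared losses, and the symmetric penalty carries the factor 1/8. Scaling by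
    1/80 turns 10 into \<open>10 / 80\<^sup>2\<close>, which is exactly
    \<open>1 / (8 * 80) = 1 / 640\<close>.\<close>
  define u where "u i = (w (n + i) - w i) / 80" for i
  define v where "v i = ((ell q (\<omega> (n + i)))\<^sup>2 + (ell q (\<omega> i))\<^sup>2) / 640" for i
  \<comment> \<open>Since \<open>ell\<close> is at most 1 in absolute value, its square is at most
    \<open>\<bar>ell\<bar>\<close>, and \<open>17/8 = 2 + 1/8\<close>.\<close>
  have w: "\<bar>w i\<bar> \<le> 17/8 * \<bar>ell q (\<omega> i)\<bar>" for i
  proof -
    have "(ell q (\<omega> i))\<^sup>2 = \<bar>ell q (\<omega> i)\<bar> * \<bar>ell q (\<omega> i)\<bar>" by (simp add: power2_eq_square)
    also have "\<dots> \<le> \<bar>ell q (\<omega> i)\<bar> * 1" using abs_ell_le[of q "\<omega> i"] q by (intro mult_left_mono) auto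
    finally have "(ell q (\<omega> i))\<^sup>2 \<le> \<bar>ell q (\<omega> i)\<bar>" by simp
    then show ?thesis unfolding w_def using zero_le_power2[of "ell q (\<omega> i)"] by argo
  qed
  have e1: "\<bar>ell q (\<omega> i)\<bar> \<le> 1" for i using q by (intro abs_ell_le)
  have u1: "\<bar>u i\<bar> \<le> 1" for i
  proof -
    have "\<bar>w (n+i) - w i\<bar> \<le> 80" using w[of i] w[of "n+i"] e1[of i] e1[of "n+i"] by linarith
    then show ?thesis unfolding u_def by simp
  qed
  have u2: "(u i)\<^sup>2 \<le> v i" for i
  proof -
    have "\<bar>w (n+i) - w i\<bar> \<le> 17/8 * (\<bar>ell q (\<omega> (n+i))\<bar> + \<bar>ell q (\<omega> i)\<bar>)"
      using w[of i] w[of "n+i"] abs_triangle_ineq4[of "w (n+i)" "w i"] unfolding distrib_left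
      by (meson add_mono order_trans)
    then have "(w (n+i) - w i)\<^sup>2 \<le> (17/8 * (\<bar>ell q (\<omega> (n+i))\<bar> + \<bar>ell q (\<omega> i)\<bar>))\<^sup>2"
      by (metis abs_ge_zero abs_le_square_iff abs_of_nonneg order_trans)
    also have "\<dots> = 289/64 * (\<bar>ell q (\<omega> (n+i))\<bar> + \<bar>ell q (\<omega> i)\<bar>)\<^sup>2" by (simp only: power_mult_distrib) (simp add: power_divide)
    also have "(\<bar>ell q (\<omega> (n+i))\<bar> + \<bar>ell q (\<omega> i)\<bar>)\<^sup>2 \<le> 2 * ((ell q (\<omega> (n+i)))\<^sup>2 + (ell q (\<omega> i))\<^sup>2)"
      using zero_le_power2[of "\<bar>ell q (\<omega> (n+i))\<bar> - \<bar>ell q (\<omega> i)\<bar>"]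
      by (simp add: power2_sum power2_diff)
    finally have "(w (n+i) - w i)\<^sup>2 \<le> 289/64 * (2 * ((ell q (\<omega> (n+i)))\<^sup>2 + (ell q (\<omega> i))\<^sup>2))" by simp
    then have "(w (n+i) - w i)\<^sup>2 \<le> 10 * ((ell q (\<omega> (n+i)))\<^sup>2 + (ell q (\<omega> i))\<^sup>2)"
      using sum_power2_ge_zero[of "ell q (\<omega> (n+i))" "ell q (\<omega> i)"] by argo
    then show ?thesis unfolding u_def v_def by (simp add: power_divide)
  qed
  have "Q n q (\<lambda>i\<in>{..<2*n}. \<omega> (swap_ghost n A i)) / 80 = (\<Sum>i<n. (if i \<in> A then - u i else u i) - v i)" for A
    unfolding Q_swap sum_divide_distrib u_def v_def w_def by (intro sum.cong refl) (auto simp: field_simps)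
  then show ?thesis using sum_Pow_exp_rademacher[of n u v] u1 u2 by simp
qed

text \<open>Passing from one function to the whole class costs the number of sign patterns on the
  double sample. The patterns are formed before any exchange, so one list of representatives serves
  every \<open>A\<close>, and the average over \<open>A\<close> can be taken for each representative
  separately.\<close>

lemma sum_SUP_exp_Q_swap_le:
  assumes n: "n \<ge> 1"
  shows "(\<Sum>A\<in>Pow {..<n}. SUP \<beta>\<in>B. ennreal (exp (Q n (clin \<beta>) (\<lambda>i\<in>{..<2*n}. \<omega> (swap_ghost n A i)) / 80)))
     \<le> ennreal (2 ^ n * (exp (1/8) * real ((2 * n * n + 1) ^ card K)))"
proof -
  \<comment> \<open>One affine form for every point of the double sample and every threshold j / n,
    hence \<open>2 * n * n\<close> forms in \<open>card K\<close> coefficients.\<close>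
  let ?I = "{..<2*n} \<times> {1..n}"
  define pat where "pat \<beta> = {x\<in>?I. (case x of (i, j) \<Rightarrow> - (real j / real n)) +
    (\<Sum>k\<in>K. \<beta> k * (case x of (i, j) \<Rightarrow> \<phi> k (S (\<omega> i)))) \<ge> 0}" for \<beta>
  define rep where "rep p = (SOME \<beta>. pat \<beta> = p)" for p
  define R where "R = range pat"
  have rep: "pat (rep (pat \<beta>)) = pat \<beta>" for \<beta> unfolding rep_def by (rule someI[where P = "\<lambda>\<beta>'. pat \<beta>' = pat \<beta>"]) (rule refl)
  have finR: "finite R"
    unfolding R_def by (rule finite_subset[of _ "Pow ?I"]) (auto simp: pat_def)
  have "card R \<le> (card ?I + 1) ^ card K"
    unfolding R_def pat_def by (rule card_sign_patterns) (auto simp: finite_K)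
  then have cR: "card R \<le> (2 * n * n + 1) ^ card K" by (simp add: card_cartesian_product)
  define \<omega>' where "\<omega>' A = (\<lambda>i\<in>{..<2*n}. \<omega> (swap_ghost n A i))" for A
  have level: "(i, j) \<in> pat \<beta> \<longleftrightarrow> (\<Sum>k\<in>K. \<beta> k * \<phi> k (S (\<omega> i))) \<ge> real j / real n"
    if "i < 2 * n" "j \<in> {1..n}" for i j \<beta>
    using that unfolding pat_def by auto
  have close1: "clin \<beta> (S (\<omega> i)) \<le> clin \<beta>' (S (\<omega> i)) + 1 / n" if "i < 2 * n" "pat \<beta> = pat \<beta>'" for i \<beta> \<beta>'
    unfolding clin_def using n
  proof (rule clip01_close_if_same_levels)
    fix j assume j: "j \<in> {1..n}"
    show "(\<Sum>k\<in>K. \<beta> k * \<phi> k (S (\<omega> i))) \<ge> real j / real n \<longleftrightarrow> (\<Sum>k\<in>K. \<beta>' k * \<phi> k (S (\<omega> i))) \<ge> real j / real n"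
      using level[OF that(1) j, of \<beta>] level[OF that(1) j, of \<beta>'] that(2) by simp
  qed
  \<comment> \<open>An exchanged sample uses the same \<open>2 * n\<close> points, so closeness on
    \<open>\<omega>\<close> is closeness on every \<open>\<omega>' A\<close>.\<close>
  have sw: "swap_ghost n A i < 2 * n" if "i < 2 * n" for A i
    using that unfolding swap_ghost_def by auto
  have le: "exp (Q n (clin \<beta>) (\<omega>' A) / 80) \<le> exp (1/8) * (\<Sum>p\<in>R. exp (Q n (clin (rep p)) (\<omega>' A) / 80))" for \<beta> A
  proof -
    have "Q n (clin \<beta>) (\<omega>' A) \<le> Q n (clin (rep (pat \<beta>))) (\<omega>' A) + 10"
    proof (rule Q_Lipschitz)
      fix i assume i: "i < 2 * n"
      show "\<bar>clin \<beta> (S (\<omega>' A i)) - clin (rep (pat \<beta>)) (S (\<omega>' A i))\<bar> \<le> 1 / n"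
        using close1[OF sw[OF i, of A] rep[symmetric], of \<beta>] close1[OF sw[OF i, of A] rep, of \<beta>] i
        unfolding \<omega>'_def by (simp add: abs_le_iff)
    qed (rule clin01)+
    \<comment> \<open>\<open>1/8\<close> is the constant 10 of \<open>Q_Lipschitz\<close> divided by
      80.\<close>
    then have "exp (Q n (clin \<beta>) (\<omega>' A) / 80) \<le> exp (1/8 + Q n (clin (rep (pat \<beta>))) (\<omega>' A) / 80)" by simp
    also have "\<dots> = exp (1/8) * exp (Q n (clin (rep (pat \<beta>))) (\<omega>' A) / 80)" by (rule exp_add)
    also have "exp (Q n (clin (rep (pat \<beta>))) (\<omega>' A) / 80) \<le> (\<Sum>p\<in>R. exp (Q n (clin (rep p)) (\<omega>' A) / 80))"
      using finR by (intro member_le_sum[where f = "\<lambda>p. exp (Q n (clin (rep p)) (\<omega>' A) / 80)"]) (auto simp: R_def)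
    finally show ?thesis by simp
  qed
  have "(\<Sum>A\<in>Pow {..<n}. SUP \<beta>\<in>B. ennreal (exp (Q n (clin \<beta>) (\<omega>' A) / 80)))
     \<le> (\<Sum>A\<in>Pow {..<n}. ennreal (exp (1/8) * (\<Sum>p\<in>R. exp (Q n (clin (rep p)) (\<omega>' A) / 80))))"
    by (intro sum_mono SUP_least ennreal_leI le)
  also have "\<dots> = ennreal (\<Sum>A\<in>Pow {..<n}. exp (1/8) * (\<Sum>p\<in>R. exp (Q n (clin (rep p)) (\<omega>' A) / 80)))"
    by (intro sum_ennreal mult_nonneg_nonneg sum_nonneg) auto
  also have "(\<Sum>A\<in>Pow {..<n}. exp (1/8) * (\<Sum>p\<in>R. exp (Q n (clin (rep p)) (\<omega>' A) / 80)))
     = exp (1/8) * (\<Sum>p\<in>R. \<Sum>A\<in>Pow {..<n}. exp (Q n (clin (rep p)) (\<omega>' A) / 80))"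
    unfolding sum_distrib_left[symmetric] by (subst sum.swap) simp
  also have "\<dots> \<le> exp (1/8) * (\<Sum>p\<in>R. 2 ^ n)"
    unfolding \<omega>'_def by (intro mult_left_mono sum_mono sum_exp_Q_swap_le clin01) auto
  also have "\<dots> \<le> 2 ^ n * (exp (1/8) * real ((2 * n * n + 1) ^ card K))"
    using cR of_nat_mono[OF cR, where 'a=real] by (simp add: mult_ac)
  finally show ?thesis unfolding \<omega>'_def by (simp only: ennreal_leI)
qed

text \<open>Every exchange of sample and ghost points preserves the product measure, so the integral
  equals its average over all \<open>2 ^ n\<close> exchanges, and that average is bounded pointwise.
  Countability of \<open>B\<close> makes the supremum measurable.\<close>

lemma nn_integral_SUP_exp_Q_le:
  assumes n: "n \<ge> 1" and B: "countable B"
  shows "(\<integral>\<^sup>+\<omega>. (SUP \<beta>\<in>B. ennreal (exp (Q n (clin \<beta>) \<omega> / 80))) \<partial>(\<Pi>\<^sub>M i\<in>{..<2*n}. L))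
     \<le> ennreal (exp (1/8) * real ((2 * n * n + 1) ^ card K))"
proof -
  let ?\<Omega> = "\<Pi>\<^sub>M i\<in>{..<2*n}. L"
  define F where "F \<omega> = (SUP \<beta>\<in>B. ennreal (exp (Q n (clin \<beta>) \<omega> / 80)))" for \<omega>
  define \<tau> where "\<tau> A \<omega> = (\<lambda>i\<in>{..<2*n}. \<omega> (swap_ghost n A i))" for A and \<omega> :: "nat \<Rightarrow> 'z"
  have m: "(\<lambda>\<omega>. ell (clin \<beta>) (\<omega> j)) \<in> borel_measurable ?\<Omega>" if "j < 2 * n" for j \<beta>
    using that by (intro measurable_compose[OF measurable_component_singleton[of j "{..<2*n}" "\<lambda>_. L"]]
        ell_measurable clin_measurable) auto
  have [measurable]: "Q n (clin \<beta>) \<in> borel_measurable ?\<Omega>" for \<beta>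
    unfolding Q_def[abs_def]
    by (intro borel_measurable_sum borel_measurable_diff borel_measurable_times borel_measurable_divide
        borel_measurable_power borel_measurable_const m) auto
  have F[measurable]: "F \<in> borel_measurable ?\<Omega>"
    unfolding F_def[abs_def] by (intro borel_measurable_SUP B) measurable
  have mp: "distr ?\<Omega> ?\<Omega> (\<tau> A) = ?\<Omega>" for A
  proof -
    have inj: "inj_on (swap_ghost n A) {..<2*n}"
      by (rule inj_onI) (auto simp: swap_ghost_def split: if_splits)
    have "swap_ghost n A \<in> {..<2*n} \<rightarrow> {..<2*n}" by (auto simp: swap_ghost_def)
    from distr_PiM_reindex[OF _ inj this, of "\<lambda>_. L"] show ?thesis
      unfolding \<tau>_def using prob_space_axioms by simp
  qed
  have \<tau>[measurable]: "\<tau> A \<in> ?\<Omega> \<rightarrow>\<^sub>M ?\<Omega>" for A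
    unfolding \<tau>_def by (intro measurable_restrict measurable_component_singleton) (auto simp: swap_ghost_def)
  have inv: "(\<integral>\<^sup>+\<omega>. F (\<tau> A \<omega>) \<partial>?\<Omega>) = (\<integral>\<^sup>+\<omega>. F \<omega> \<partial>?\<Omega>)" for A
    using nn_integral_distr[OF \<tau>, of F A] F unfolding mp by simp
  interpret \<Omega>: prob_space ?\<Omega> by (intro prob_space_PiM prob_space_axioms)
  have "ennreal (2 ^ n) * (\<integral>\<^sup>+\<omega>. F \<omega> \<partial>?\<Omega>) = (\<Sum>A\<in>Pow {..<n}. \<integral>\<^sup>+\<omega>. F (\<tau> A \<omega>) \<partial>?\<Omega>)"
    unfolding inv by (simp add: card_Pow ennreal_power[symmetric])
  also have "\<dots> = (\<integral>\<^sup>+\<omega>. (\<Sum>A\<in>Pow {..<n}. F (\<tau> A \<omega>)) \<partial>?\<Omega>)"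
    by (intro nn_integral_sum[symmetric]) measurable
  also have "\<dots> \<le> (\<integral>\<^sup>+\<omega>. ennreal (2 ^ n * (exp (1/8) * real ((2 * n * n + 1) ^ card K))) \<partial>?\<Omega>)"
    unfolding F_def \<tau>_def by (intro nn_integral_mono sum_SUP_exp_Q_swap_le n)
  also have "\<dots> = ennreal (2 ^ n) * ennreal (exp (1/8) * real ((2 * n * n + 1) ^ card K))"
    by (simp add: \<Omega>.emeasure_space_1 ennreal_mult)
  finally have "ennreal (2 ^ n) * (\<integral>\<^sup>+\<omega>. F \<omega> \<partial>?\<Omega>)
     \<le> ennreal (2 ^ n) * ennreal (exp (1/8) * real ((2 * n * n + 1) ^ card K))" .
  then show ?thesis unfolding F_def by (subst (asm) ennreal_mult_le_mult_iff) auto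
qed

text \<open>As \<open>K\<close> is finite there are only countably many rational coefficient
  families, so suprema over the class reduce to countable ones.\<close>

lemma clin_rational_approximation:
  obtains \<gamma> where "\<And>m :: nat. \<gamma> m \<in> K \<rightarrow>\<^sub>E \<rat>" "\<And>s. (\<lambda>m. clin (\<gamma> m) s) \<longlonglongrightarrow> clin \<beta> s"
proof -
  have "\<exists>r\<in>\<rat>. x < r \<and> r < x + 1 / real (Suc m)" for x :: real and m :: nat
    by (rule Rats_dense_in_real) auto
  then obtain r where r: "r x m \<in> \<rat>" "x < r x m" "r x m < x + 1 / real (Suc m)" for x :: real and m :: nat
    by metis
  have lim: "(\<lambda>m. r x m) \<longlonglongrightarrow> x" for x
  proof (rule tendsto_sandwich[where f = "\<lambda>_. x" and h = "\<lambda>m. x + 1 / real (Suc m)"])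
    show "(\<lambda>m. x + 1 / real (Suc m)) \<longlonglongrightarrow> x"
      using tendsto_add[OF tendsto_const[of x] lim_inverse_n'[THEN LIMSEQ_Suc]] by simp
  qed (use r in \<open>auto intro!: always_eventually less_imp_le\<close>)
  show thesis
  proof (rule that)
    show "(\<lambda>k\<in>K. r (\<beta> k) m) \<in> K \<rightarrow>\<^sub>E \<rat>" for m using r(1) by auto
    show "(\<lambda>m. clin (\<lambda>k\<in>K. r (\<beta> k) m) s) \<longlonglongrightarrow> clin \<beta> s" for s
      unfolding clin_def
      by (intro isCont_tendsto_compose[OF continuous_clip01] tendsto_sum tendsto_mult)
        (auto intro: lim)
  qed
qed

text \<open>\<open>Q\<close> sees a function only through its values at finitely many points and is
  therefore continuous under pointwise convergence.\<close>

lemma exp_Q_le_SUP_rational: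
  "ennreal (exp (Q n (clin \<beta>) \<omega> / 80)) \<le> (SUP \<beta>\<in>K \<rightarrow>\<^sub>E \<rat>. ennreal (exp (Q n (clin \<beta>) \<omega> / 80)))"
proof -
  obtain \<gamma> where \<gamma>: "\<And>m :: nat. \<gamma> m \<in> K \<rightarrow>\<^sub>E \<rat>" "\<And>s. (\<lambda>m. clin (\<gamma> m) s) \<longlonglongrightarrow> clin \<beta> s"
    by (rule clin_rational_approximation[of \<beta>]) blast
  have "(\<lambda>m. ennreal (exp (Q n (clin (\<gamma> m)) \<omega> / 80))) \<longlonglongrightarrow> ennreal (exp (Q n (clin \<beta>) \<omega> / 80))"
    unfolding Q_def ell_def by (intro tendsto_ennrealI tendsto_intros \<gamma>(2)) simp_all
  then show ?thesis
    by (rule LIMSEQ_le_const2) (auto intro!: exI[of _ 0] SUP_upper \<gamma>(1))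
qed

lemma countable_rational_coefficients: "countable (K \<rightarrow>\<^sub>E (\<rat> :: real set))"
  by (intro countable_PiE finite_K countable_rat)

text \<open>The estimator \<open>g\<close> sees the sample but not the ghost sample, so integrating out the latter
  turns the ghost terms into the population risk.\<close>

lemma expected_risk_le:
  fixes g :: "(nat \<Rightarrow> 'z) \<Rightarrow> 's \<Rightarrow> real"
  assumes n: "n \<ge> 1"
    and g[measurable]: "(\<lambda>(D, s). g D s) \<in> borel_measurable ((\<Pi>\<^sub>M i\<in>{..<n}. L) \<Otimes>\<^sub>M N)"
    and g_clin: "\<And>D. D \<in> space (\<Pi>\<^sub>M i\<in>{..<n}. L) \<Longrightarrow> g D \<in> range clin"
    and erm: "\<And>D \<beta>. D \<in> space (\<Pi>\<^sub>M i\<in>{..<n}. L) \<Longrightarrow>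
      (\<Sum>i<n. (Z (D i) - g D (S (D i)))\<^sup>2) \<le> (\<Sum>i<n. (Z (D i) - clin \<beta> (S (D i)))\<^sup>2)"
  shows "(\<integral>D. risk (g D) \<partial>(\<Pi>\<^sub>M i\<in>{..<n}. L))
    \<le> 2 * risk (clin \<beta>) + (10 + 80 * (real (card K) * ln (2 * real n * real n + 1))) / real n"
proof -
  let ?P = "\<Pi>\<^sub>M i\<in>{..<n}. L"
  let ?P' = "\<Pi>\<^sub>M i\<in>{n..<2*n}. L"
  let ?\<Omega> = "\<Pi>\<^sub>M i\<in>{..<2*n}. L"
  interpret P: prob_space ?P by (intro prob_space_PiM prob_space_axioms)
  interpret P': prob_space ?P' by (intro prob_space_PiM prob_space_axioms)
  interpret \<Omega>: prob_space ?\<Omega> by (intro prob_space_PiM prob_space_axioms)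
  interpret PL: pair_prob_space ?P L ..
  interpret fam: product_sigma_finite "\<lambda>_ :: nat. L" by standard
  have un: "{..<n} \<union> {n..<2*n} = {..<2*n}" "{..<n} \<inter> {n..<2*n} = {}" by auto
  define r where "r \<omega> = restrict \<omega> {..<n}" for \<omega> :: "nat \<Rightarrow> 'z"
  have r[measurable]: "r \<in> ?\<Omega> \<rightarrow>\<^sub>M ?P" unfolding r_def by (rule measurable_restrict_subset) auto
  have comp[measurable]: "(\<lambda>\<omega>. \<omega> i) \<in> ?\<Omega> \<rightarrow>\<^sub>M L" if "i < 2 * n" for i
    using that by (intro measurable_component_singleton) auto
  have compP: "(\<lambda>\<omega>. \<omega> i) \<in> ?P \<rightarrow>\<^sub>M L" if "i < n" for i
    using that by (intro measurable_component_singleton) auto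
  have g01: "0 \<le> g D s" "g D s \<le> 1" if "D \<in> space ?P" for D s
    using g_clin[OF that] clin01 by auto
  have gD[measurable]: "g D \<in> borel_measurable N" if "D \<in> space ?P" for D
    using g_clin[OF that] by auto
  define H where "H = (\<lambda>(D, z). ell (g D) z)"
  have gS: "(\<lambda>x. g (fst x) (S (snd x))) \<in> borel_measurable (?P \<Otimes>\<^sub>M L)"
    using measurable_compose[of "\<lambda>x. (fst x, S (snd x))" "?P \<Otimes>\<^sub>M L" "?P \<Otimes>\<^sub>M N", OF _ g] by simp
  have H[measurable]: "H \<in> borel_measurable (?P \<Otimes>\<^sub>M L)"
    unfolding H_def ell_def case_prod_beta
    by (intro borel_measurable_diff borel_measurable_power gS) measurable
  have H1: "\<bar>H (D, z)\<bar> \<le> 1" if "D \<in> space ?P" for D z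
    unfolding H_def using abs_ell_le g01[OF that] by simp
  have Hm: "(\<lambda>\<omega>. H (r \<omega>, \<omega> i)) \<in> borel_measurable ?\<Omega>" if "i < 2 * n" for i
    using that by measurable
  have HmP: "(\<lambda>D. H (D, D i)) \<in> borel_measurable ?P" if "i < n" for i
    using compP[OF that] by measurable
  have rsp: "r \<omega> \<in> space ?P" if "\<omega> \<in> space ?\<Omega>" for \<omega>
    using measurable_space[OF r that] .
  have Hint: "integrable ?\<Omega> (\<lambda>\<omega>. f (H (r \<omega>, \<omega> i)))"
    if [measurable]: "f \<in> borel_measurable borel" and "\<And>x. \<bar>x\<bar> \<le> 1 \<Longrightarrow> \<bar>f x\<bar> \<le> 1" "i < 2 * n" for f :: "real \<Rightarrow> real" and i
  proof (rule \<Omega>.integrable_const_bound[where B=1])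
    show "(\<lambda>\<omega>. f (H (r \<omega>, \<omega> i))) \<in> borel_measurable ?\<Omega>"
      using Hm[OF that(3)] by measurable
    show "AE \<omega> in ?\<Omega>. norm (f (H (r \<omega>, \<omega> i))) \<le> 1"
      using that(2) H1 rsp by (intro AE_I2) auto
  qed
  have HintP: "integrable ?P (\<lambda>D. H (D, D i))" if "i < n" for i
    using H1 by (intro P.integrable_const_bound[where B=1] HmP that AE_I2) auto
  have merge_r: "r (merge {..<n} {n..<2*n} (x, y)) = x" if "x \<in> space ?P" for x y
    using that unfolding r_def by (auto simp: merge_def space_PiM PiE_def extensional_def fun_eq_iff)
  \<comment> \<open>Fubini over sample and ghost sample; \<open>f\<close> will be the identity and
    the square, the two forms in which ghost losses enter \<open>Q\<close>.\<close>
  have ghost: "(\<integral>\<omega>. f (H (r \<omega>, \<omega> (n + i))) \<partial>?\<Omega>) = (\<integral>D. (\<integral>z. f (H (D, z)) \<partial>L) \<partial>?P)"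
    if f[measurable]: "f \<in> borel_measurable borel" and f1: "\<And>x. \<bar>x\<bar> \<le> 1 \<Longrightarrow> \<bar>f x\<bar> \<le> 1" and i: "i < n"
    for f :: "real \<Rightarrow> real" and i
  proof -
    have "(\<integral>\<omega>. f (H (r \<omega>, \<omega> (n + i))) \<partial>?\<Omega>)
      = (\<integral>x. (\<integral>y. f (H (r (merge {..<n} {n..<2*n} (x, y)), merge {..<n} {n..<2*n} (x, y) (n + i))) \<partial>?P') \<partial>?P)"
      using fam.product_integral_fold[OF un(2), of "\<lambda>\<omega>. f (H (r \<omega>, \<omega> (n + i)))"] Hint[OF f f1, of "n + i"] i
      unfolding un by simp
    also have "\<dots> = (\<integral>x. (\<integral>z. f (H (x, z)) \<partial>L) \<partial>?P)"
    proof (intro Bochner_Integration.integral_cong refl)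
      fix x assume x: "x \<in> space ?P"
      have mi: "merge {..<n} {n..<2*n} (x, y) (n + i) = y (n + i)" for y
        using i by (simp add: merge_def)
      have "(\<integral>z. f (H (x, z)) \<partial>L) = (\<integral>z. f (H (x, z)) \<partial>distr ?P' L (\<lambda>y. y (n + i)))"
        using i distr_PiM_component[of "{n..<2*n}" "\<lambda>_. L" "n + i"] prob_space_axioms by simp
      also have "\<dots> = (\<integral>y. f (H (x, y (n + i))) \<partial>?P')"
        using i x by (intro integral_distr measurable_component_singleton) auto
      finally show "(\<integral>y. f (H (r (merge {..<n} {n..<2*n} (x, y)), merge {..<n} {n..<2*n} (x, y) (n + i))) \<partial>?P')
        = (\<integral>z. f (H (x, z)) \<partial>L)" unfolding mi merge_r[OF x] by simp
    qed
    finally show ?thesis .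
  qed
  have own: "(\<integral>\<omega>. H (r \<omega>, \<omega> i) \<partial>?\<Omega>) = (\<integral>D. H (D, D i) \<partial>?P)" if i: "i < n" for i
  proof -
    have "(\<integral>\<omega>. H (r \<omega>, \<omega> i) \<partial>?\<Omega>)
      = (\<integral>x. (\<integral>y. H (r (merge {..<n} {n..<2*n} (x, y)), merge {..<n} {n..<2*n} (x, y) i) \<partial>?P') \<partial>?P)"
      using fam.product_integral_fold[OF un(2), of "\<lambda>\<omega>. H (r \<omega>, \<omega> i)"] Hint[of "\<lambda>x. x" i] i
      unfolding un by simp
    also have "\<dots> = (\<integral>x. H (x, x i) \<partial>?P)"
    proof (intro Bochner_Integration.integral_cong refl)
      fix x assume x: "x \<in> space ?P"
      have mi: "merge {..<n} {n..<2*n} (x, y) i = x i" for y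
        using i by (simp add: merge_def)
      show "(\<integral>y. H (r (merge {..<n} {n..<2*n} (x, y)), merge {..<n} {n..<2*n} (x, y) i) \<partial>?P') = H (x, x i)"
        unfolding mi merge_r[OF x] by (simp add: P'.prob_space)
    qed
    finally show ?thesis .
  qed
  define G where "G \<omega> = Q n (g (r \<omega>)) \<omega>" for \<omega>
  have G_alt: "G \<omega> = (\<Sum>i<n. 2 * H (r \<omega>, \<omega> (n + i)) - (H (r \<omega>, \<omega> (n + i)))\<^sup>2 / 4 - 2 * H (r \<omega>, \<omega> i))" for \<omega>
    unfolding G_def Q_def H_def by simp
  have sq1: "\<And>x :: real. \<bar>x\<bar> \<le> 1 \<Longrightarrow> \<bar>x\<^sup>2\<bar> \<le> 1" by (simp add: abs_square_le_1)
  have Gint: "integrable ?\<Omega> G"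
    unfolding G_alt[abs_def] using Hint[of "\<lambda>x. x"] Hint[of "\<lambda>x. x\<^sup>2"] sq1
    by (intro Bochner_Integration.integrable_sum Bochner_Integration.integrable_diff integrable_mult_right integrable_divide) auto
  define M where "M = exp (1/8) * real ((2 * n * n + 1) ^ card K)"
  have M0: "M > 0" unfolding M_def by (intro mult_pos_pos exp_gt_zero, simp only: of_nat_0_less_iff) simp
  \<comment> \<open>\<open>g\<close> is chosen from the sample, so the bound for a single function
    does not apply to it; the supremum over the class removes this dependence.\<close>
  have expG: "(\<integral>\<^sup>+\<omega>. ennreal (exp (G \<omega> / 80)) \<partial>?\<Omega>) \<le> ennreal M"
  proof -
    have "(\<integral>\<^sup>+\<omega>. ennreal (exp (G \<omega> / 80)) \<partial>?\<Omega>)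
      \<le> (\<integral>\<^sup>+\<omega>. (SUP \<beta>\<in>K \<rightarrow>\<^sub>E \<rat>. ennreal (exp (Q n (clin \<beta>) \<omega> / 80))) \<partial>?\<Omega>)"
    proof (rule nn_integral_mono)
      fix \<omega> assume "\<omega> \<in> space ?\<Omega>"
      then obtain \<beta> where "g (r \<omega>) = clin \<beta>" using g_clin[OF rsp] by blast
      then show "ennreal (exp (G \<omega> / 80)) \<le> (SUP \<beta>\<in>K \<rightarrow>\<^sub>E \<rat>. ennreal (exp (Q n (clin \<beta>) \<omega> / 80)))"
        unfolding G_def using exp_Q_le_SUP_rational by simp
    qed
    also have "\<dots> \<le> ennreal M"
      unfolding M_def by (intro nn_integral_SUP_exp_Q_le n countable_rational_coefficients)
    finally show ?thesis .
  qed
  have expint: "integrable ?\<Omega> (\<lambda>\<omega>. exp (G \<omega> / 80))"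
    using expG borel_measurable_integrable[OF Gint]
    by (intro integrableI_bounded) (auto simp: less_top[symmetric] top_unique)
  have expval: "(\<integral>\<omega>. exp (G \<omega> / 80) \<partial>?\<Omega>) \<le> M"
    using expG M0 unfolding nn_integral_eq_integral[OF expint AE_I2[OF exp_ge_zero]]
    by (subst (asm) ennreal_le_iff) auto
  have EG: "(\<integral>\<omega>. G \<omega> \<partial>?\<Omega>) \<le> 80 * ln M"
  proof -
    \<comment> \<open>Jensen's inequality for the exponential, through
      \<open>1 + x \<le> exp x\<close> at \<open>x = G \<omega> / 80 - ln M\<close>.\<close>
    have "(\<integral>\<omega>. 1 + (G \<omega> / 80 - ln M) \<partial>?\<Omega>) \<le> (\<integral>\<omega>. exp (G \<omega> / 80) / M \<partial>?\<Omega>)"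
    proof (rule integral_mono)
      show "integrable ?\<Omega> (\<lambda>\<omega>. 1 + (G \<omega> / 80 - ln M))" using Gint by simp
      show "integrable ?\<Omega> (\<lambda>\<omega>. exp (G \<omega> / 80) / M)" using expint by simp
      show "1 + (G \<omega> / 80 - ln M) \<le> exp (G \<omega> / 80) / M" for \<omega>
        using exp_ge_add_one_self[of "G \<omega> / 80 - ln M"] M0 by (simp add: exp_diff)
    qed
    also have "\<dots> \<le> 1" using expval M0 by simp
    finally show ?thesis using Gint by (simp add: \<Omega>.prob_space)
  qed
  have risk_pop: "risk (g D) = (\<integral>z. H (D, z) \<partial>L)" if "D \<in> space ?P" for D
    using integral_ell[OF gD g01, OF that that that] unfolding H_def by simp
  have sq_le: "(\<integral>z. (H (D, z))\<^sup>2 \<partial>L) \<le> 4 * risk (g D)" if D: "D \<in> space ?P" for D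
  proof -
    have [measurable]: "(\<lambda>z. H (D, z)) \<in> borel_measurable L" using D by measurable
    have [measurable]: "g D \<in> borel_measurable N" using D by measurable
    have "(\<integral>z. (H (D, z))\<^sup>2 \<partial>L) \<le> (\<integral>z. 4 * (g D (S z) - \<eta> (S z))\<^sup>2 \<partial>L)"
    proof (rule integral_mono)
      show "integrable L (\<lambda>z. (H (D, z))\<^sup>2)"
        using H1[OF D] by (intro integrable_const_bound[where B=1] AE_I2) (auto simp: abs_square_le_1)
      have "\<bar>g D s - \<eta> s\<bar> \<le> 1" for s using g01[OF D, of s] eta01[of s] by (simp add: abs_le_iff)
      then show "integrable L (\<lambda>z. 4 * (g D (S z) - \<eta> (S z))\<^sup>2)"
        by (intro integrable_mult_right integrable_const_bound[where B=1] AE_I2) (auto simp: abs_square_le_1)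
      show "(H (D, z))\<^sup>2 \<le> 4 * (g D (S z) - \<eta> (S z))\<^sup>2" for z
        unfolding H_def using ell_square_le g01[OF D] by simp
    qed
    then show ?thesis unfolding risk_def by simp
  qed
  have int_in: "integrable ?P (\<lambda>D. \<integral>z. f (H (D, z)) \<partial>L)"
    if [measurable]: "f \<in> borel_measurable borel" and f1: "\<And>x. \<bar>x\<bar> \<le> 1 \<Longrightarrow> \<bar>f x\<bar> \<le> 1" for f :: "real \<Rightarrow> real"
  proof (rule P.integrable_const_bound[where B=1])
    show "(\<lambda>D. \<integral>z. f (H (D, z)) \<partial>L) \<in> borel_measurable ?P" by measurable
    show "AE D in ?P. norm (\<integral>z. f (H (D, z)) \<partial>L) \<le> 1"
    proof (rule AE_I2)
      fix D assume D: "D \<in> space ?P"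
      have "norm (\<integral>z. f (H (D, z)) \<partial>L) \<le> (\<integral>z. norm (f (H (D, z))) \<partial>L)" by (rule integral_norm_bound)
      also have "\<dots> \<le> (\<integral>z. 1 \<partial>L)" using f1 H1[OF D]
        by (intro integral_mono' ) auto
      finally show "norm (\<integral>z. f (H (D, z)) \<partial>L) \<le> 1" by (simp add: prob_space)
    qed
  qed
  have Rint: "integrable ?P (\<lambda>D. risk (g D))"
    using int_in[of "\<lambda>x. x"] by (subst Bochner_Integration.integrable_cong[OF refl risk_pop]) auto
  have i2: "integrable ?P (\<lambda>D. \<integral>z. (H (D, z))\<^sup>2 \<partial>L)" using int_in[of "\<lambda>x. x\<^sup>2"] sq1 by simp
  have "(\<integral>\<omega>. G \<omega> \<partial>?\<Omega>) = (\<Sum>i<n. 2 * (\<integral>\<omega>. H (r \<omega>, \<omega> (n + i)) \<partial>?\<Omega>)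
     - (\<integral>\<omega>. (H (r \<omega>, \<omega> (n + i)))\<^sup>2 \<partial>?\<Omega>) / 4 - 2 * (\<integral>\<omega>. H (r \<omega>, \<omega> i) \<partial>?\<Omega>))"
    unfolding G_alt using Hint[of "\<lambda>x. x"] Hint[of "\<lambda>x. x\<^sup>2"] sq1
    by (subst Bochner_Integration.integral_sum) (auto intro!: sum.cong)
  also have "\<dots> = (\<Sum>i<n. 2 * (\<integral>D. risk (g D) \<partial>?P) - (\<integral>D. (\<integral>z. (H (D, z))\<^sup>2 \<partial>L) \<partial>?P) / 4
     - 2 * (\<integral>D. H (D, D i) \<partial>?P))"
    using ghost[of "\<lambda>x. x"] ghost[of "\<lambda>x. x\<^sup>2"] sq1 own risk_pop
    by (intro sum.cong refl) (simp cong: Bochner_Integration.integral_cong)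
  also have "\<dots> = real n * (2 * (\<integral>D. risk (g D) \<partial>?P) - (\<integral>D. (\<integral>z. (H (D, z))\<^sup>2 \<partial>L) \<partial>?P) / 4)
     - 2 * (\<integral>D. (\<Sum>i<n. H (D, D i)) \<partial>?P)"
    using HintP by (simp add: sum_subtractf sum.distrib sum_distrib_left[symmetric] algebra_simps)
  finally have EG2: "(\<integral>\<omega>. G \<omega> \<partial>?\<Omega>) = \<dots>" .
  have "(\<integral>D. (\<integral>z. (H (D, z))\<^sup>2 \<partial>L) \<partial>?P) \<le> (\<integral>D. 4 * risk (g D) \<partial>?P)"
    using i2 Rint sq_le by (intro integral_mono) auto
  \<comment> \<open>The Bernstein condition at work: the penalty consumes at most one of the two
    copies of the risk in the mean of \<open>G\<close>, and the other copy remains to be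
    bounded.\<close>
  then have bern: "(\<integral>D. (\<integral>z. (H (D, z))\<^sup>2 \<partial>L) \<partial>?P) / 4 \<le> (\<integral>D. risk (g D) \<partial>?P)" by simp
  have ell_clin: "ell (clin \<beta>) \<in> borel_measurable L" by (intro ell_measurable clin_measurable)
  have cint: "integrable ?P (\<lambda>D. ell (clin \<beta>) (D i))" if i: "i < n" for i
    using abs_ell_le[of "clin \<beta>"] clin01
    by (intro P.integrable_const_bound[where B=1] AE_I2 measurable_compose[OF compP ell_clin] i) auto
  \<comment> \<open>On its own sample the minimizer does no worse than the fixed
    \<open>\<beta>\<close>. The latter does not depend on the data, so its empirical excess loss has
    mean \<open>n\<close> times its risk.\<close>
  have "(\<integral>D. (\<Sum>i<n. H (D, D i)) \<partial>?P) \<le> (\<integral>D. (\<Sum>i<n. ell (clin \<beta>) (D i)) \<partial>?P)"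
  proof (rule integral_mono)
    fix D assume "D \<in> space ?P"
    from erm[OF this, of \<beta>] show "(\<Sum>i<n. H (D, D i)) \<le> (\<Sum>i<n. ell (clin \<beta>) (D i))"
      unfolding H_def ell_def by (simp add: sum_subtractf)
  qed (use HintP cint in auto)
  also have "\<dots> = (\<Sum>i<n. \<integral>D. ell (clin \<beta>) (D i) \<partial>?P)"
    using cint by (intro Bochner_Integration.integral_sum) auto
  also have "\<dots> = (\<Sum>i<n. risk (clin \<beta>))"
  proof (intro sum.cong refl)
    fix i assume i: "i \<in> {..<n}"
    have "(\<integral>D. ell (clin \<beta>) (D i) \<partial>?P) = (\<integral>z. ell (clin \<beta>) z \<partial>distr ?P L (\<lambda>D. D i))"
      using i compP ell_clin by (intro integral_distr[symmetric]) auto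
    also have "distr ?P L (\<lambda>D. D i) = L"
      using i by (intro distr_PiM_component prob_space_axioms) auto
    finally show "(\<integral>D. ell (clin \<beta>) (D i) \<partial>?P) = risk (clin \<beta>)"
      using integral_ell[OF clin_measurable clin01] by simp
  qed
  finally have emp: "(\<integral>D. (\<Sum>i<n. H (D, D i)) \<partial>?P) \<le> real n * risk (clin \<beta>)" by simp
  have "real n * (\<integral>D. risk (g D) \<partial>?P)
     \<le> real n * (2 * (\<integral>D. risk (g D) \<partial>?P) - (\<integral>D. (\<integral>z. (H (D, z))\<^sup>2 \<partial>L) \<partial>?P) / 4)"
    using bern by (intro mult_left_mono) auto
  also have "\<dots> \<le> 80 * ln M + 2 * (real n * risk (clin \<beta>))"
    using EG emp unfolding EG2 by linarith
  \<comment> \<open>Multiplied by 80, the summand 1/8 gives the 10 of the statement.\<close>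
  also have "ln M = 1/8 + real (card K) * ln (2 * real n * real n + 1)"
  proof -
    have "2 * real n * real n + 1 > 0" by (intro add_nonneg_pos) auto
    then show ?thesis unfolding M_def by (subst ln_mult) (simp_all add: ln_realpow)
  qed
  finally have "real n * (\<integral>D. risk (g D) \<partial>?P) \<le> 10 + 80 * (real (card K) * ln (2 * real n * real n + 1))
      + 2 * (real n * risk (clin \<beta>))" by simp
  then show ?thesis using n by (simp add: field_simps)
qed

end

subsection \<open>Holomorphic parametric integrals and Chebyshev polynomials\<close>

text \<open>Cauchy's estimate turns the uniform bound on \<open>F\<close> into a uniform bound on
  its derivative near \<open>z0\<close>. Difference quotients are then dominated by a constant, and
  dominated convergence applies.\<close>

lemma has_field_derivative_parametric_integral:
  fixes F :: "complex \<Rightarrow> 'a \<Rightarrow> complex"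
  assumes "finite_measure M" and U: "open U" "z0 \<in> U"
    and hol: "\<And>x. x \<in> space M \<Longrightarrow> (\<lambda>z. F z x) holomorphic_on U"
    and meas: "\<And>z. z \<in> U \<Longrightarrow> F z \<in> borel_measurable M"
    and bound: "\<And>z x. z \<in> U \<Longrightarrow> x \<in> space M \<Longrightarrow> norm (F z x) \<le> B"
  shows "((\<lambda>z. \<integral>x. F z x \<partial>M) has_field_derivative (\<integral>x. deriv (\<lambda>z. F z x) z0 \<partial>M)) (at z0)"
proof -
  interpret finite_measure M by fact
  obtain e where e: "e > 0" "cball z0 e \<subseteq> U" using U open_contains_cball by blast
  \<comment> \<open>Half the radius, so that discs of radius \<open>r\<close> about points of
    \<open>ball z0 r\<close> stay inside \<open>U\<close>.\<close>
  define r where "r = e / 2"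
  have r: "r > 0" "cball z0 (2 * r) \<subseteq> U" unfolding r_def using e by auto
  have sub: "cball w r \<subseteq> U" if "w \<in> ball z0 r" for w
  proof
    fix y assume "y \<in> cball w r"
    then have "dist z0 y \<le> 2 * r" using that dist_triangle[of z0 y w] by auto
    then show "y \<in> U" using r(2) by auto
  qed
  have inU: "w \<in> U" if "w \<in> ball z0 r" for w using sub[OF that] r(1) by (auto simp: subset_iff)
  have intF: "integrable M (F w)" if "w \<in> ball z0 r" for w
    using bound inU[OF that] by (intro integrable_const_bound[where B=B] meas) auto
  have derivb: "norm (deriv (\<lambda>z. F z x) w) \<le> B / r" if "w \<in> ball z0 r" "x \<in> space M" for w x
  proof -
    have h: "(\<lambda>z. F z x) holomorphic_on cball w r" using hol[OF that(2)] sub[OF that(1)] holomorphic_on_subset by blast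
    have "norm ((deriv ^^ 1) (\<lambda>z. F z x) w) \<le> fact 1 * B / r ^ 1"
    proof (rule Cauchy_inequality)
      show "(\<lambda>z. F z x) holomorphic_on ball w r" using h ball_subset_cball holomorphic_on_subset by blast
      show "continuous_on (cball w r) (\<lambda>z. F z x)" using h by (rule holomorphic_on_imp_continuous_on)
      show "norm (F y x) \<le> B" if y: "norm (w - y) = r" for y
      proof (rule bound)
        show "y \<in> U" using sub[OF \<open>w \<in> ball z0 r\<close>] y by (auto simp: dist_norm)
      qed fact
    qed (use r in auto)
    then show ?thesis by simp
  qed
  have der: "((\<lambda>z. F z x) has_field_derivative deriv (\<lambda>z. F z x) w) (at w)"
    if "w \<in> ball z0 r" "x \<in> space M" for w x
    by (rule holomorphic_derivI[OF hol[OF that(2)] U(1) inU[OF that(1)]])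
  have z0: "z0 \<in> ball z0 r" using r by simp
  have quot: "norm ((F w x - F z0 x) / (w - z0)) \<le> B / r" if w: "w \<in> ball z0 r - {z0}" and x: "x \<in> space M" for w x
  proof -
    have "norm (F w x - F z0 x) \<le> B / r * norm (w - z0)"
    proof (rule field_differentiable_bound[OF convex_ball])
      show "((\<lambda>z. F z x) has_field_derivative deriv (\<lambda>z. F z x) y) (at y within ball z0 r)" if "y \<in> ball z0 r" for y
        by (rule has_field_derivative_at_within[OF der[OF that x]])
      show "norm (deriv (\<lambda>z. F z x) y) \<le> B / r" if "y \<in> ball z0 r" for y
        by (rule derivb[OF that x])
    qed (use w z0 in auto)
    moreover have "norm (w - z0) > 0" using w by auto
    ultimately show ?thesis by (simp add: norm_divide divide_le_eq)
  qed
  have "((\<lambda>w. ((\<integral>x. F w x \<partial>M) - (\<integral>x. F z0 x \<partial>M)) / (w - z0)) \<longlongrightarrow> (\<integral>x. deriv (\<lambda>z. F z x) z0 \<partial>M)) (at z0 within ball z0 r)"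
    unfolding tendsto_at_iff_sequentially
  proof (intro allI impI)
    fix X assume X: "\<forall>i. X i \<in> ball z0 r - {z0}" "X \<longlonglongrightarrow> z0"
    have lim: "(\<lambda>i. (F (X i) x - F z0 x) / (X i - z0)) \<longlonglongrightarrow> deriv (\<lambda>z. F z x) z0" if x: "x \<in> space M" for x
    proof -
      have "((\<lambda>w. (F w x - F z0 x) / (w - z0)) \<longlongrightarrow> deriv (\<lambda>z. F z x) z0) (at z0 within ball z0 r)"
        using has_field_derivative_at_within[OF der[OF z0 x]] unfolding has_field_derivative_iff .
      then show ?thesis using X unfolding tendsto_at_iff_sequentially by (auto simp: o_def)
    qed
    have mq: "(\<lambda>x. (F (X i) x - F z0 x) / (X i - z0)) \<in> borel_measurable M" for i
      using X inU z0 by (intro borel_measurable_divide borel_measurable_diff meas borel_measurable_const) auto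
    \<comment> \<open>The derivative is measurable as a pointwise limit of measurable difference
      quotients.\<close>
    have md: "(\<lambda>x. deriv (\<lambda>z. F z x) z0) \<in> borel_measurable M"
      by (rule borel_measurable_LIMSEQ_metric[OF mq lim])
    have "(\<lambda>i. \<integral>x. (F (X i) x - F z0 x) / (X i - z0) \<partial>M) \<longlonglongrightarrow> (\<integral>x. deriv (\<lambda>z. F z x) z0 \<partial>M)"
      by (rule integral_dominated_convergence[where w = "\<lambda>_. B / r"])
        (use mq md lim quot X in \<open>auto intro!: AE_I2\<close>)
    also have "(\<lambda>i. \<integral>x. (F (X i) x - F z0 x) / (X i - z0) \<partial>M)
       = (\<lambda>i. ((\<integral>x. F (X i) x \<partial>M) - (\<integral>x. F z0 x \<partial>M)) / (X i - z0))"
    proof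
      fix i
      have "X i \<in> ball z0 r" using X by auto
      then show "(\<integral>x. (F (X i) x - F z0 x) / (X i - z0) \<partial>M) = ((\<integral>x. F (X i) x \<partial>M) - (\<integral>x. F z0 x \<partial>M)) / (X i - z0)"
        using intF[of "X i"] intF[OF z0] by simp
    qed
    finally show "((\<lambda>w. ((\<integral>x. F w x \<partial>M) - (\<integral>x. F z0 x \<partial>M)) / (w - z0)) \<circ> X) \<longlonglongrightarrow> (\<integral>x. deriv (\<lambda>z. F z x) z0 \<partial>M)"
      by (simp add: o_def)
  qed
  then have "((\<lambda>z. \<integral>x. F z x \<partial>M) has_field_derivative (\<integral>x. deriv (\<lambda>z. F z x) z0 \<partial>M)) (at z0 within ball z0 r)"
    by (simp add: has_field_derivative_iff)
  then show ?thesis using z0 by (simp add: at_within_open[OF z0 open_ball])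
qed

lemma holomorphic_on_parametric_integral:
  fixes F :: "complex \<Rightarrow> 'a \<Rightarrow> complex"
  assumes "finite_measure M" "open U"
    and "\<And>x. x \<in> space M \<Longrightarrow> (\<lambda>z. F z x) holomorphic_on U"
    and "\<And>z. z \<in> U \<Longrightarrow> F z \<in> borel_measurable M"
    and "\<And>z x. z \<in> U \<Longrightarrow> x \<in> space M \<Longrightarrow> norm (F z x) \<le> B"
  shows "(\<lambda>z. \<integral>x. F z x \<partial>M) holomorphic_on U"
  unfolding holomorphic_on_open[OF assms(2)]
proof
  fix z assume z: "z \<in> U"
  show "\<exists>f'. ((\<lambda>z. \<integral>x. F z x \<partial>M) has_field_derivative f') (at z)"
    by (rule exI, rule has_field_derivative_parametric_integral[OF assms(1,2) z assms(3-5)])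
qed

lemma continuous_on_parametric_integral:
  fixes F :: "'b :: first_countable_topology \<Rightarrow> 'a \<Rightarrow> complex"
  assumes "finite_measure M"
    and cont: "\<And>x. x \<in> space M \<Longrightarrow> continuous_on U (\<lambda>z. F z x)"
    and meas: "\<And>z. z \<in> U \<Longrightarrow> F z \<in> borel_measurable M"
    and bound: "\<And>z x. z \<in> U \<Longrightarrow> x \<in> space M \<Longrightarrow> norm (F z x) \<le> B"
  shows "continuous_on U (\<lambda>z. \<integral>x. F z x \<partial>M)"
  unfolding continuous_on_def tendsto_at_iff_sequentially
proof (intro ballI allI impI)
  interpret finite_measure M by fact
  fix z X assume z: "z \<in> U" and X: "\<forall>i. X i \<in> U - {z}" "X \<longlonglongrightarrow> z"
  have "(\<lambda>i. \<integral>x. F (X i) x \<partial>M) \<longlonglongrightarrow> (\<integral>x. F z x \<partial>M)"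
  proof (rule integral_dominated_convergence[where w = "\<lambda>_. B"])
    show "AE x in M. (\<lambda>i. F (X i) x) \<longlonglongrightarrow> F z x"
    proof (rule AE_I2)
      fix x assume "x \<in> space M"
      from cont[OF this] z have "((\<lambda>z. F z x) \<longlongrightarrow> F z x) (at z within U)" by (simp add: continuous_on_def)
      then show "(\<lambda>i. F (X i) x) \<longlonglongrightarrow> F z x"
        using X unfolding tendsto_at_iff_sequentially by (auto simp: o_def)
    qed
  qed (use X z meas bound in auto)
  then show "((\<lambda>z. \<integral>x. F z x \<partial>M) \<circ> X) \<longlonglongrightarrow> (\<integral>x. F z x \<partial>M)" by (simp add: o_def)
qed

text \<open>Chebyshev polynomials, described through the Joukowski map because both bounds below are
  read off there. The induction is the recurrence
  \<open>T (n + 2) = 2 * z * T (n + 1) - T n\<close>.\<close>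

lemma chebyshev_poly_exists:
  "\<exists>p :: complex poly. degree p \<le> n \<and> (\<forall>w. w \<noteq> 0 \<longrightarrow> poly p ((w + inverse w) / 2) = (w ^ n + inverse w ^ n) / 2)"
proof (induction n rule: induct_nat_012)
  case 0
  show ?case by (intro exI[of _ 1]) simp
next
  case 1
  show ?case by (intro exI[of _ "[:0, 1:]"]) simp
next
  case (ge2 n)
  then obtain p q :: "complex poly" where
    p: "degree p \<le> n" "\<And>w. w \<noteq> 0 \<Longrightarrow> poly p ((w + inverse w) / 2) = (w ^ n + inverse w ^ n) / 2" and
    q: "degree q \<le> Suc n" "\<And>w. w \<noteq> 0 \<Longrightarrow> poly q ((w + inverse w) / 2) = (w ^ Suc n + inverse w ^ Suc n) / 2"
    by blast
  have "degree ([:0, 2:] * q - p) \<le> Suc (Suc n)"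
  proof (rule degree_diff_le)
    have "degree ([:0, 2:] * q) \<le> degree [:0, 2 :: complex:] + degree q" by (rule degree_mult_le)
    then show "degree ([:0, 2:] * q) \<le> Suc (Suc n)" using q(1) by simp
  qed (use p in auto)
  moreover have "poly ([:0, 2:] * q - p) ((w + inverse w) / 2) = (w ^ Suc (Suc n) + inverse w ^ Suc (Suc n)) / 2"
    if w: "w \<noteq> 0" for w
  proof -
    have e: "w * (inverse w ^ Suc n) = inverse w ^ n" "inverse w * w ^ Suc n = w ^ n"
      using w by (simp_all add: mult.assoc[symmetric])
    have "poly ([:0, 2:] * q - p) ((w + inverse w) / 2)
      = (w + inverse w) * ((w ^ Suc n + inverse w ^ Suc n) / 2) - (w ^ n + inverse w ^ n) / 2"
      unfolding p(2)[OF w, symmetric] q(2)[OF w, symmetric] by (simp add: algebra_simps add_divide_distrib)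
    also have "\<dots> = (w * w ^ Suc n + inverse w * inverse w ^ Suc n + (w * inverse w ^ Suc n + inverse w * w ^ Suc n)) / 2
        - (w ^ n + inverse w ^ n) / 2"
      by (simp only: ring_distribs add_divide_distrib times_divide_eq_right) simp
    also have "\<dots> = (w ^ Suc (Suc n) + inverse w ^ Suc (Suc n)) / 2"
      unfolding e by (simp add: field_simps)
    finally show ?thesis .
  qed
  ultimately show ?case by blast
qed

text \<open>The two solutions of \<open>w\<^sup>2 - 2 * z * w + 1 = 0\<close> have product 1, so one
  of them has norm at least 1.\<close>

lemma joukowski_preimage:
  fixes z :: complex
  obtains w where "norm w \<ge> 1" "z = (w + inverse w) / 2"
proof -
  define w where "w = z + csqrt (z\<^sup>2 - 1)"
  define w' where "w' = z - csqrt (z\<^sup>2 - 1)"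
  have "w * w' = z\<^sup>2 - (csqrt (z\<^sup>2 - 1))\<^sup>2" unfolding w_def w'_def by (simp add: power2_eq_square algebra_simps)
  then have ww: "w * w' = 1" by simp
  then have inv: "inverse w = w'" "inverse w' = w" by (auto simp: inverse_unique) (metis inverse_unique mult.commute)
  have z: "z = (w + w') / 2" unfolding w_def w'_def by simp
  have "norm w * norm w' = 1" using ww by (metis norm_mult norm_one)
  then have "norm w \<ge> 1 \<or> norm w' \<ge> 1"
    using mult_strict_mono[of "norm w" 1 "norm w'" 1] by fastforce
  then show thesis
  proof
    assume "norm w \<ge> 1" then show thesis using that[of w] z inv by simp
  next
    assume "norm w' \<ge> 1" then show thesis using that[of w'] z inv by (simp add: add.commute)
  qed
qed

text \<open>A circle of radius \<open>norm w\<close> is mapped to an ellipse with these half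
  axes.\<close>

lemma joukowski_Re_Im_le:
  assumes w: "norm w \<ge> 1"
  shows "\<bar>Im ((w + inverse w) / 2)\<bar> \<le> (norm w - inverse (norm w)) / 2"
    and "\<bar>Re ((w + inverse w) / 2)\<bar> \<le> (norm w + inverse (norm w)) / 2"
proof -
  have w0: "norm w > 0" using w by linarith
  have sq: "(Re w)\<^sup>2 + (Im w)\<^sup>2 = (norm w)\<^sup>2" by (simp add: cmod_power2)
  have Re: "Re (w + inverse w) = Re w * (1 + inverse ((norm w)\<^sup>2))"
    using w0 by (simp add: sq divide_inverse ring_distribs)
  have Im: "Im (w + inverse w) = Im w * (1 - inverse ((norm w)\<^sup>2))"
    using w0 by (simp add: sq divide_inverse ring_distribs)
  have i1: "inverse ((norm w)\<^sup>2) \<le> 1" using w one_le_power[OF w, of 2] by (simp add: inverse_le_1_iff del: one_le_power)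
  have "\<bar>Im w * (1 - inverse ((norm w)\<^sup>2))\<bar> \<le> norm w * (1 - inverse ((norm w)\<^sup>2))"
    using i1 abs_Im_le_cmod[of w] by (simp add: abs_mult mult_right_mono)
  also have "\<dots> = norm w - inverse (norm w)" using w0 by (simp add: field_simps power2_eq_square)
  finally show "\<bar>Im ((w + inverse w) / 2)\<bar> \<le> (norm w - inverse (norm w)) / 2" unfolding Im[symmetric] by simp
  have "\<bar>Re w * (1 + inverse ((norm w)\<^sup>2))\<bar> \<le> norm w * (1 + inverse ((norm w)\<^sup>2))"
    using abs_Re_le_cmod[of w] by (simp add: abs_mult mult_right_mono)
  also have "\<dots> = norm w + inverse (norm w)" using w0 by (simp add: field_simps power2_eq_square)
  finally show "\<bar>Re ((w + inverse w) / 2)\<bar> \<le> (norm w + inverse (norm w)) / 2" unfolding Re[symmetric] by simp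
qed

text \<open>The assumption on \<open>z\<close> describes the lines that bound the rectangle circumscribed about the
  Bernstein ellipse with parameter \<open>\<rho>\<close>.\<close>

lemma chebyshev_poly_lower_bound:
  fixes p :: "complex poly"
  assumes p: "\<And>w. w \<noteq> 0 \<Longrightarrow> poly p ((w + inverse w) / 2) = (w ^ n + inverse w ^ n) / 2"
    and \<rho>: "\<rho> > 1"
    and z: "\<bar>Im z\<bar> = (\<rho> - inverse \<rho>) / 2 \<or> \<bar>Re z\<bar> = (\<rho> + inverse \<rho>) / 2"
  shows "norm (poly p z) \<ge> (\<rho> ^ n - 1) / 2"
proof -
  obtain w where w: "norm w \<ge> 1" "z = (w + inverse w) / 2" by (rule joukowski_preimage)
  have w0: "w \<noteq> 0" using w(1) by auto
  \<comment> \<open>Both half axes grow with the parameter. For \<open>norm w < \<rho>\<close> the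
    point \<open>z\<close> would lie strictly inside the rectangle and not on one of its bounding
    lines.\<close>
  have "norm w \<ge> \<rho>"
  proof (rule ccontr)
    assume "\<not> ?thesis"
    then have lt: "norm w < \<rho>" by simp
    have inv: "inverse \<rho> < inverse (norm w)" using lt w(1) by (intro less_imp_inverse_less) auto
    have "norm w + inverse (norm w) < \<rho> + inverse \<rho>"
    proof -
      have "inverse (norm w * \<rho>) < 1" using less_le_trans[of 1 \<rho> "norm w * \<rho>"] \<rho>
        mult_right_mono[OF w(1), of \<rho>] by (simp add: inverse_less_1_iff del: inverse_mult_distrib)
      then have "(\<rho> - norm w) * inverse (norm w * \<rho>) < (\<rho> - norm w) * 1" using lt by (intro mult_strict_left_mono) auto
      moreover have "(\<rho> - norm w) * inverse (norm w * \<rho>) = inverse (norm w) - inverse \<rho>"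
        using w0 \<rho> by (simp add: field_simps)
      ultimately show ?thesis by simp
    qed
    then show False using z inv lt joukowski_Re_Im_le[OF w(1)] unfolding w(2)[symmetric] by auto
  qed
  then have "\<rho> ^ n \<le> norm (w ^ n)" using \<rho> by (simp add: norm_power power_mono)
  moreover have "norm (inverse w ^ n) \<le> 1"
    using w(1) by (simp add: norm_power norm_inverse power_le_one inverse_le_1_iff)
  moreover have "norm (w ^ n) - norm (inverse w ^ n) \<le> norm (w ^ n + inverse w ^ n)"
    by (metis norm_diff_ineq)
  moreover have "poly p z = (w ^ n + inverse w ^ n) / 2" using p[OF w0] unfolding w(2)[symmetric] .
  ultimately show ?thesis by (simp only: norm_divide) simp
qed

text \<open>Points of [-1, 1] have Joukowski preimages on the unit circle, where both powers have
  norm 1.\<close>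

lemma chebyshev_poly_upper_bound:
  fixes p :: "complex poly" and x :: real
  assumes p: "\<And>w. w \<noteq> 0 \<Longrightarrow> poly p ((w + inverse w) / 2) = (w ^ n + inverse w ^ n) / 2"
    and x: "\<bar>x\<bar> \<le> 1"
  shows "norm (poly p (of_real x)) \<le> 1"
proof -
  define w where "w = cis (arccos x)"
  have "(w + inverse w) / 2 = of_real x"
    using x unfolding w_def by (auto simp: complex_eq_iff cos_arccos_abs)
  then have "poly p (of_real x) = (w ^ n + inverse w ^ n) / 2" using p[of w] by (simp add: w_def)
  also have "norm \<dots> \<le> (norm (w ^ n) + norm (inverse w ^ n)) / 2" by (simp add: norm_divide norm_triangle_ineq)
  also have "\<dots> = 1" by (simp add: w_def norm_power norm_inverse)
  finally show ?thesis .
qed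

subsection \<open>Polynomial approximation in Bernstein rectangles\<close>

lemma path_image_rectpath_segments:
  assumes "Re a \<le> Re b" "Im a \<le> Im b"
  shows "closed_segment a (Complex (Re b) (Im a)) \<subseteq> path_image (rectpath a b)"
    "closed_segment (Complex (Re b) (Im a)) b \<subseteq> path_image (rectpath a b)"
    "closed_segment b (Complex (Re a) (Im b)) \<subseteq> path_image (rectpath a b)"
    "closed_segment (Complex (Re a) (Im b)) a \<subseteq> path_image (rectpath a b)"
  by (auto simp: rectpath_def Let_def path_image_join)

lemma contour_integrable_rectpath:
  assumes "Re a \<le> Re b" "Im a \<le> Im b" and g: "continuous_on (path_image (rectpath a b)) g"
  shows "g contour_integrable_on rectpath a b"
proof -
  have i: "g contour_integrable_on linepath a (Complex (Re b) (Im a))"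
    "g contour_integrable_on linepath (Complex (Re b) (Im a)) b"
    "g contour_integrable_on linepath b (Complex (Re a) (Im b))"
    "g contour_integrable_on linepath (Complex (Re a) (Im b)) a"
    by (intro contour_integrable_continuous_linepath continuous_on_subset[OF g]
        path_image_rectpath_segments assms)+
  show ?thesis unfolding rectpath_def Let_def using i by simp
qed

lemma contour_integral_rectpath:
  assumes "Re a \<le> Re b" "Im a \<le> Im b" and g: "continuous_on (path_image (rectpath a b)) g"
  shows "contour_integral (rectpath a b) g =
    contour_integral (linepath a (Complex (Re b) (Im a))) g
    + (contour_integral (linepath (Complex (Re b) (Im a)) b) g
    + (contour_integral (linepath b (Complex (Re a) (Im b))) g
    + contour_integral (linepath (Complex (Re a) (Im b)) a) g))"
proof -
  have i: "g contour_integrable_on linepath a (Complex (Re b) (Im a))"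
    "g contour_integrable_on linepath (Complex (Re b) (Im a)) b"
    "g contour_integrable_on linepath b (Complex (Re a) (Im b))"
    "g contour_integrable_on linepath (Complex (Re a) (Im b)) a"
    by (intro contour_integrable_continuous_linepath continuous_on_subset[OF g]
        path_image_rectpath_segments assms)+
  show ?thesis unfolding rectpath_def Let_def using i by simp
qed

lemma norm_contour_integral_rectpath_le:
  assumes le: "Re a \<le> Re b" "Im a \<le> Im b" and g: "continuous_on (path_image (rectpath a b)) g"
    and B: "0 \<le> B" "\<And>z. z \<in> path_image (rectpath a b) \<Longrightarrow> norm (g z) \<le> B"
  shows "norm (contour_integral (rectpath a b) g) \<le> B * (2 * (Re b - Re a) + 2 * (Im b - Im a))"
proof -
  have seg: "norm (contour_integral (linepath p q) g) \<le> B * norm (q - p)"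
    if "closed_segment p q \<subseteq> path_image (rectpath a b)" for p q
    using that B by (intro contour_integral_bound_linepath contour_integrable_continuous_linepath
        continuous_on_subset[OF g]) auto
  have hor: "norm (p - q) = \<bar>Re p - Re q\<bar>" if "Im p = Im q" for p q
    using that by (simp add: cmod_def)
  have ver: "norm (p - q) = \<bar>Im p - Im q\<bar>" if "Re p = Re q" for p q
    using that by (simp add: cmod_def)
  note s = path_image_rectpath_segments[OF le]
  have "norm (contour_integral (rectpath a b) g) \<le>
     B * norm (Complex (Re b) (Im a) - a) + (B * norm (b - Complex (Re b) (Im a))
     + (B * norm (Complex (Re a) (Im b) - b) + B * norm (a - Complex (Re a) (Im b))))"
    unfolding contour_integral_rectpath[OF le g]
    by (intro norm_triangle_mono seg s)
  also have "\<dots> = B * (2 * (Re b - Re a) + 2 * (Im b - Im a))"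
    using le by (simp add: hor ver algebra_simps)
  finally show ?thesis .
qed

text \<open>Makes the inner integral of an iterated contour integral continuous in the outer
  variable.\<close>

lemma continuous_on_contour_integral_rectpath:
  assumes le: "Re a \<le> Re b" "Im a \<le> Im b" and U: "open U" "path_image (rectpath a b) \<subseteq> U"
    and cont: "continuous_on (U \<times> U) (\<lambda>(x, y). F x y)"
  shows "continuous_on U (\<lambda>w. contour_integral (rectpath a b) (F w))"
proof -
  have Fw: "continuous_on U (F w)" if "w \<in> U" for w
  proof -
    have "continuous_on U ((\<lambda>(x, y). F x y) \<circ> (\<lambda>y. (w, y)))"
      using that by (intro continuous_on_compose continuous_on_subset[OF cont] continuous_intros) auto
    then show ?thesis by (simp add: o_def)
  qed
  have seg: "continuous_on U (\<lambda>w. contour_integral (linepath p q) (F w))"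
    if s: "closed_segment p q \<subseteq> path_image (rectpath a b)" for p q
    using U s by (intro contour_integral_continuous_on_linepath_2D[OF U(1) _ cont]
        contour_integrable_continuous_linepath continuous_on_subset[OF Fw]) auto
  note s = path_image_rectpath_segments[OF le]
  show ?thesis
    by (subst continuous_on_cong[OF refl contour_integral_rectpath[OF le continuous_on_subset[OF Fw U(2)]]])
      (auto intro!: continuous_on_add seg s)
qed

text \<open>Half axes of the image of the Bernstein ellipse with parameter \<open>\<rho>\<close> under the affine map
  that takes \<open>[-1, 1]\<close> to \<open>[0, 1]\<close>.\<close>

definition rect_a :: "real \<Rightarrow> real" where "rect_a \<rho> = (\<rho> + inverse \<rho>) / 4"

definition rect_b :: "real \<Rightarrow> real" where "rect_b \<rho> = (\<rho> - inverse \<rho>) / 4"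

definition bernstein_rect :: "real \<Rightarrow> real \<Rightarrow> complex" where
  "bernstein_rect \<rho> = rectpath (Complex (1/2 - rect_a \<rho>) (- (rect_b \<rho>)))
    (Complex (1/2 + rect_a \<rho>) (rect_b \<rho>))"

abbreviation rect_integral :: "real \<Rightarrow> (complex \<Rightarrow> complex) \<Rightarrow> complex" where
  "rect_integral \<rho> \<equiv> contour_integral (bernstein_rect \<rho>)"

text \<open>A lower bound for the distance between [0, 1] and the contour.\<close>

definition bernstein_gap :: "real \<Rightarrow> real" where
  "bernstein_gap \<rho> = min (rect_b \<rho>) (rect_a \<rho> - 1/2)"

lemma bernstein_gap_pos:
  assumes "\<rho> > 1"
  shows "bernstein_gap \<rho> > 0" "rect_b \<rho> > 0" "rect_a \<rho> > 1/2"
proof -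
  have "inverse \<rho> < 1" using assms by (simp add: inverse_less_1_iff)
  then have "inverse \<rho> < \<rho>" using assms by (rule less_trans)
  then show 1: "rect_b \<rho> > 0" unfolding rect_b_def by simp
  have "(\<rho> + inverse \<rho>) - 2 = (\<rho> - 1)\<^sup>2 / \<rho>"
    using assms by (simp add: power2_eq_square field_simps)
  also have "\<dots> > 0" using assms by simp
  finally show 2: "rect_a \<rho> > 1/2" unfolding rect_a_def by simp
  show "bernstein_gap \<rho> > 0" unfolding bernstein_gap_def using 1 2 by simp
qed

lemma path_image_bernstein_rect:
  assumes \<rho>: "\<rho> > 1" and z: "z \<in> path_image (bernstein_rect \<rho>)"
  shows "\<bar>Im z\<bar> \<le> rect_b \<rho>"
    and "\<bar>Im (2 * z - 1)\<bar> = 2 * rect_b \<rho> \<or> \<bar>Re (2 * z - 1)\<bar> = 2 * rect_a \<rho>"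
    and "x \<in> {0..1} \<Longrightarrow> bernstein_gap \<rho> \<le> norm (z - of_real x)"
proof -
  note gap = bernstein_gap_pos[OF \<rho>]
  have z': "Re z \<in> {1/2 - rect_a \<rho>, 1/2 + rect_a \<rho>} \<and> \<bar>Im z\<bar> \<le> rect_b \<rho> \<or>
      \<bar>Im z\<bar> = rect_b \<rho>"
    using z gap unfolding bernstein_rect_def by (subst (asm) path_image_rectpath) (auto simp: abs_le_iff)
  then show "\<bar>Im z\<bar> \<le> rect_b \<rho>" by auto
  show "\<bar>Im (2 * z - 1)\<bar> = 2 * rect_b \<rho> \<or> \<bar>Re (2 * z - 1)\<bar> = 2 * rect_a \<rho>"
    using z' gap by (auto simp: abs_mult)
  assume x: "x \<in> {0..1}"
  from z' show "bernstein_gap \<rho> \<le> norm (z - of_real x)"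
  proof
    assume "\<bar>Im z\<bar> = rect_b \<rho>"
    then show ?thesis using abs_Im_le_cmod[of "z - of_real x"] unfolding bernstein_gap_def by simp
  next
    assume "Re z \<in> {1/2 - rect_a \<rho>, 1/2 + rect_a \<rho>} \<and> \<bar>Im z\<bar> \<le> rect_b \<rho>"
    then have "rect_a \<rho> - 1/2 \<le> \<bar>Re (z - of_real x)\<bar>" using x by auto
    then show ?thesis using abs_Re_le_cmod[of "z - of_real x"] unfolding bernstein_gap_def by linarith
  qed
qed

lemma
  assumes \<rho>: "\<rho> > 1"
  shows contour_integrable_bernstein_rect:
      "continuous_on (path_image (bernstein_rect \<rho>)) g \<Longrightarrow> g contour_integrable_on bernstein_rect \<rho>"
    and norm_contour_integral_bernstein_rect_le:
      "continuous_on (path_image (bernstein_rect \<rho>)) g \<Longrightarrow> 0 \<le> B \<Longrightarrow>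
       (\<And>z. z \<in> path_image (bernstein_rect \<rho>) \<Longrightarrow> norm (g z) \<le> B) \<Longrightarrow>
       norm (rect_integral \<rho> g) \<le> B * (2 * \<rho>)"
    and continuous_on_contour_integral_bernstein_rect:
      "open U \<Longrightarrow> path_image (bernstein_rect \<rho>) \<subseteq> U \<Longrightarrow> continuous_on (U \<times> U) (\<lambda>(x, y). F x y) \<Longrightarrow>
       continuous_on U (\<lambda>w. rect_integral \<rho> (F w))"
proof -
  note gap = bernstein_gap_pos[OF \<rho>]
  show "continuous_on (path_image (bernstein_rect \<rho>)) g \<Longrightarrow> g contour_integrable_on bernstein_rect \<rho>"
    unfolding bernstein_rect_def using gap \<rho> by (intro contour_integrable_rectpath) auto
  show "norm (rect_integral \<rho> g) \<le> B * (2 * \<rho>)"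
    if "continuous_on (path_image (bernstein_rect \<rho>)) g" "0 \<le> B"
      "\<And>z. z \<in> path_image (bernstein_rect \<rho>) \<Longrightarrow> norm (g z) \<le> B"
  proof -
    let ?a = "Complex (1/2 - rect_a \<rho>) (- (rect_b \<rho>))"
    let ?b = "Complex (1/2 + rect_a \<rho>) (rect_b \<rho>)"
    have "norm (rect_integral \<rho> g) \<le> B * (2 * (Re ?b - Re ?a) + 2 * (Im ?b - Im ?a))"
      using that gap \<rho> unfolding bernstein_rect_def by (intro norm_contour_integral_rectpath_le) auto
    \<comment> \<open>The perimeter is \<open>4 * (rect_a \<rho> + rect_b \<rho>)\<close>, and the
      inverses cancel.\<close>
    also have "2 * (Re ?b - Re ?a) + 2 * (Im ?b - Im ?a) = 2 * \<rho>" by (simp add: rect_a_def rect_b_def field_simps)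
    finally show ?thesis .
  qed
  show "open U \<Longrightarrow> path_image (bernstein_rect \<rho>) \<subseteq> U \<Longrightarrow> continuous_on (U \<times> U) (\<lambda>(x, y). F x y) \<Longrightarrow>
       continuous_on U (\<lambda>w. rect_integral \<rho> (F w))"
    unfolding bernstein_rect_def using gap \<rho> by (intro continuous_on_contour_integral_rectpath) auto
qed

lemma Cauchy_bernstein_rect:
  assumes \<rho>: "\<rho> > 1" and Y: "rect_b \<rho> < Y" and f: "f holomorphic_on {z. \<bar>Im z\<bar> < Y}"
    and x: "x \<in> {0..1}"
  shows "((\<lambda>z. f z / (z - of_real x)) has_contour_integral (2 * pi * \<i> * f (of_real x))) (bernstein_rect \<rho>)"
proof -
  note gap = bernstein_gap_pos[OF \<rho>]
  let ?U = "{z. \<bar>Im z\<bar> < Y}"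
  have U: "?U = {z. Im z < Y} \<inter> {z. Im z > - Y}" by auto
  have op: "open ?U" unfolding U by (intro open_Int open_halfspace_Im_lt open_halfspace_Im_gt)
  have cv: "convex ?U" unfolding U by (intro convex_Int convex_halfspace_Im_lt convex_halfspace_Im_gt)
  have "winding_number (bernstein_rect \<rho>) (of_real x) = 1"
    unfolding bernstein_rect_def using gap x by (intro winding_number_rectpath) (auto simp: in_box_complex_iff)
  moreover have "path_image (bernstein_rect \<rho>) \<subseteq> ?U - {of_real x}"
    using path_image_bernstein_rect(1,3)[OF \<rho>] x gap(1) Y by fastforce
  moreover have "of_real x \<in> interior ?U"
    unfolding interior_open[OF op] using Y gap by auto
  ultimately show ?thesis
    using Cauchy_integral_formula_convex_simple[OF cv f, of "of_real x" "bernstein_rect \<rho>"]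
    by (auto simp: bernstein_rect_def)
qed

text \<open>Hermite's remainder formula: the kernel is \<open>(T z - T x) / (2 \<pi> \<i> T z (z - x))\<close> with the
  Chebyshev polynomial \<open>T\<close> of degree \<open>n\<close>. It is a polynomial in \<open>x\<close>, and its error is
  governed by \<open>T x / T z\<close>.\<close>

definition hermite_kernel :: "real \<Rightarrow> real \<Rightarrow> nat \<Rightarrow> (nat \<Rightarrow> complex \<Rightarrow> complex) \<Rightarrow> complex set \<Rightarrow> bool" where
  "hermite_kernel \<rho> c n \<kappa> V \<longleftrightarrow> open V \<and> path_image (bernstein_rect \<rho>) \<subseteq> V \<and>
    (\<forall>j. continuous_on V (\<kappa> j)) \<and>
    (\<forall>z\<in>path_image (bernstein_rect \<rho>). \<forall>x\<in>{0..1}. norm (\<Sum>j<n. \<kappa> j z * of_real x ^ j) \<le> c) \<and>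
    (\<forall>f Y M x. rect_b \<rho> < Y \<longrightarrow> f holomorphic_on {z. \<bar>Im z\<bar> < Y} \<longrightarrow> x \<in> {0..1} \<longrightarrow>
       (\<forall>z\<in>path_image (bernstein_rect \<rho>). norm (f z) \<le> M) \<longrightarrow>
       norm (f (of_real x) - rect_integral \<rho> (\<lambda>z. f z * (\<Sum>j<n. \<kappa> j z * of_real x ^ j)))
         \<le> c * M * inverse \<rho> ^ n)"

lemma hermite_kernel_exists:
  assumes \<rho>: "\<rho> > 1"
  shows "\<exists>c\<ge>0. \<forall>n\<ge>1. \<exists>\<kappa> V. hermite_kernel \<rho> c n \<kappa> V"
proof -
  note gap = bernstein_gap_pos[OF \<rho>]
  let ?G = "path_image (bernstein_rect \<rho>)"
  define \<delta> where "\<delta> = bernstein_gap \<rho>"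
  \<comment> \<open>For \<open>n \<ge> 1\<close> the lower bound \<open>(\<rho> ^ n - 1) / 2\<close>
    on the contour is at least \<open>q * \<rho> ^ n\<close>.\<close>
  define q where "q = (1 - inverse \<rho>) / 2"
  have q: "q > 0" using \<rho> unfolding q_def by (simp add: inverse_less_1_iff)
  have \<delta>: "\<delta> > 0" unfolding \<delta>_def by (rule gap)
  \<comment> \<open>The first summand bounds the kernel, the second the remainder integral over a
    contour of length \<open>2 * \<rho>\<close>; the factor 1 / (2 pi) is estimated by 1. No part of
    it depends on the degree.\<close>
  define c where "c = (1 + inverse q) * inverse \<delta> + inverse q * inverse \<delta> * (2 * \<rho>)"
  have c0: "c \<ge> 0" unfolding c_def using q \<delta> \<rho> by simp
  show ?thesis
  proof (intro exI[of _ c] conjI c0 allI impI)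
    fix n :: nat assume n: "n \<ge> 1"
    obtain p0 :: "complex poly" where p0: "degree p0 \<le> n"
      "\<And>w. w \<noteq> 0 \<Longrightarrow> poly p0 ((w + inverse w) / 2) = (w ^ n + inverse w ^ n) / 2"
      using chebyshev_poly_exists by blast
    \<comment> \<open>Substituting \<open>2 * x - 1\<close> moves the Chebyshev polynomial from
      [-1, 1] to [0, 1].\<close>
    define p where "p = pcompose p0 [:-1, 2:]"
    define T where "T = poly p"
    have T0: "T z = poly p0 (2 * z - 1)" for z unfolding T_def p_def by (simp add: poly_pcompose algebra_simps)
    have deg: "degree p \<le> n" unfolding p_def using p0(1) degree_pcompose_le[of p0 "[:-1, 2:]"] by simp
    have Tsum: "T z = (\<Sum>i\<le>n. coeff p i * z ^ i)" for z
    proof -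
      have "T z = (\<Sum>i\<le>degree p. coeff p i * z ^ i)" unfolding T_def by (rule poly_altdef)
      also have "\<dots> = (\<Sum>i\<le>n. coeff p i * z ^ i)"
        using deg by (intro sum.mono_neutral_left) (auto simp: coeff_eq_0)
      finally show ?thesis .
    qed
    have contT: "continuous_on V T" for V unfolding T_def by (intro continuous_intros)
    \<comment> \<open>The coefficients of the kernel have poles at the zeros of \<open>T\<close>.
      Continuity is needed on an open neighbourhood of the contour, since parametric contour
      integrals will be taken there.\<close>
    define V where "V = {z. T z \<noteq> 0}"
    have V: "open V"
    proof -
      have "V = - (T -` {0})" unfolding V_def by auto
      moreover have "closed (T -` {0})" by (intro closed_vimage contT) auto
      ultimately show ?thesis by (metis open_Compl)
    qed
    have rhon: "\<rho> ^ n * (1 - inverse \<rho>) \<le> \<rho> ^ n - 1"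
    proof -
      have "\<rho> ^ n * inverse \<rho> = \<rho> ^ (n - 1)" using n \<rho> by (cases n) auto
      moreover have "\<rho> ^ (n - 1) \<ge> 1" using \<rho> by simp
      ultimately show ?thesis by (simp add: algebra_simps)
    qed
    have Tlow: "norm (T z) \<ge> q * \<rho> ^ n" if "z \<in> ?G" for z
    proof -
      have "(\<rho> ^ n - 1) / 2 \<le> norm (T z)"
        unfolding T0 using path_image_bernstein_rect(2)[OF \<rho> that] \<rho> p0(2)
        by (intro chebyshev_poly_lower_bound) (auto simp: rect_a_def rect_b_def)
      then show ?thesis using rhon unfolding q_def by (simp add: algebra_simps)
    qed
    have qn: "q * \<rho> ^ n > 0" using q \<rho> by simp
    have Tinv: "norm (inverse (T z)) \<le> inverse q * inverse \<rho> ^ n" if "z \<in> ?G" for z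
      using le_imp_inverse_le[OF Tlow[OF that] qn] by (simp add: norm_inverse power_inverse)
    have Tinv1: "norm (inverse (T z)) \<le> inverse q" if "z \<in> ?G" for z
    proof -
      have "inverse \<rho> ^ n \<le> 1" using \<rho> by (intro power_le_one) (auto simp: inverse_le_1_iff)
      then have "inverse q * inverse \<rho> ^ n \<le> inverse q * 1" using q by (intro mult_left_mono) auto
      then show ?thesis using Tinv[OF that] by simp
    qed
    have TG: "T z \<noteq> 0" if "z \<in> ?G" for z using Tlow[OF that] qn by auto
    have Tx: "norm (T (of_real x)) \<le> 1" if "x \<in> {0..1}" for x
      using chebyshev_poly_upper_bound[OF p0(2), of "2 * x - 1"] that unfolding T0 by (simp add: abs_le_iff)
    \<comment> \<open>The coefficients of the polynomial \<open>(T x - T z) / (x - z)\<close> in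
      \<open>x\<close>; they are polynomials in \<open>z\<close>.\<close>
    define num where "num j z = (\<Sum>i=Suc j..n. coeff p i * z ^ (i - j - 1))" for j z
    define \<kappa> where "\<kappa> j z = num j z / (2 * pi * \<i> * T z)" for j z
    have K: "(\<Sum>j<n. \<kappa> j z * of_real x ^ j) = (1 - T (of_real x) * inverse (T z)) / (2 * pi * \<i> * (z - of_real x))"
      if "z \<in> ?G" "x \<in> {0..1}" for z x
    proof -
      have zx: "z - of_real x \<noteq> 0" using path_image_bernstein_rect(3)[OF \<rho> that] \<delta> unfolding \<delta>_def by auto
      have "T (of_real x) - T z = (of_real x - z) * (\<Sum>j<n. num j z * of_real x ^ j)"
        unfolding Tsum num_def by (rule polyfun_diff[OF n])
      also have "(\<Sum>j<n. num j z * of_real x ^ j)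
          = (\<Sum>j<n. \<kappa> j z * of_real x ^ j) * (2 * pi * \<i> * T z)"
        unfolding sum_distrib_right \<kappa>_def using TG[OF that(1)] by (intro sum.cong refl) simp
      finally have "T z - T (of_real x) = (z - of_real x) * ((\<Sum>j<n. \<kappa> j z * of_real x ^ j) * (2 * pi * \<i> * T z))"
        by (simp add: algebra_simps)
      then show ?thesis using zx TG[OF that(1)] by (simp add: field_simps)
    qed
    have invd: "norm (inverse (z - of_real x)) \<le> inverse \<delta>" if "z \<in> ?G" "x \<in> {0..1}" for z x
      using path_image_bernstein_rect(3)[OF \<rho> that] \<delta> unfolding \<delta>_def norm_inverse by (intro le_imp_inverse_le)
    have pi1: "inverse (2 * pi) \<le> 1" using pi_gt3 by (intro inverse_le_1_iff[THEN iffD2]) auto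
    have npi: "norm (inverse (2 * pi * \<i>)) = inverse (2 * pi)" by (simp add: norm_mult norm_inverse)
    show "\<exists>\<kappa> V. hermite_kernel \<rho> c n \<kappa> V"
      unfolding hermite_kernel_def
    proof (intro exI[of _ \<kappa>] exI[of _ V] conjI V ballI allI impI)
      show "?G \<subseteq> V" unfolding V_def using TG by auto
      show "continuous_on V (\<kappa> j)" for j
      proof -
        have "continuous_on V (num j)" unfolding num_def[abs_def] by (intro continuous_intros)
        then show ?thesis unfolding \<kappa>_def[abs_def]
          by (rule continuous_on_divide) (auto intro!: continuous_intros contT simp: V_def)
      qed
      show "norm (\<Sum>j<n. \<kappa> j z * of_real x ^ j) \<le> c" if z: "z \<in> ?G" and x: "x \<in> {0..1}" for z x
      proof -
        have "(\<Sum>j<n. \<kappa> j z * of_real x ^ j)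
          = (1 - T (of_real x) * inverse (T z)) * (inverse (2 * pi * \<i>) * inverse (z - of_real x))"
          unfolding K[OF z x] by (simp only: divide_inverse inverse_mult_distrib)
        also have "norm \<dots> = norm (1 - T (of_real x) * inverse (T z)) * (inverse (2 * pi) * norm (inverse (z - of_real x)))"
          unfolding norm_mult npi by simp
        also have "\<dots> \<le> (1 + inverse q) * (1 * inverse \<delta>)"
        proof (intro mult_mono)
          have "norm (1 - T (of_real x) * inverse (T z)) \<le> norm (1::complex) + norm (T (of_real x) * inverse (T z))"
            by (rule norm_triangle_ineq4)
          also have "norm (T (of_real x) * inverse (T z)) \<le> 1 * inverse q"
            unfolding norm_mult using q by (intro mult_mono Tx Tinv1 z x) auto
          finally show "norm (1 - T (of_real x) * inverse (T z)) \<le> 1 + inverse q" by simp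
        qed (use q \<delta> pi1 invd[OF z x] in auto)
        also have "\<dots> \<le> c" unfolding c_def using q \<delta> \<rho> by simp
        finally show ?thesis .
      qed
      fix f :: "complex \<Rightarrow> complex" and Y M x :: real
      assume Y: "rect_b \<rho> < Y" and f: "f holomorphic_on {z. \<bar>Im z\<bar> < Y}" and x: "x \<in> {0..1}"
        and M: "\<forall>z\<in>?G. norm (f z) \<le> M"
      have GU: "?G \<subseteq> {z. \<bar>Im z\<bar> < Y}" using path_image_bernstein_rect(1)[OF \<rho>] Y by fastforce
      have fG: "continuous_on ?G f" using holomorphic_on_imp_continuous_on[OF f] GU continuous_on_subset by blast
      have zx: "z - of_real x \<noteq> 0" if "z \<in> ?G" for z
        using path_image_bernstein_rect(3)[OF \<rho> that x] \<delta> unfolding \<delta>_def by auto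
      \<comment> \<open>The Cauchy integrand times \<open>T x / T z\<close>: exactly what the kernel
        leaves out of Cauchy's formula.\<close>
      define E where "E z = f z * T (of_real x) * inverse (T z) * inverse (2 * pi * \<i>) * inverse (z - of_real x)" for z
      have Econt: "continuous_on ?G E" unfolding E_def[abs_def]
        by (intro continuous_intros fG contT) (use TG zx in auto)
      have cancel: "inverse a * (a * b) = b" if "a \<noteq> 0" for a b :: complex using that by simp
      have "((\<lambda>z. inverse (2 * pi * \<i>) * (f z / (z - of_real x))) has_contour_integral
         (inverse (2 * pi * \<i>) * (2 * pi * \<i> * f (of_real x)))) (bernstein_rect \<rho>)"
        by (intro has_contour_integral_lmul Cauchy_bernstein_rect[OF \<rho> Y f x])
      moreover have "inverse (2 * pi * \<i>) * (2 * pi * \<i> * f (of_real x)) = f (of_real x)"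
        by (rule cancel) simp
      ultimately have c1: "((\<lambda>z. inverse (2 * pi * \<i>) * (f z / (z - of_real x))) has_contour_integral f (of_real x)) (bernstein_rect \<rho>)"
        by (simp only:)
      have "((\<lambda>z. inverse (2 * pi * \<i>) * (f z / (z - of_real x)) - E z) has_contour_integral
         (f (of_real x) - rect_integral \<rho> E)) (bernstein_rect \<rho>)"
        by (intro has_contour_integral_diff c1 has_contour_integral_integral contour_integrable_bernstein_rect \<rho> Econt)
      then have "rect_integral \<rho> (\<lambda>z. inverse (2 * pi * \<i>) * (f z / (z - of_real x)) - E z)
         = f (of_real x) - rect_integral \<rho> E"
        by (rule contour_integral_unique)
      moreover have "rect_integral \<rho> (\<lambda>z. f z * (\<Sum>j<n. \<kappa> j z * of_real x ^ j))
         = rect_integral \<rho> (\<lambda>z. inverse (2 * pi * \<i>) * (f z / (z - of_real x)) - E z)"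
      proof (rule contour_integral_eq)
        have alg: "a * ((1 - b * c) / (p * q)) = inverse p * (a / q) - a * b * c * inverse p * inverse q"
          for a b c p q :: complex by (simp add: divide_inverse algebra_simps)
        fix z assume z: "z \<in> ?G"
        show "f z * (\<Sum>j<n. \<kappa> j z * of_real x ^ j) = inverse (2 * pi * \<i>) * (f z / (z - of_real x)) - E z"
          unfolding K[OF z x] E_def by (rule alg)
      qed
      ultimately have eq: "f (of_real x) - rect_integral \<rho> (\<lambda>z. f z * (\<Sum>j<n. \<kappa> j z * of_real x ^ j))
         = rect_integral \<rho> E" by simp
      have Gne: "?G \<noteq> {}" by (simp add: bernstein_rect_def)
      have M0: "M \<ge> 0" using M Gne norm_ge_zero order_trans by blast
      have "norm (rect_integral \<rho> E) \<le> (M * (inverse q * inverse \<rho> ^ n) * inverse \<delta>) * (2 * \<rho>)"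
      proof (rule norm_contour_integral_bernstein_rect_le[OF \<rho> Econt])
        show "0 \<le> M * (inverse q * inverse \<rho> ^ n) * inverse \<delta>" using M0 q \<rho> \<delta> by simp
        fix z assume z: "z \<in> ?G"
        have "norm (E z) = norm (f z) * norm (T (of_real x)) * norm (inverse (T z)) * inverse (2 * pi) * norm (inverse (z - of_real x))"
          unfolding E_def norm_mult npi by simp
        also have "\<dots> \<le> M * 1 * (inverse q * inverse \<rho> ^ n) * 1 * inverse \<delta>"
          using M0 q \<rho> \<delta> M z pi1 by (intro mult_mono Tx x Tinv invd) auto
        finally show "norm (E z) \<le> M * (inverse q * inverse \<rho> ^ n) * inverse \<delta>" by simp
      qed
      also have "\<dots> = (inverse q * inverse \<delta> * (2 * \<rho>)) * M * inverse \<rho> ^ n" by (simp add: mult_ac)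
      also have "\<dots> \<le> c * M * inverse \<rho> ^ n"
        using M0 q \<rho> \<delta> by (intro mult_right_mono) (auto simp: c_def)
      finally show "norm (f (of_real x) - rect_integral \<rho> (\<lambda>z. f z * (\<Sum>j<n. \<kappa> j z * of_real x ^ j)))
         \<le> c * M * inverse \<rho> ^ n" unfolding eq .
    qed
  qed
qed

text \<open>The kernel is applied in the second variable on the contour and then in the first. The
  error of the second variable is integrated once more against the kernel of the first, which gives
  the summand \<open>c * c * (2 * \<rho>)\<close> in the constant. The constant is fixed before the
  degree and the function.\<close>

lemma bivariate_polynomial_approximation:
  assumes \<rho>: "\<rho> > 1" and Y: "rect_b \<rho> < Y"
  shows "\<exists>C\<ge>0. \<forall>n\<ge>1. \<forall>(H :: complex \<Rightarrow> complex \<Rightarrow> complex) M.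
    continuous_on ({z. \<bar>Im z\<bar> < Y} \<times> {z. \<bar>Im z\<bar> < Y}) (\<lambda>(z, w). H z w) \<longrightarrow>
    (\<forall>w. \<bar>Im w\<bar> < Y \<longrightarrow> (\<lambda>z. H z w) holomorphic_on {z. \<bar>Im z\<bar> < Y}) \<longrightarrow>
    (\<forall>z. \<bar>Im z\<bar> < Y \<longrightarrow> H z holomorphic_on {z. \<bar>Im z\<bar> < Y}) \<longrightarrow>
    (\<forall>z w. \<bar>Im z\<bar> \<le> rect_b \<rho> \<longrightarrow> \<bar>Im w\<bar> \<le> rect_b \<rho> \<longrightarrow> norm (H z w) \<le> M) \<longrightarrow>
    (\<exists>d. \<forall>s\<in>{0..1}. \<forall>t\<in>{0..1}. norm (H (of_real s) (of_real t)
       - (\<Sum>i<n. \<Sum>j<n. d i j * of_real s ^ i * of_real t ^ j)) \<le> C * M * inverse \<rho> ^ n)"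
proof -
  let ?G = "path_image (bernstein_rect \<rho>)" and ?U = "{z :: complex. \<bar>Im z\<bar> < Y}"
  note gap = bernstein_gap_pos[OF \<rho>]
  have U: "?U = {z. Im z < Y} \<inter> {z. Im z > - Y}" by auto
  have op: "open ?U" unfolding U by (intro open_Int open_halfspace_Im_lt open_halfspace_Im_gt)
  have GU: "?G \<subseteq> ?U" using path_image_bernstein_rect(1)[OF \<rho>] Y by fastforce
  have realU: "of_real x \<in> ?U" for x using Y gap by simp
  obtain c where c: "c \<ge> 0" and kernel: "\<And>n. n \<ge> 1 \<Longrightarrow> \<exists>\<kappa> V. hermite_kernel \<rho> c n \<kappa> V"
    using hermite_kernel_exists[OF \<rho>] by blast
  define C where "C = c + c * c * (2 * \<rho>)"
  have C0: "C \<ge> 0" unfolding C_def using c \<rho> by simp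
  show ?thesis
  proof (intro exI[of _ C] conjI C0 allI impI)
    fix n :: nat and H :: "complex \<Rightarrow> complex \<Rightarrow> complex" and M
    assume n: "n \<ge> 1"
      and cont: "continuous_on (?U \<times> ?U) (\<lambda>(z, w). H z w)"
      and hol1: "\<forall>w. \<bar>Im w\<bar> < Y \<longrightarrow> (\<lambda>z. H z w) holomorphic_on ?U"
      and hol2: "\<forall>z. \<bar>Im z\<bar> < Y \<longrightarrow> H z holomorphic_on ?U"
      and bound: "\<forall>z w. \<bar>Im z\<bar> \<le> rect_b \<rho> \<longrightarrow> \<bar>Im w\<bar> \<le> rect_b \<rho> \<longrightarrow> norm (H z w) \<le> M"
    obtain \<kappa> V where hk: "hermite_kernel \<rho> c n \<kappa> V" using kernel[OF n] by blast
    note hk' = hk[unfolded hermite_kernel_def]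
    have V: "open V" "?G \<subseteq> V" and \<kappa>: "\<And>j. continuous_on V (\<kappa> j)" using hk' by auto
    note K = hk'[THEN conjunct2, THEN conjunct2, THEN conjunct2, THEN conjunct1]
    note approx = hk'[THEN conjunct2, THEN conjunct2, THEN conjunct2, THEN conjunct2, rule_format]
    have M0: "0 \<le> M" using order_trans[OF norm_ge_zero[of "H 0 0"], of M] bound[rule_format, of 0 0] gap by simp
    have imG: "\<bar>Im z\<bar> \<le> rect_b \<rho>" if "z \<in> ?G" for z using path_image_bernstein_rect(1)[OF \<rho> that] .
    \<comment> \<open>An open set around the contour on which both \<open>H\<close> and the kernel
      coefficients are continuous.\<close>
    define W where "W = ?U \<inter> V"
    have W: "open W" "?G \<subseteq> W" unfolding W_def using op V GU by auto
    define A where "A j z = rect_integral \<rho> (\<lambda>w. H z w * \<kappa> j w)" for j z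
    have contWW: "continuous_on (W \<times> W) (\<lambda>(z, w). H z w * \<kappa> j w)" for j
    proof -
      have "continuous_on (W \<times> W) (\<lambda>x. (\<lambda>(z, w). H z w) x * \<kappa> j (snd x))"
      proof (intro continuous_on_mult continuous_on_subset[OF cont])
        show "continuous_on (W \<times> W) (\<lambda>x. \<kappa> j (snd x))"
          by (rule continuous_on_compose2[OF \<kappa>]) (auto simp: W_def intro: continuous_intros)
      qed (auto simp: W_def)
      then show ?thesis by (simp add: case_prod_beta')
    qed
    have A: "continuous_on W (A j)" for j
      unfolding A_def[abs_def]
      by (rule continuous_on_contour_integral_bernstein_rect[OF \<rho> W contWW])
    have AG: "continuous_on ?G (A j)" for j by (rule continuous_on_subset[OF A W(2)])
    have \<kappa>G: "continuous_on ?G (\<kappa> j)" for j by (rule continuous_on_subset[OF \<kappa> V(2)])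
    have HG2: "continuous_on ?G (H z)" if "z \<in> ?U" for z
      using hol2 that holomorphic_on_imp_continuous_on continuous_on_subset GU by blast
    have HG1: "continuous_on ?G (\<lambda>z. H z w)" if "w \<in> ?U" for w
      using hol1 that holomorphic_on_imp_continuous_on continuous_on_subset GU by blast
    have Asum: "(\<Sum>j<n. A j z * of_real t ^ j)
       = rect_integral \<rho> (\<lambda>w. H z w * (\<Sum>j<n. \<kappa> j w * of_real t ^ j))"
      if z: "z \<in> ?U" for z t
    proof -
      have "rect_integral \<rho> (\<lambda>w. H z w * (\<Sum>j<n. \<kappa> j w * of_real t ^ j))
        = rect_integral \<rho> (\<lambda>w. \<Sum>j<n. (H z w * \<kappa> j w) * of_real t ^ j)"
        by (simp add: sum_distrib_left mult_ac)
      also have "\<dots> = (\<Sum>j<n. rect_integral \<rho> (\<lambda>w. (H z w * \<kappa> j w) * of_real t ^ j))"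
        by (intro contour_integral_sum contour_integrable_bernstein_rect[OF \<rho>] continuous_intros HG2 \<kappa>G z) auto
      also have "\<dots> = (\<Sum>j<n. A j z * of_real t ^ j)"
        unfolding A_def
        by (intro sum.cong refl contour_integral_rmul contour_integrable_bernstein_rect[OF \<rho>] continuous_intros HG2 \<kappa>G z)
      finally show ?thesis by simp
    qed
    define d where "d i j = rect_integral \<rho> (\<lambda>z. A j z * \<kappa> i z)" for i j
    show "\<exists>d. \<forall>s\<in>{0..1}. \<forall>t\<in>{0..1}. norm (H (of_real s) (of_real t)
       - (\<Sum>i<n. \<Sum>j<n. d i j * of_real s ^ i * of_real t ^ j)) \<le> C * M * inverse \<rho> ^ n"
    proof (intro exI[of _ d] ballI)
      fix s t :: real assume s: "s \<in> {0..1}" and t: "t \<in> {0..1}"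
      define k where "k z = (\<Sum>i<n. \<kappa> i z * of_real s ^ i)" for z
      have kG: "continuous_on ?G k" unfolding k_def[abs_def] by (intro continuous_intros \<kappa>G)
      \<comment> \<open>The approximation error in the second variable, as a function of the first
        one on the contour.\<close>
      define D where "D z = H z (of_real t) - (\<Sum>j<n. A j z * of_real t ^ j)" for z
      have DG: "continuous_on ?G D" unfolding D_def[abs_def] by (intro continuous_intros AG HG1 realU)
      have Dbound: "norm (D z) \<le> c * M * inverse \<rho> ^ n" if z: "z \<in> ?G" for z
      proof -
        have zU: "z \<in> ?U" using z GU by auto
        then have h: "H z holomorphic_on ?U" using hol2 by auto
        show ?thesis unfolding D_def Asum[OF zU]
          using bound imG z by (intro approx[OF Y h t]) auto
      qed
      have "(\<Sum>i<n. \<Sum>j<n. d i j * of_real s ^ i * of_real t ^ j)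
        = (\<Sum>j<n. \<Sum>i<n. rect_integral \<rho> (\<lambda>z. A j z * \<kappa> i z * (of_real s ^ i * of_real t ^ j)))"
      proof (subst sum.swap, intro sum.cong refl)
        fix i j
        have "d i j * (of_real s ^ i * of_real t ^ j)
           = rect_integral \<rho> (\<lambda>z. A j z * \<kappa> i z * (of_real s ^ i * of_real t ^ j))"
          unfolding d_def by (intro contour_integral_rmul[symmetric] contour_integrable_bernstein_rect[OF \<rho>]
            continuous_on_mult AG \<kappa>G)
        then show "d i j * of_real s ^ i * of_real t ^ j
           = rect_integral \<rho> (\<lambda>z. A j z * \<kappa> i z * (of_real s ^ i * of_real t ^ j))"
          by (simp only: mult.assoc)
      qed
      also have "\<dots> = rect_integral \<rho> (\<lambda>z. \<Sum>j<n. \<Sum>i<n. A j z * \<kappa> i z * (of_real s ^ i * of_real t ^ j))"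
        by (subst contour_integral_sum, simp, intro contour_integrable_bernstein_rect[OF \<rho>] continuous_intros AG \<kappa>G,
            intro sum.cong refl contour_integral_sum[symmetric] contour_integrable_bernstein_rect[OF \<rho>] continuous_intros AG \<kappa>G)
           simp
      also have "\<dots> = rect_integral \<rho> (\<lambda>z. H z (of_real t) * k z - D z * k z)"
      proof (rule contour_integral_eq)
        fix z
        have "H z (of_real t) * k z - D z * k z = (\<Sum>j<n. A j z * of_real t ^ j) * k z"
          unfolding D_def by (simp only: left_diff_distrib) simp
        also have "\<dots> = (\<Sum>j<n. \<Sum>i<n. (A j z * of_real t ^ j) * (\<kappa> i z * of_real s ^ i))"
          unfolding k_def by (rule sum_product)
        also have "\<dots> = (\<Sum>j<n. \<Sum>i<n. A j z * \<kappa> i z * (of_real s ^ i * of_real t ^ j))"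
          by (intro sum.cong refl) (simp only: mult_ac)
        finally show "(\<Sum>j<n. \<Sum>i<n. A j z * \<kappa> i z * (of_real s ^ i * of_real t ^ j))
           = H z (of_real t) * k z - D z * k z" by (rule sym)
      qed
      also have "\<dots> = rect_integral \<rho> (\<lambda>z. H z (of_real t) * k z)
           - rect_integral \<rho> (\<lambda>z. D z * k z)"
        by (intro contour_integral_diff contour_integrable_bernstein_rect[OF \<rho>] continuous_intros HG1 realU kG DG)
      finally have eq: "H (of_real s) (of_real t) - (\<Sum>i<n. \<Sum>j<n. d i j * of_real s ^ i * of_real t ^ j)
         = (H (of_real s) (of_real t) - rect_integral \<rho> (\<lambda>z. H z (of_real t) * k z))
           + rect_integral \<rho> (\<lambda>z. D z * k z)" by simp
      have h1: "(\<lambda>z. H z (of_real t)) holomorphic_on ?U" using hol1 realU by auto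
      have e1: "norm (H (of_real s) (of_real t) - rect_integral \<rho> (\<lambda>z. H z (of_real t) * k z))
          \<le> c * M * inverse \<rho> ^ n"
        unfolding k_def using bound imG gap by (intro approx[OF Y h1 s]) auto
      have e2: "norm (rect_integral \<rho> (\<lambda>z. D z * k z)) \<le> (c * M * inverse \<rho> ^ n * c) * (2 * \<rho>)"
      proof (rule norm_contour_integral_bernstein_rect_le[OF \<rho>])
        show "0 \<le> c * M * inverse \<rho> ^ n * c" using c M0 \<rho> by simp
        show "norm (D z * k z) \<le> c * M * inverse \<rho> ^ n * c" if "z \<in> ?G" for z
          unfolding norm_mult using Dbound[OF that] K[rule_format, OF that s] c M0 \<rho> unfolding k_def
          by (intro mult_mono) auto
      qed (intro continuous_intros DG kG)
      have "norm (H (of_real s) (of_real t) - (\<Sum>i<n. \<Sum>j<n. d i j * of_real s ^ i * of_real t ^ j))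
         \<le> c * M * inverse \<rho> ^ n + (c * M * inverse \<rho> ^ n * c) * (2 * \<rho>)"
        unfolding eq by (rule norm_triangle_le[OF add_mono[OF e1 e2]])
      also have "\<dots> = C * M * inverse \<rho> ^ n" unfolding C_def by (simp add: algebra_simps)
      finally show "norm (H (of_real s) (of_real t) - (\<Sum>i<n. \<Sum>j<n. d i j * of_real s ^ i * of_real t ^ j))
         \<le> C * M * inverse \<rho> ^ n" .
    qed
  qed
qed

subsection \<open>Averages of hyperbolic secants\<close>

lemma Re_cosh: "Re (cosh z) = cosh (Re z) * cos (Im z)"
  by (simp add: cosh_field_def Re_exp algebra_simps)

lemma Im_cosh: "Im (cosh z) = sinh (Re z) * sin (Im z)"
  by (simp add: cosh_field_def sinh_field_def Im_exp algebra_simps)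

lemma abs_sinh_le_cosh: "\<bar>sinh x\<bar> \<le> cosh (x :: real)"
  using sinh_le_cosh_real[of x] sinh_le_cosh_real[of "- x"] by (simp add: abs_le_iff)

lemma open_strip: "open {z. \<bar>Im z\<bar> < c}"
proof -
  have "{z. \<bar>Im z\<bar> < c} = {z. Im z < c} \<inter> {z. Im z > - c}" by auto
  then show ?thesis by (metis open_Int open_halfspace_Im_lt open_halfspace_Im_gt)
qed

definition csech :: "complex \<Rightarrow> complex" where "csech z = inverse (cosh z)"

lemma csech_of_real: "csech (of_real x) = of_real (sech x)"
proof -
  have "cosh (of_real x :: complex) = of_real (cosh x)"
    by (simp add: complex_eq_iff Re_cosh Im_cosh)
  then show ?thesis by (simp add: csech_def sech_def inverse_eq_divide)
qed

lemma Re_cosh_ge: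
  assumes "\<bar>Im z\<bar> < pi / 4"
  shows "1 / 2 \<le> Re (cosh z)"
proof -
  have "cos (pi / 4) \<le> cos \<bar>Im z\<bar>" using assms by (intro cos_monotone_0_pi_le) auto
  then have "sqrt 2 / 2 \<le> cos (Im z)" by (simp add: cos_45)
  moreover have "1 \<le> sqrt (2 :: real)" by simp
  ultimately have "1 / 2 \<le> cos (Im z)" by linarith
  moreover have "1 * cos (Im z) \<le> cosh (Re z) * cos (Im z)"
    using calculation cosh_real_ge_1[of "Re z"] by (intro mult_right_mono) auto
  ultimately show ?thesis unfolding Re_cosh by linarith
qed

lemma cosh_nonzero: "\<bar>Im z\<bar> < pi / 4 \<Longrightarrow> cosh z \<noteq> 0" for z :: complex
  using Re_cosh_ge[of z] by auto

lemma norm_csech_le: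
  assumes "\<bar>Im z\<bar> < pi / 4"
  shows "norm (csech z) \<le> 2"
proof -
  have "1 / 2 \<le> norm (cosh z)" using Re_cosh_ge[OF assms] complex_Re_le_cmod[of "cosh z"] by linarith
  then have "inverse (norm (cosh z)) \<le> inverse (1 / 2)" by (intro le_imp_inverse_le) auto
  then show ?thesis by (simp add: csech_def norm_inverse)
qed

text \<open>The argument of \<open>cosh z\<close> has tangent
  \<open>tanh (Re z) * tan (Im z)\<close>, so its size is at most that of \<open>Im z\<close>;
  inversion only reflects the argument.\<close>

lemma csech_cone:
  assumes z: "\<bar>Im z\<bar> \<le> \<beta>" and \<beta>: "\<beta> < pi / 4"
  shows "0 < Re (csech z)" "\<bar>Im (csech z)\<bar> \<le> tan \<beta> * Re (csech z)"
proof -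
  have b0: "0 \<le> \<beta>" using z by linarith
  let ?c = "cosh z"
  have re: "Re ?c > 0" using Re_cosh_ge[of z] z \<beta> by linarith
  have sq: "(Re ?c)\<^sup>2 + (Im ?c)\<^sup>2 > 0" using re by (simp add: sum_power2_gt_zero_iff)
  show "0 < Re (csech z)" using re sq by (simp add: csech_def)
  have cosb: "cos (Im z) > 0" using z \<beta> by (intro cos_gt_zero_pi) auto
  have "tan \<bar>Im z\<bar> \<le> tan \<beta>" using z \<beta> b0 by (cases "\<bar>Im z\<bar> = \<beta>") (auto intro!: less_imp_le tan_monotone)
  moreover have "tan \<bar>Im z\<bar> = \<bar>sin (Im z)\<bar> / cos (Im z)"
  proof (cases "Im z \<ge> 0")
    case True
    then have "sin (Im z) \<ge> 0" using z \<beta> by (intro sin_ge_zero) auto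
    then show ?thesis using True by (simp add: tan_def)
  next
    case False
    then have "sin (- Im z) \<ge> 0" using z \<beta> by (intro sin_ge_zero) auto
    then show ?thesis using False by (simp add: tan_def)
  qed
  ultimately have s: "\<bar>sin (Im z)\<bar> \<le> tan \<beta> * cos (Im z)" using cosb by (simp add: divide_le_eq)
  have "\<bar>Im ?c\<bar> = \<bar>sinh (Re z)\<bar> * \<bar>sin (Im z)\<bar>" unfolding Im_cosh by (simp add: abs_mult)
  also have "\<dots> \<le> cosh (Re z) * (tan \<beta> * cos (Im z))"
    using abs_sinh_le_cosh s by (intro mult_mono) auto
  also have "\<dots> = tan \<beta> * Re ?c" unfolding Re_cosh by simp
  finally have "\<bar>Im ?c\<bar> / ((Re ?c)\<^sup>2 + (Im ?c)\<^sup>2) \<le> tan \<beta> * Re ?c / ((Re ?c)\<^sup>2 + (Im ?c)\<^sup>2)"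
    using sq by (intro divide_right_mono) auto
  then show "\<bar>Im (csech z)\<bar> \<le> tan \<beta> * Re (csech z)" by (simp add: csech_def)
qed

text \<open>Two arguments below \<open>\<pi>/4\<close> add up to less than \<open>\<pi>/2\<close>, so a product of two factors of this
  cone, and hence any average of such products, stays away from zero.\<close>

definition cone_const :: "real \<Rightarrow> real" where
  "cone_const \<beta> = (1 + (tan \<beta>)\<^sup>2) / (1 - (tan \<beta>)\<^sup>2)"

lemma tan_sq_less_1:
  assumes "0 \<le> \<beta>" "\<beta> < pi / 4"
  shows "0 \<le> tan \<beta>" "(tan \<beta>)\<^sup>2 < 1"
proof -
  show t: "0 \<le> tan \<beta>" using tan_gt_zero[of \<beta>] assms by (cases "\<beta> = 0") auto
  have "tan \<beta> < tan (pi / 4)" using assms by (intro tan_monotone) auto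
  then show "(tan \<beta>)\<^sup>2 < 1" using t by (simp add: tan_45 power_less_one_iff)
qed

text \<open>With \<open>k = tan \<beta>\<close>, the real part of the product is at least
  \<open>(1 - k\<^sup>2) * (Re a * Re b)\<close> and its norm is at most
  \<open>(1 + k\<^sup>2) * (Re a * Re b)\<close>. The ratio \<open>cone_const \<beta>\<close> equals
  \<open>1 / cos (2 * \<beta>)\<close>, in accordance with an argument of at most
  \<open>2 * \<beta>\<close>.\<close>

lemma csech_product_cone:
  assumes z: "\<bar>Im z\<bar> \<le> \<beta>" and w: "\<bar>Im w\<bar> \<le> \<beta>" and \<beta>: "\<beta> < pi / 4"
  shows "0 < Re (csech z * csech w)" "norm (csech z * csech w) \<le> cone_const \<beta> * Re (csech z * csech w)"
proof -
  have b0: "0 \<le> \<beta>" using z by linarith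
  define k where "k = tan \<beta>"
  have k: "0 \<le> k" "k\<^sup>2 < 1" unfolding k_def using tan_sq_less_1[OF b0 \<beta>] by auto
  define a b where "a = csech z" and "b = csech w"
  have a: "0 < Re a" "\<bar>Im a\<bar> \<le> k * Re a" and b: "0 < Re b" "\<bar>Im b\<bar> \<le> k * Re b"
    unfolding a_def b_def k_def using csech_cone[OF z \<beta>] csech_cone[OF w \<beta>] by auto
  have "\<bar>Im a * Im b\<bar> \<le> (k * Re a) * (k * Re b)"
    unfolding abs_mult using a b k by (intro mult_mono) auto
  then have re: "(1 - k\<^sup>2) * (Re a * Re b) \<le> Re (a * b)"
    by (simp add: power2_eq_square algebra_simps abs_le_iff)
  have rr: "Re a * Re b > 0" using a b by simp
  have "(1 - k\<^sup>2) * (Re a * Re b) > 0" using rr k by simp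
  then show "0 < Re (csech z * csech w)" using re unfolding a_def b_def by linarith
  have n: "(norm c)\<^sup>2 \<le> (1 + k\<^sup>2) * (Re c)\<^sup>2" if "0 < Re c" "\<bar>Im c\<bar> \<le> k * Re c" for c
  proof -
    have "(Im c)\<^sup>2 \<le> (k * Re c)\<^sup>2" using that k by (metis abs_ge_zero power2_abs power_mono)
    then show ?thesis by (simp add: cmod_power2 power_mult_distrib algebra_simps)
  qed
  have "(norm (a * b))\<^sup>2 \<le> ((1 + k\<^sup>2) * (Re a)\<^sup>2) * ((1 + k\<^sup>2) * (Re b)\<^sup>2)"
    unfolding norm_mult power_mult_distrib using n a b by (intro mult_mono) auto
  also have "\<dots> = ((1 + k\<^sup>2) * (Re a * Re b))\<^sup>2" by (simp add: power2_eq_square algebra_simps)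
  finally have "norm (a * b) \<le> (1 + k\<^sup>2) * (Re a * Re b)"
    by (rule power2_le_imp_le) (use rr in auto)
  also have "\<dots> \<le> (1 + k\<^sup>2) * (Re (a * b) / (1 - k\<^sup>2))"
    using re k by (intro mult_left_mono) (auto simp: pos_le_divide_eq mult_ac)
  also have "\<dots> = cone_const \<beta> * Re (a * b)" unfolding cone_const_def k_def by simp
  finally show "norm (csech z * csech w) \<le> cone_const \<beta> * Re (csech z * csech w)" unfolding a_def b_def .
qed

lemma csech_holomorphic:
  assumes "open U" "\<And>z. z \<in> U \<Longrightarrow> \<bar>Im z\<bar> < pi / 4"
  shows "csech holomorphic_on U"
proof -
  have c: "cosh = (\<lambda>z :: complex. (exp z + exp (- z)) / 2)" by (simp add: fun_eq_iff cosh_field_def)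
  have "(cosh :: complex \<Rightarrow> complex) holomorphic_on U" unfolding c by (intro holomorphic_intros) auto
  then show ?thesis unfolding csech_def[abs_def] using assms cosh_nonzero by (intro holomorphic_on_inverse) auto
qed

lemma csech_scaled_holomorphic:
  assumes h: "h > 0"
  shows "(\<lambda>z. csech ((z - of_real a) / of_real h)) holomorphic_on {z. \<bar>Im z\<bar> < h * pi / 4}"
proof -
  have "csech holomorphic_on {z. \<bar>Im z\<bar> < pi / 4}"
    by (rule csech_holomorphic[OF open_strip]) auto
  then have "(csech \<circ> (\<lambda>z. (z - of_real a) / of_real h)) holomorphic_on {z. \<bar>Im z\<bar> < h * pi / 4}"
    using h by (intro holomorphic_on_compose_gen[of _ _ csech "{z. \<bar>Im z\<bar> < pi / 4}"] holomorphic_intros)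
      (auto simp: field_simps abs_mult)
  then show ?thesis by (simp add: o_def)
qed

lemma csech_measurable [measurable]: "csech \<in> borel_measurable borel"
proof -
  have c: "cosh = (\<lambda>z :: complex. (exp z + exp (- z)) / 2)" by (simp add: fun_eq_iff cosh_field_def)
  have [measurable]: "(exp :: complex \<Rightarrow> complex) \<in> borel_measurable borel"
    by (intro borel_measurable_continuous_onI continuous_intros)
  have "(cosh :: complex \<Rightarrow> complex) \<in> borel_measurable borel"
    unfolding c by measurable
  then show ?thesis unfolding csech_def[abs_def] by measurable
qed

text \<open>The solution above 1 of \<open>(\<theta> - 1 / \<theta>) / 4 = h * pi / 2\<close>: the
  ellipse about [0, 1] with this parameter has the height of the first poles of the rescaled
  sech.\<close>

definition analyticity_param :: "real \<Rightarrow> real" where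
  "analyticity_param h = h * pi + sqrt (h\<^sup>2 * pi\<^sup>2 + 1)"

text \<open>For \<open>r = sqrt \<theta>\<close> the product of \<open>r - 1 / r\<close> and
  \<open>r + 1 / r\<close> is \<open>\<theta> - 1 / \<theta> = 2 * h * pi\<close>, and the second
  factor exceeds 2.\<close>

lemma analyticity_param:
  assumes h: "h > 0"
  shows "analyticity_param h > 1" "sqrt (analyticity_param h) > 1" "rect_b (sqrt (analyticity_param h)) < h * pi / 4"
proof -
  let ?t = "analyticity_param h"
  have "sqrt (h\<^sup>2 * pi\<^sup>2 + 1) \<ge> 1" by simp
  moreover have "h * pi > 0" using h by simp
  ultimately show t: "?t > 1" unfolding analyticity_param_def by linarith
  then show r: "sqrt ?t > 1" by simp
  have inv: "?t * (sqrt (h\<^sup>2 * pi\<^sup>2 + 1) - h * pi) = 1"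
    unfolding analyticity_param_def by (simp add: algebra_simps power2_eq_square[symmetric] power_mult_distrib)
  then have it: "inverse ?t = sqrt (h\<^sup>2 * pi\<^sup>2 + 1) - h * pi" by (rule inverse_unique)
  define r where "r = sqrt ?t"
  have r1: "r > 1" using r unfolding r_def .
  have r2: "r\<^sup>2 = ?t" using t unfolding r_def by simp
  have "(r - inverse r) * (r + inverse r) = r\<^sup>2 - inverse (r\<^sup>2)"
    using r1 by (simp add: power2_eq_square algebra_simps)
  also have "\<dots> = 2 * (h * pi)" unfolding r2 it by (simp add: analyticity_param_def)
  finally have e: "(r - inverse r) * (r + inverse r) = 2 * (h * pi)" .
  have "rect_a r > 1/2" "rect_b r > 0" using bernstein_gap_pos[OF r1] by auto
  then have g: "r + inverse r > 2" "r - inverse r > 0" by (simp_all add: rect_a_def rect_b_def)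
  then have "(r - inverse r) * 2 < (r - inverse r) * (r + inverse r)" by (intro mult_strict_left_mono) auto
  then have "r - inverse r < h * pi" unfolding e by simp
  then show "rect_b (sqrt ?t) < h * pi / 4" unfolding rect_b_def r_def by simp
qed

text \<open>The weight \<open>\<omega>\<close> takes up the normalizing factors of the perturbation
  kernel, which depend on \<open>x\<close> but not on the perturbed score. Its bound
  \<open>W\<close> gives integrability and stays out of the constant, because the quotient is
  bounded by comparing numerator and denominator pointwise. Both variables range over [0, 1], which
  covers the shorter interval of the variance score.\<close>

lemma regression_function_approximation:
  fixes h :: real
  assumes h: "h > 0"
  shows "\<exists>C\<ge>0. \<forall>n\<ge>1. \<forall>(\<mu> :: 'a measure) g m v \<omega> W.
    prob_space \<mu> \<longrightarrow> g \<in> borel_measurable \<mu> \<longrightarrow> (\<forall>x\<in>space \<mu>. g x \<in> {0..1}) \<longrightarrow>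
    m \<in> borel_measurable \<mu> \<longrightarrow> v \<in> borel_measurable \<mu> \<longrightarrow> \<omega> \<in> borel_measurable \<mu> \<longrightarrow>
    (\<forall>x\<in>space \<mu>. 0 < \<omega> x \<and> \<omega> x \<le> W) \<longrightarrow>
    (\<exists>d. \<forall>s\<in>{0..1}. \<forall>t\<in>{0..1}.
      \<bar>(\<integral>x. g x * (sech ((s - m x) / h) * sech ((t - v x) / h) * \<omega> x) \<partial>\<mu>)
        / (\<integral>x. sech ((s - m x) / h) * sech ((t - v x) / h) * \<omega> x \<partial>\<mu>)
       - (\<Sum>i<n. \<Sum>j<n. d i j * s ^ i * t ^ j)\<bar> \<le> C * inverse (sqrt (analyticity_param h)) ^ n)"
proof -
  define \<rho> where "\<rho> = sqrt (analyticity_param h)"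
  define Y where "Y = h * pi / 4"
  let ?U = "{z :: complex. \<bar>Im z\<bar> < Y}"
  have \<rho>: "\<rho> > 1" and Y: "rect_b \<rho> < Y" unfolding \<rho>_def Y_def using analyticity_param[OF h] by auto
  \<comment> \<open>The largest imaginary part of the rescaled arguments when both variables run
    through the rectangle.\<close>
  define \<beta> where "\<beta> = rect_b \<rho> / h"
  have \<beta>: "0 \<le> \<beta>" "\<beta> < pi / 4"
    unfolding \<beta>_def using bernstein_gap_pos[OF \<rho>] h Y by (auto simp: Y_def field_simps)
  obtain C where C: "C \<ge> 0" and approx: "\<And>n (H :: complex \<Rightarrow> complex \<Rightarrow> complex) M. n \<ge> 1 \<Longrightarrow>
    continuous_on (?U \<times> ?U) (\<lambda>(z, w). H z w) \<Longrightarrow>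
    (\<forall>w. \<bar>Im w\<bar> < Y \<longrightarrow> (\<lambda>z. H z w) holomorphic_on ?U) \<Longrightarrow>
    (\<forall>z. \<bar>Im z\<bar> < Y \<longrightarrow> H z holomorphic_on ?U) \<Longrightarrow>
    (\<forall>z w. \<bar>Im z\<bar> \<le> rect_b \<rho> \<longrightarrow> \<bar>Im w\<bar> \<le> rect_b \<rho> \<longrightarrow> norm (H z w) \<le> M) \<Longrightarrow>
    (\<exists>d. \<forall>s\<in>{0..1}. \<forall>t\<in>{0..1}. norm (H (of_real s) (of_real t)
       - (\<Sum>i<n. \<Sum>j<n. d i j * of_real s ^ i * of_real t ^ j)) \<le> C * M * inverse \<rho> ^ n)"
    using bivariate_polynomial_approximation[OF \<rho> Y] by blast
  have cc: "cone_const \<beta> \<ge> 0" unfolding cone_const_def using tan_sq_less_1[OF \<beta>] by simp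
  show ?thesis
  proof (intro exI[of _ "C * cone_const \<beta>"] conjI allI impI)
    show "0 \<le> C * cone_const \<beta>" using C cc by simp
    fix n :: nat and \<mu> :: "'a measure" and g m v \<omega> :: "'a \<Rightarrow> real" and W :: real
    assume n: "n \<ge> 1" and "prob_space \<mu>" and [measurable]: "g \<in> borel_measurable \<mu>"
      and g: "\<forall>x\<in>space \<mu>. g x \<in> {0..1}"
      and [measurable]: "m \<in> borel_measurable \<mu>" "v \<in> borel_measurable \<mu>" "\<omega> \<in> borel_measurable \<mu>"
      and \<omega>: "\<forall>x\<in>space \<mu>. 0 < \<omega> x \<and> \<omega> x \<le> W"
    interpret prob_space \<mu> by fact
    have fin: "finite_measure \<mu>" by unfold_locales
    define S1 where "S1 z x = csech ((z - of_real (m x)) / of_real h)" for z x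
    define S2 where "S2 w x = csech ((w - of_real (v x)) / of_real h)" for w x
    define F where "F q z w x = S1 z x * S2 w x * of_real (q x * \<omega> x)" for q :: "'a \<Rightarrow> real" and z w x
    have op: "open ?U" by (rule open_strip)
    have holS: "(\<lambda>z. S1 z x) holomorphic_on ?U" "(\<lambda>z. S2 z x) holomorphic_on ?U" for x
      unfolding S1_def S2_def Y_def using h by (intro csech_scaled_holomorphic; simp)+
    have im: "\<bar>Im ((z - of_real a) / of_real h)\<bar> = \<bar>Im z\<bar> / h" for z a using h by simp
    have bS: "norm (S1 z x) \<le> 2" "norm (S2 z x) \<le> 2" if "z \<in> ?U" for z x
    proof -
      have "\<bar>Im z\<bar> / h < pi / 4" using that h unfolding Y_def by (simp add: field_simps)
      then show "norm (S1 z x) \<le> 2" "norm (S2 z x) \<le> 2"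
        unfolding S1_def S2_def by (intro norm_csech_le; simp only: im)+
    qed
    have q\<omega>: "\<bar>q x * \<omega> x\<bar> \<le> W" if "x \<in> space \<mu>" "\<forall>x\<in>space \<mu>. q x \<in> {0..1}" for q :: "'a \<Rightarrow> real" and x
    proof -
      have "q x * \<omega> x \<le> 1 * W" using that \<omega> by (intro mult_mono) auto
      moreover have "q x * \<omega> x \<ge> 0" using that \<omega> by (intro mult_nonneg_nonneg) (auto intro: less_imp_le)
      ultimately show ?thesis by simp
    qed
    have Fb: "norm (F q z w x) \<le> 2 * 2 * W"
      if "z \<in> ?U" "w \<in> ?U" "x \<in> space \<mu>" "\<forall>x\<in>space \<mu>. q x \<in> {0..1}" for q z w x
      unfolding F_def norm_mult norm_of_real
      using bS(1)[OF that(1)] bS(2)[OF that(2)] q\<omega>[OF that(3,4)] by (intro mult_mono) auto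
    have Fm: "F q z w \<in> borel_measurable \<mu>" if [measurable]: "q \<in> borel_measurable \<mu>" for q z w
      unfolding F_def[abs_def] S1_def S2_def by measurable
    define I where "I q z w = (\<integral>x. F q z w x \<partial>\<mu>)" for q z w
    have Fint: "integrable \<mu> (F q z w)"
      if "z \<in> ?U" "w \<in> ?U" "q \<in> borel_measurable \<mu>" "\<forall>x\<in>space \<mu>. q x \<in> {0..1}" for q z w
      using Fb[OF that(1,2) _ that(4)] Fm[OF that(3)] by (intro integrable_const_bound[where B = "2 * 2 * W"] AE_I2) auto
    have Ihol1: "(\<lambda>z. I q z w) holomorphic_on ?U"
      if "w \<in> ?U" "q \<in> borel_measurable \<mu>" "\<forall>x\<in>space \<mu>. q x \<in> {0..1}" for q w
      unfolding I_def
    proof (rule holomorphic_on_parametric_integral[OF fin op])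
      show "(\<lambda>z. F q z w x) holomorphic_on ?U" for x unfolding F_def by (intro holomorphic_intros holS)
    qed (use Fm Fb that in auto)
    have Ihol2: "I q z holomorphic_on ?U"
      if "z \<in> ?U" "q \<in> borel_measurable \<mu>" "\<forall>x\<in>space \<mu>. q x \<in> {0..1}" for q z
      unfolding I_def
    proof (rule holomorphic_on_parametric_integral[OF fin op])
      show "(\<lambda>w. F q z w x) holomorphic_on ?U" for x unfolding F_def by (intro holomorphic_intros holS)
    qed (use Fm Fb that in auto)
    have contS: "continuous_on (?U \<times> ?U) (\<lambda>p. S1 (fst p) x)" "continuous_on (?U \<times> ?U) (\<lambda>p. S2 (snd p) x)" for x
      by (rule continuous_on_compose2[OF holomorphic_on_imp_continuous_on[OF holS(1)]], auto intro!: continuous_intros)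
        (rule continuous_on_compose2[OF holomorphic_on_imp_continuous_on[OF holS(2)]], auto intro!: continuous_intros)
    have Icont: "continuous_on (?U \<times> ?U) (\<lambda>(z, w). I q z w)"
      if "q \<in> borel_measurable \<mu>" "\<forall>x\<in>space \<mu>. q x \<in> {0..1}" for q
      unfolding I_def case_prod_beta
    proof (rule continuous_on_parametric_integral[OF fin])
      show "continuous_on (?U \<times> ?U) (\<lambda>p. F q (fst p) (snd p) x)" for x
        unfolding F_def by (intro continuous_intros contS)
    qed (use Fm Fb that in auto)
    have one: "(\<lambda>_. 1) \<in> borel_measurable \<mu>" "\<forall>x\<in>space \<mu>. (1::real) \<in> {0..1}" by auto
    have cone: "0 < Re (F (\<lambda>_. 1) z w x)" "norm (F (\<lambda>_. 1) z w x) \<le> cone_const b * Re (F (\<lambda>_. 1) z w x)"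
      if "\<bar>Im z\<bar> / h \<le> b" "\<bar>Im w\<bar> / h \<le> b" "b < pi / 4" "x \<in> space \<mu>" for z w b x
    proof -
      have p: "0 < Re (S1 z x * S2 w x)" "norm (S1 z x * S2 w x) \<le> cone_const b * Re (S1 z x * S2 w x)"
        using csech_product_cone[of "(z - of_real (m x)) / of_real h" b "(w - of_real (v x)) / of_real h", unfolded im, OF that(1,2,3)]
        unfolding S1_def S2_def .
      have w: "0 < \<omega> x" using \<omega> that by auto
      have F1: "F (\<lambda>_. 1) z w x = S1 z x * S2 w x * of_real (\<omega> x)" unfolding F_def by simp
      have ReF: "Re (F (\<lambda>_. 1) z w x) = Re (S1 z x * S2 w x) * \<omega> x" unfolding F1 by simp
      show "0 < Re (F (\<lambda>_. 1) z w x)" unfolding ReF using p w by (intro mult_pos_pos)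
      have "norm (F (\<lambda>_. 1) z w x) = norm (S1 z x * S2 w x) * \<omega> x" unfolding F1 using w by (simp add: norm_mult)
      also have "\<dots> \<le> (cone_const b * Re (S1 z x * S2 w x)) * \<omega> x" using p w by (intro mult_right_mono) auto
      finally show "norm (F (\<lambda>_. 1) z w x) \<le> cone_const b * Re (F (\<lambda>_. 1) z w x)" unfolding ReF by simp
    qed
    have RePos: "0 < Re (I (\<lambda>_. 1) z w)" if z: "z \<in> ?U" and w: "w \<in> ?U" for z w
    proof -
      \<comment> \<open>An angle that depends on the two points. On the open strip the denominator
        is only shown to be nonzero; the uniform bound \<open>Hb\<close> concerns the smaller closed
        strip with angle \<open>\<beta>\<close>.\<close>
      define b where "b = max (\<bar>Im z\<bar> / h) (\<bar>Im w\<bar> / h)"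
      have b: "\<bar>Im z\<bar> / h \<le> b" "\<bar>Im w\<bar> / h \<le> b" "b < pi / 4"
      proof -
        have "\<bar>Im z\<bar> / h < pi / 4" "\<bar>Im w\<bar> / h < pi / 4" using z w h by (auto simp: Y_def field_simps)
        then show "b < pi / 4" unfolding b_def by simp
      qed (simp_all add: b_def)
      have R: "Re (I (\<lambda>_. 1) z w) = (\<integral>x. Re (F (\<lambda>_. 1) z w x) \<partial>\<mu>)"
        unfolding I_def by (rule integral_Re[symmetric, OF Fint[OF z w one]])
      have ir: "integrable \<mu> (\<lambda>x. Re (F (\<lambda>_. 1) z w x))" using Fint[OF z w one] by (rule integrable_Re)
      have nn: "0 \<le> (\<integral>x. Re (F (\<lambda>_. 1) z w x) \<partial>\<mu>)"
        using cone(1)[OF b] by (intro integral_nonneg_AE AE_I2) (auto intro: less_imp_le)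
      have "(\<integral>x. Re (F (\<lambda>_. 1) z w x) \<partial>\<mu>) \<noteq> 0"
      proof
        assume "(\<integral>x. Re (F (\<lambda>_. 1) z w x) \<partial>\<mu>) = 0"
        then have "AE x in \<mu>. Re (F (\<lambda>_. 1) z w x) = 0"
          using integral_nonneg_eq_0_iff_AE[OF ir] cone(1)[OF b] by (auto intro: less_imp_le AE_I2)
        moreover have "AE x in \<mu>. Re (F (\<lambda>_. 1) z w x) > 0" using cone(1)[OF b] by auto
        ultimately have "AE x in \<mu>. False" by eventually_elim auto
        then show False by simp
      qed
      then show ?thesis using nn unfolding R by simp
    qed
    have Inz: "I (\<lambda>_. 1) z w \<noteq> 0" if "z \<in> ?U" "w \<in> ?U" for z w using RePos[OF that] by auto
    define H where "H z w = I g z w / I (\<lambda>_. 1) z w" for z w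
    have gm: "g \<in> borel_measurable \<mu>" by measurable
    \<comment> \<open>Integrals respect the cone: the numerator is at most the integral of the
      norms, hence at most \<open>cone_const \<beta>\<close> times the real part of the denominator.
      This bound is the same for all \<open>\<mu>\<close>, \<open>g\<close> and
      \<open>\<omega>\<close>.\<close>
    have Hb: "norm (H z w) \<le> cone_const \<beta>" if "\<bar>Im z\<bar> \<le> rect_b \<rho>" "\<bar>Im w\<bar> \<le> rect_b \<rho>" for z w
    proof -
      have zU: "z \<in> ?U" "w \<in> ?U" using that Y by auto
      have b: "\<bar>Im z\<bar> / h \<le> \<beta>" "\<bar>Im w\<bar> / h \<le> \<beta>" unfolding \<beta>_def using that h by (auto intro: divide_right_mono)
      have "norm (I g z w) \<le> (\<integral>x. norm (F g z w x) \<partial>\<mu>)" unfolding I_def by (rule integral_norm_bound)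
      also have "\<dots> \<le> (\<integral>x. cone_const \<beta> * Re (F (\<lambda>_. 1) z w x) \<partial>\<mu>)"
      proof (rule integral_mono)
        show "integrable \<mu> (\<lambda>x. norm (F g z w x))" using Fint[OF zU gm g] by simp
        show "integrable \<mu> (\<lambda>x. cone_const \<beta> * Re (F (\<lambda>_. 1) z w x))" using Fint[OF zU one] by simp
        fix x assume x: "x \<in> space \<mu>"
        have "norm (F g z w x) = norm (F (\<lambda>_. 1) z w x) * \<bar>g x\<bar>" unfolding F_def by (simp add: norm_mult abs_mult)
        also have "\<dots> \<le> norm (F (\<lambda>_. 1) z w x) * 1" using g x by (intro mult_left_mono) auto
        finally show "norm (F g z w x) \<le> cone_const \<beta> * Re (F (\<lambda>_. 1) z w x)" using cone(2)[OF b \<beta>(2) x] by simp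
      qed
      also have "\<dots> = cone_const \<beta> * Re (I (\<lambda>_. 1) z w)"
        unfolding I_def using integral_Re[OF Fint[OF zU one]] by simp
      also have "\<dots> \<le> cone_const \<beta> * norm (I (\<lambda>_. 1) z w)" using cc by (intro mult_left_mono complex_Re_le_cmod)
      finally show ?thesis unfolding H_def norm_divide using Inz[OF zU] by (simp add: divide_le_eq)
    qed
    have "\<exists>d. \<forall>s\<in>{0..1}. \<forall>t\<in>{0..1}. norm (H (of_real s) (of_real t)
       - (\<Sum>i<n. \<Sum>j<n. d i j * of_real s ^ i * of_real t ^ j)) \<le> C * cone_const \<beta> * inverse \<rho> ^ n"
    proof (rule approx[OF n])
      have "continuous_on (?U \<times> ?U) (\<lambda>p. (case p of (z, w) \<Rightarrow> I g z w) / (case p of (z, w) \<Rightarrow> I (\<lambda>_. 1) z w))"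
        by (intro continuous_on_divide Icont gm g one) (use Inz in auto)
      then show "continuous_on (?U \<times> ?U) (\<lambda>(z, w). H z w)" unfolding H_def by (simp add: case_prod_beta)
      show "\<forall>w. \<bar>Im w\<bar> < Y \<longrightarrow> (\<lambda>z. H z w) holomorphic_on ?U"
        unfolding H_def by (intro allI impI holomorphic_on_divide Ihol1 gm g one) (use Inz in auto)
      show "\<forall>z. \<bar>Im z\<bar> < Y \<longrightarrow> H z holomorphic_on ?U"
        unfolding H_def[abs_def] by (intro allI impI holomorphic_on_divide Ihol2 gm g one) (use Inz in auto)
    qed (use Hb in blast)
    then obtain d where d: "\<And>s t. s \<in> {0..1} \<Longrightarrow> t \<in> {0..1} \<Longrightarrow> norm (H (of_real s) (of_real t)
       - (\<Sum>i<n. \<Sum>j<n. d i j * of_real s ^ i * of_real t ^ j)) \<le> C * cone_const \<beta> * inverse \<rho> ^ n"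
      by blast
    define N where "N q s t = (\<integral>x. q x * (sech ((s - m x) / h) * sech ((t - v x) / h) * \<omega> x) \<partial>\<mu>)" for q :: "'a \<Rightarrow> real" and s t
    have Ireal: "I q (of_real s) (of_real t) = of_real (N q s t)" for q s t
    proof -
      have a: "csech ((of_real a - of_real b) / of_real h) = of_real (sech ((a - b) / h))" for a b
        using csech_of_real[of "(a - b) / h"] by simp
      have "F q (of_real s) (of_real t) = (\<lambda>x. of_real (q x * (sech ((s - m x) / h) * sech ((t - v x) / h) * \<omega> x)))"
        unfolding F_def S1_def S2_def a by (simp add: mult_ac fun_eq_iff)
      then show ?thesis unfolding I_def N_def by (simp only: integral_complex_of_real)
    qed
    show "\<exists>d. \<forall>s\<in>{0..1}. \<forall>t\<in>{0..1}.
      \<bar>(\<integral>x. g x * (sech ((s - m x) / h) * sech ((t - v x) / h) * \<omega> x) \<partial>\<mu>)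
        / (\<integral>x. sech ((s - m x) / h) * sech ((t - v x) / h) * \<omega> x \<partial>\<mu>)
       - (\<Sum>i<n. \<Sum>j<n. d i j * s ^ i * t ^ j)\<bar> \<le> C * cone_const \<beta> * inverse (sqrt (analyticity_param h)) ^ n"
    \<comment> \<open>At real points \<open>H\<close> is real, so taking real parts of the
      coefficients does not increase the error.\<close>
    proof (intro exI[of _ "\<lambda>i j. Re (d i j)"] ballI)
      fix s t :: real assume s: "s \<in> {0..1}" and t: "t \<in> {0..1}"
      have "N g s t / N (\<lambda>_. 1) s t - (\<Sum>i<n. \<Sum>j<n. Re (d i j) * s ^ i * t ^ j)
        = Re (H (of_real s) (of_real t) - (\<Sum>i<n. \<Sum>j<n. d i j * of_real s ^ i * of_real t ^ j))"
        unfolding H_def Ireal by (simp flip: of_real_power of_real_divide)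
      also have "\<bar>\<dots>\<bar> \<le> C * cone_const \<beta> * inverse \<rho> ^ n"
        using abs_Re_le_cmod d[OF s t] by (rule order_trans)
      finally show "\<bar>(\<integral>x. g x * (sech ((s - m x) / h) * sech ((t - v x) / h) * \<omega> x) \<partial>\<mu>)
        / (\<integral>x. sech ((s - m x) / h) * sech ((t - v x) / h) * \<omega> x \<partial>\<mu>)
       - (\<Sum>i<n. \<Sum>j<n. Re (d i j) * s ^ i * t ^ j)\<bar> \<le> C * cone_const \<beta> * inverse (sqrt (analyticity_param h)) ^ n"
        unfolding N_def \<rho>_def by simp
    qed
  qed
qed

subsection \<open>The laws of the data\<close>

lemma cosh_measurable [measurable]: "(cosh :: real \<Rightarrow> real) \<in> borel_measurable borel"
  by (intro borel_measurable_continuous_onI continuous_intros)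

lemma sech_measurable [measurable]: "sech \<in> borel_measurable borel"
  unfolding sech_def[abs_def] by measurable

lemma continuous_on_sech [continuous_intros]:
  "continuous_on A g \<Longrightarrow> continuous_on A (\<lambda>x. sech (g x))"
  unfolding sech_def by (intro continuous_intros) auto

lemma sech_pos: "sech x > 0"
  by (simp add: sech_def)

lemma sech_le_1: "sech x \<le> 1"
  using cosh_real_ge_1[of x] by (simp add: sech_def divide_le_eq)

lemma sech_antimono:
  assumes "\<bar>x\<bar> \<le> y"
  shows "sech y \<le> sech x"
proof -
  have "cosh \<bar>x\<bar> \<le> cosh y" using assms by (subst cosh_real_nonneg_le_iff) auto
  then have "cosh x \<le> cosh y" by (cases "x \<ge> 0") auto
  then show ?thesis unfolding sech_def by (intro divide_left_mono) auto
qed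

definition kernel_mass :: "real \<Rightarrow> real \<Rightarrow> real \<Rightarrow> real \<Rightarrow> real" where
  "kernel_mass h a b s = (LBINT u:{a..b}. sech ((u - s) / h))"

lemma kernel_mass_measurable [measurable]: "kernel_mass h a b \<in> borel_measurable borel"
  unfolding kernel_mass_def[abs_def] set_lebesgue_integral_def by measurable

lemma kernel_mass_integrable: "set_integrable lborel {a..b} (\<lambda>u. sech ((u - s) / h))"
  by (cases "h = 0") (auto intro!: borel_integrable_atLeastAtMost' continuous_intros)

lemma kernel_mass_ge:
  assumes h: "h > 0" and ab: "a \<le> b" and s: "\<And>u. u \<in> {a..b} \<Longrightarrow> \<bar>u - s\<bar> \<le> 1"
  shows "(b - a) * sech (1 / h) \<le> kernel_mass h a b s"
proof -
  have "(LBINT u:{a..b}. sech (1 / h)) \<le> (LBINT u:{a..b}. sech ((u - s) / h))"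
  proof (rule set_integral_mono)
    show "sech (1 / h) \<le> sech ((u - s) / h)" if "u \<in> {a..b}" for u
      using s[OF that] h by (intro sech_antimono) (simp add: divide_right_mono)
  qed (auto intro: kernel_mass_integrable borel_integrable_atLeastAtMost')
  then show ?thesis using ab unfolding kernel_mass_def by (simp add: set_integral_const)
qed

lemma nn_integral_sech_kernel:
  assumes pos: "kernel_mass h a b s > 0"
  shows "(\<integral>\<^sup>+t. ennreal (sech_kernel h a b s t) \<partial>lborel) = 1"
proof -
  have "(\<integral>\<^sup>+t. ennreal (sech_kernel h a b s t) \<partial>lborel)
    = (\<integral>\<^sup>+t. ennreal (indicator {a..b} t *\<^sub>R sech ((t - s) / h) / kernel_mass h a b s) \<partial>lborel)"
    unfolding sech_kernel_def kernel_mass_def by (intro nn_integral_cong) (simp add: mult.commute)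
  also have "\<dots> = ennreal (\<integral>t. indicator {a..b} t *\<^sub>R sech ((t - s) / h) / kernel_mass h a b s \<partial>lborel)"
    using kernel_mass_integrable[of a b s h] pos less_imp_le[OF sech_pos]
    by (intro nn_integral_eq_integral) (auto simp: set_integrable_def indicator_def)
  also have "(\<integral>t. indicator {a..b} t *\<^sub>R sech ((t - s) / h) / kernel_mass h a b s \<partial>lborel) = 1"
    using pos by (simp add: kernel_mass_def set_lebesgue_integral_def)
  finally show ?thesis by simp
qed

text \<open>Serves to replace the Bernoulli weights, before anything is known about their
  measurability, by \<open>label_prob\<close>; the two agree only where \<open>f\<close> lies in
  [0, 1].\<close>

lemma density_eq_on_space:
  assumes "\<And>x. x \<in> space M \<Longrightarrow> f x = g x"
  shows "density M f = density M g"
proof -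
  have "(\<lambda>A. \<integral>\<^sup>+x. f x * indicator A x \<partial>M) = (\<lambda>A. \<integral>\<^sup>+x. g x * indicator A x \<partial>M)"
    using assms by (auto intro!: ext nn_integral_cong)
  then show ?thesis unfolding density_def by simp
qed

section \<open>The perturbed score and its regression functions\<close>

locale snapshot_model = prob_space \<mu> for \<mu> :: "'a measure" +
  fixes h :: real and f m v :: "'a \<Rightarrow> real"
  assumes h: "h > 0"
    and f_measurable [measurable]: "f \<in> borel_measurable \<mu>"
    and f01: "x \<in> space \<mu> \<Longrightarrow> f x \<in> {0..1}"
    and predictor: "ho_predictor \<mu> m v"
begin

lemma m_measurable [measurable]: "m \<in> borel_measurable \<mu>"
  and v_measurable [measurable]: "v \<in> borel_measurable \<mu>"
  using predictor by (auto simp: ho_predictor_def)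

lemma m01: "x \<in> space \<mu> \<Longrightarrow> m x \<in> {0..1}"
  using predictor by (auto simp: ho_predictor_def)

lemma v_quarter:
  assumes "x \<in> space \<mu>"
  shows "v x \<in> {0..1/4}"
proof -
  have "v x \<in> {0..m x * (1 - m x)}" using predictor assms by (auto simp: ho_predictor_def)
  moreover have "m x * (1 - m x) \<le> 1 / 4"
    using zero_le_power2[of "m x - 1/2"] by (simp add: power2_eq_square algebra_simps)
  ultimately show ?thesis by auto
qed

definition scale :: "'a \<Rightarrow> real" where
  "scale x = 1 / (kernel_mass h 0 1 (m x) * kernel_mass h 0 (1/4) (v x))"

text \<open>The density of the perturbed score without the indicator of its domain. It is positive
  for every \<open>s\<close>, so quotients of its averages are defined everywhere and have the form
  treated by \<open>regression_function_approximation\<close>.\<close>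

definition smooth_kernel :: "'a \<Rightarrow> real \<times> real \<Rightarrow> real" where
  "smooth_kernel x s = sech ((fst s - m x) / h) * sech ((snd s - v x) / h) * scale x"

definition score_domain :: "(real \<times> real) set" where
  "score_domain = {0..1} \<times> {0..1/4}"

definition scale_bound :: real where
  "scale_bound = 1 / (sech (1 / h) * (sech (1 / h) / 4))"

lemma kernel_mass_bounds:
  assumes x: "x \<in> space \<mu>"
  shows "sech (1 / h) \<le> kernel_mass h 0 1 (m x)" "sech (1 / h) / 4 \<le> kernel_mass h 0 (1/4) (v x)"
proof -
  have "(1 - 0) * sech (1 / h) \<le> kernel_mass h 0 1 (m x)"
    using m01[OF x] by (intro kernel_mass_ge h) (auto simp: abs_le_iff)
  then show "sech (1 / h) \<le> kernel_mass h 0 1 (m x)" by simp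
  have "(1/4 - 0) * sech (1 / h) \<le> kernel_mass h 0 (1/4) (v x)"
    using v_quarter[OF x] by (intro kernel_mass_ge h) (auto simp: abs_le_iff)
  then show "sech (1 / h) / 4 \<le> kernel_mass h 0 (1/4) (v x)" by simp
qed

lemma kernel_mass_pos:
  assumes x: "x \<in> space \<mu>"
  shows "0 < kernel_mass h 0 1 (m x)" "0 < kernel_mass h 0 (1/4) (v x)"
  using kernel_mass_bounds[OF x] sech_pos[of "1 / h"] by linarith+

lemma scale_bounds:
  assumes x: "x \<in> space \<mu>"
  shows "0 < scale x" "scale x \<le> scale_bound"
proof -
  show "0 < scale x" unfolding scale_def using kernel_mass_pos[OF x] by simp
  have "sech (1 / h) * (sech (1 / h) / 4) \<le> kernel_mass h 0 1 (m x) * kernel_mass h 0 (1/4) (v x)"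
    using kernel_mass_bounds[OF x] sech_pos[of "1/h"] kernel_mass_pos[OF x] by (intro mult_mono) auto
  then show "scale x \<le> scale_bound" unfolding scale_def scale_bound_def
    using sech_pos[of "1/h"] kernel_mass_pos[OF x] by (intro divide_left_mono) auto
qed

lemma scale_measurable [measurable]: "scale \<in> borel_measurable \<mu>"
  unfolding scale_def[abs_def] by measurable

lemma score_kernel_eq: "score_kernel h (m x, v x) s = smooth_kernel x s * indicator score_domain s"
  unfolding score_kernel_def sech_kernel_def smooth_kernel_def score_domain_def scale_def kernel_mass_def
  by (auto simp: indicator_def mem_Times_iff)

lemma smooth_kernel_measurable [measurable]:
  "(\<lambda>(x, s). smooth_kernel x s) \<in> borel_measurable (\<mu> \<Otimes>\<^sub>M borel)"
  unfolding smooth_kernel_def[abs_def] borel_prod[symmetric] by measurable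

lemma score_domain_sets [measurable]: "score_domain \<in> sets borel"
  unfolding score_domain_def borel_prod[symmetric] by measurable

lemma smooth_kernel_bounds:
  assumes x: "x \<in> space \<mu>"
  shows "0 < smooth_kernel x s" "smooth_kernel x s \<le> scale_bound"
proof -
  show "0 < smooth_kernel x s" unfolding smooth_kernel_def using scale_bounds[OF x] sech_pos by simp
  have "sech ((fst s - m x) / h) * sech ((snd s - v x) / h) * scale x \<le> 1 * 1 * scale_bound"
    using scale_bounds[OF x] sech_pos sech_le_1 by (intro mult_mono) (auto intro: less_imp_le)
  then show "smooth_kernel x s \<le> scale_bound" unfolding smooth_kernel_def by simp
qed

lemma smooth_kernel_nonneg: "x \<in> space \<mu> \<Longrightarrow> 0 \<le> smooth_kernel x s"
  using smooth_kernel_bounds(1)[of x s] by simp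

lemma nn_integral_score_kernel:
  assumes x: "x \<in> space \<mu>"
  shows "(\<integral>\<^sup>+s. ennreal (smooth_kernel x s * indicator score_domain s) \<partial>lborel) = 1"
proof -
  have sk [measurable]: "sech_kernel h a b p \<in> borel_measurable borel" for a b p
    unfolding sech_kernel_def[abs_def] by measurable
  have nn: "0 \<le> sech_kernel h 0 1 (m x) t" "0 \<le> sech_kernel h 0 (1/4) (v x) t" for t
    using kernel_mass_pos[OF x] sech_pos less_imp_le
    unfolding sech_kernel_def kernel_mass_def by (auto intro!: divide_nonneg_nonneg mult_nonneg_nonneg simp: less_imp_le)
  have "(\<integral>\<^sup>+s. ennreal (smooth_kernel x s * indicator score_domain s) \<partial>lborel)
    = (\<integral>\<^sup>+s. ennreal (sech_kernel h 0 1 (m x) (fst s) * sech_kernel h 0 (1/4) (v x) (snd s)) \<partial>(lborel \<Otimes>\<^sub>M lborel))"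
    unfolding score_kernel_eq[symmetric] score_kernel_def lborel_prod by simp
  also have "\<dots> = (\<integral>\<^sup>+a. \<integral>\<^sup>+b. ennreal (sech_kernel h 0 1 (m x) a * sech_kernel h 0 (1/4) (v x) b) \<partial>lborel \<partial>lborel)"
    by (subst lborel.nn_integral_fst[symmetric]) auto
  also have "\<dots> = (\<integral>\<^sup>+a. ennreal (sech_kernel h 0 1 (m x) a) \<partial>lborel)"
    using nn by (simp add: ennreal_mult nn_integral_cmult nn_integral_sech_kernel[OF kernel_mass_pos(2)[OF x]])
  also have "\<dots> = 1" by (rule nn_integral_sech_kernel[OF kernel_mass_pos(1)[OF x]])
  finally show ?thesis .
qed

definition numerator :: "('a \<Rightarrow> real) \<Rightarrow> real \<times> real \<Rightarrow> real" where
  "numerator g s = (\<integral>x. g x * smooth_kernel x s \<partial>\<mu>)"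

text \<open>Bayes' formula for the conditional mean of \<open>g\<close> given the perturbed
  score.\<close>

definition reg :: "('a \<Rightarrow> real) \<Rightarrow> real \<times> real \<Rightarrow> real" where
  "reg g s = numerator g s / numerator (\<lambda>_. 1) s"

lemma integrable_smooth_kernel:
  assumes [measurable]: "g \<in> borel_measurable \<mu>" and g: "\<And>x. x \<in> space \<mu> \<Longrightarrow> g x \<in> {0..1}"
  shows "integrable \<mu> (\<lambda>x. g x * smooth_kernel x s)"
proof (rule integrable_const_bound[where B = scale_bound])
  show "AE x in \<mu>. norm (g x * smooth_kernel x s) \<le> scale_bound"
  proof (rule AE_I2)
    fix x assume x: "x \<in> space \<mu>"
    have "g x * smooth_kernel x s \<le> 1 * scale_bound"
      using smooth_kernel_bounds[OF x, of s] g[OF x] by (intro mult_mono) auto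
    then show "norm (g x * smooth_kernel x s) \<le> scale_bound"
      using smooth_kernel_bounds[OF x, of s] g[OF x] by (simp add: abs_mult)
  qed
qed measurable

lemma numerator_pos: "0 < numerator (\<lambda>_. 1) s"
proof -
  have i: "integrable \<mu> (\<lambda>x. smooth_kernel x s)" using integrable_smooth_kernel[of "\<lambda>_. 1" s] by simp
  have "0 \<le> (\<integral>x. smooth_kernel x s \<partial>\<mu>)"
    by (intro integral_nonneg_AE AE_I2 smooth_kernel_nonneg)
  moreover have "(\<integral>x. smooth_kernel x s \<partial>\<mu>) \<noteq> 0"
  proof
    assume "(\<integral>x. smooth_kernel x s \<partial>\<mu>) = 0"
    then have "AE x in \<mu>. smooth_kernel x s = 0"
      using integral_nonneg_eq_0_iff_AE[OF i AE_I2[OF smooth_kernel_nonneg]] by simp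
    moreover have "AE x in \<mu>. smooth_kernel x s > 0" using smooth_kernel_bounds(1) by auto
    ultimately have "AE x in \<mu>. False" by eventually_elim auto
    then show False by simp
  qed
  ultimately show ?thesis unfolding numerator_def by simp
qed

lemma reg_bounds:
  assumes [measurable]: "g \<in> borel_measurable \<mu>" and g: "\<And>x. x \<in> space \<mu> \<Longrightarrow> g x \<in> {0..1}"
  shows "0 \<le> numerator g s" "0 \<le> reg g s" "reg g s \<le> 1"
proof -
  show n: "0 \<le> numerator g s" unfolding numerator_def
    using smooth_kernel_nonneg g by (intro integral_nonneg_AE AE_I2 mult_nonneg_nonneg) auto
  show "0 \<le> reg g s" unfolding reg_def using n numerator_pos[of s] by simp
  have "numerator g s \<le> numerator (\<lambda>_. 1) s"
    unfolding numerator_def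
  proof (rule integral_mono)
    show "g x * smooth_kernel x s \<le> 1 * smooth_kernel x s" if "x \<in> space \<mu>" for x
      using g[OF that] smooth_kernel_bounds(1)[OF that, of s] by (intro mult_right_mono) auto
  qed (intro integrable_smooth_kernel assms; simp)+
  then show "reg g s \<le> 1" unfolding reg_def using numerator_pos[of s] by (simp add: divide_le_eq)
qed

lemma numerator_measurable [measurable]:
  assumes [measurable]: "g \<in> borel_measurable \<mu>"
  shows "numerator g \<in> borel_measurable borel"
  unfolding numerator_def[abs_def] by measurable

lemma reg_measurable [measurable]:
  assumes [measurable]: "g \<in> borel_measurable \<mu>"
  shows "reg g \<in> borel_measurable borel"
  unfolding reg_def[abs_def] by measurable

text \<open>The expectation of \<open>g\<close> at the input times \<open>u\<close> at the perturbed
  score. All expectations over labels and score reduce to this form.\<close>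

definition weighted_score_integral :: "('a \<Rightarrow> real) \<Rightarrow> (real \<times> real \<Rightarrow> ennreal) \<Rightarrow> ennreal" where
  "weighted_score_integral g u =
    (\<integral>\<^sup>+x. ennreal (g x) * (\<integral>\<^sup>+s. ennreal (smooth_kernel x s * indicator score_domain s) * u s \<partial>lborel) \<partial>\<mu>)"

lemma weighted_score_integral_swap:
  assumes [measurable]: "g \<in> borel_measurable \<mu>" "u \<in> borel_measurable borel"
    and g: "\<And>x. x \<in> space \<mu> \<Longrightarrow> g x \<in> {0..1}"
  shows "weighted_score_integral g u = (\<integral>\<^sup>+s. ennreal (numerator g s) * (indicator score_domain s * u s) \<partial>lborel)"
proof -
  interpret pair_sigma_finite \<mu> "lborel :: (real \<times> real) measure"
    by (intro pair_sigma_finite.intro sigma_finite_measure_axioms lborel.sigma_finite_measure_axioms)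
  have "weighted_score_integral g u =
    (\<integral>\<^sup>+x. \<integral>\<^sup>+s. ennreal (g x * smooth_kernel x s) * (indicator score_domain s * u s) \<partial>lborel \<partial>\<mu>)"
    unfolding weighted_score_integral_def
  proof (intro nn_integral_cong)
    fix x assume x: "x \<in> space \<mu>"
    have "ennreal (g x) * (\<integral>\<^sup>+s. ennreal (smooth_kernel x s * indicator score_domain s) * u s \<partial>lborel)
      = (\<integral>\<^sup>+s. ennreal (g x) * (ennreal (smooth_kernel x s * indicator score_domain s) * u s) \<partial>lborel)"
      using x by (intro nn_integral_cmult[symmetric]) measurable
    also have "\<dots> = (\<integral>\<^sup>+s. ennreal (g x * smooth_kernel x s) * (indicator score_domain s * u s) \<partial>lborel)"
      using g[OF x] smooth_kernel_bounds(1)[OF x]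
      by (intro nn_integral_cong) (auto simp: indicator_def ennreal_mult less_imp_le mult.assoc)
    finally show "ennreal (g x) * (\<integral>\<^sup>+s. ennreal (smooth_kernel x s * indicator score_domain s) * u s \<partial>lborel)
      = (\<integral>\<^sup>+s. ennreal (g x * smooth_kernel x s) * (indicator score_domain s * u s) \<partial>lborel)" .
  qed
  also have "\<dots> = (\<integral>\<^sup>+s. \<integral>\<^sup>+x. ennreal (g x * smooth_kernel x s) * (indicator score_domain s * u s) \<partial>\<mu> \<partial>lborel)"
    by (intro Fubini'[symmetric]) measurable
  also have "\<dots> = (\<integral>\<^sup>+s. ennreal (numerator g s) * (indicator score_domain s * u s) \<partial>lborel)"
  proof (intro nn_integral_cong)
    fix s
    have "(\<integral>\<^sup>+x. ennreal (g x * smooth_kernel x s) * (indicator score_domain s * u s) \<partial>\<mu>)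
      = (\<integral>\<^sup>+x. ennreal (g x * smooth_kernel x s) \<partial>\<mu>) * (indicator score_domain s * u s)"
      by (intro nn_integral_multc) measurable
    also have "(\<integral>\<^sup>+x. ennreal (g x * smooth_kernel x s) \<partial>\<mu>) = ennreal (numerator g s)"
      unfolding numerator_def using g smooth_kernel_nonneg
      by (intro nn_integral_eq_integral integrable_smooth_kernel assms AE_I2 mult_nonneg_nonneg) auto
    finally show "(\<integral>\<^sup>+x. ennreal (g x * smooth_kernel x s) * (indicator score_domain s * u s) \<partial>\<mu>)
      = ennreal (numerator g s) * (indicator score_domain s * u s)" .
  qed
  finally show ?thesis .
qed

text \<open>The defining property of a conditional mean: tested against functions of the score,
  \<open>g\<close> may be replaced by \<open>reg g\<close>.\<close>

lemma weighted_score_integral_reg: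
  assumes [measurable]: "g \<in> borel_measurable \<mu>" "u \<in> borel_measurable borel"
    and g: "\<And>x. x \<in> space \<mu> \<Longrightarrow> g x \<in> {0..1}"
  shows "weighted_score_integral g u = weighted_score_integral (\<lambda>_. 1) (\<lambda>s. ennreal (reg g s) * u s)"
proof -
  have n: "ennreal (numerator g s) = ennreal (numerator (\<lambda>_. 1) s) * ennreal (reg g s)" for s
    using numerator_pos[of s] reg_bounds[OF assms(1) g] by (subst ennreal_mult[symmetric]) (auto simp: reg_def less_imp_le)
  have "weighted_score_integral g u = (\<integral>\<^sup>+s. ennreal (numerator g s) * (indicator score_domain s * u s) \<partial>lborel)"
    by (rule weighted_score_integral_swap[OF assms])
  also have "\<dots> = (\<integral>\<^sup>+s. ennreal (numerator (\<lambda>_. 1) s) * (indicator score_domain s * (ennreal (reg g s) * u s)) \<partial>lborel)"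
    by (intro nn_integral_cong) (simp only: n mult_ac)
  also have "\<dots> = weighted_score_integral (\<lambda>_. 1) (\<lambda>s. ennreal (reg g s) * u s)"
    by (rule weighted_score_integral_swap[symmetric]) auto
  finally show ?thesis .
qed

section \<open>Integrating out the labels\<close>

definition label_prob :: "'a \<Rightarrow> bool \<Rightarrow> real" where
  "label_prob x y = (if y then f x else 1 - f x)"

lemma pmf_label: "x \<in> space \<mu> \<Longrightarrow> pmf (bernoulli_pmf (f x)) y = label_prob x y"
  using f01[of x] by (cases y) (auto simp: label_prob_def)

lemma label_prob_measurable [measurable]:
  "(\<lambda>(x, y). label_prob x y) \<in> borel_measurable (\<mu> \<Otimes>\<^sub>M count_space UNIV)"
  unfolding label_prob_def[abs_def] by measurable

lemma label_prob_nonneg: "x \<in> space \<mu> \<Longrightarrow> 0 \<le> label_prob x y"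
  using f01[of x] by (auto simp: label_prob_def)

abbreviation score_density :: "'a \<Rightarrow> real \<times> real \<Rightarrow> real" where
  "score_density x s \<equiv> smooth_kernel x s * indicator score_domain s"

lemma score_density_nonneg: "x \<in> space \<mu> \<Longrightarrow> 0 \<le> score_density x s"
  using smooth_kernel_nonneg[of x s] by (simp add: indicator_def)

abbreviation snapshot_base :: "'a snapshot measure" where
  "snapshot_base \<equiv> \<mu> \<Otimes>\<^sub>M count_space UNIV \<Otimes>\<^sub>M count_space UNIV \<Otimes>\<^sub>M lborel"

abbreviation test_base :: "('a \<times> bool \<times> real \<times> real) measure" where
  "test_base \<equiv> \<mu> \<Otimes>\<^sub>M count_space UNIV \<Otimes>\<^sub>M lborel"

abbreviation snap :: "'a snapshot measure" where
  "snap \<equiv> snapshot_law h \<mu> f m v"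

abbreviation test :: "('a \<times> bool \<times> real \<times> real) measure" where
  "test \<equiv> test_law h \<mu> f m v"

lemma snapshot_law_eq: "snap = density snapshot_base
    (\<lambda>(x, y1, y2, s). ennreal (label_prob x y1 * label_prob x y2 * score_density x s))"
  unfolding snapshot_law_def
proof (rule density_eq_on_space)
  fix z :: "'a snapshot" assume "z \<in> space snapshot_base"
  then show "(case z of (x, y1, y2, s) \<Rightarrow> ennreal (pmf (bernoulli_pmf (f x)) y1 * pmf (bernoulli_pmf (f x)) y2 * score_kernel h (m x, v x) s))
      = (case z of (x, y1, y2, s) \<Rightarrow> ennreal (label_prob x y1 * label_prob x y2 * score_density x s))"
    by (auto simp: space_pair_measure pmf_label score_kernel_eq)
qed

lemma test_law_eq: "test = density test_base
    (\<lambda>(x, y, s). ennreal (label_prob x y * score_density x s))"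
  unfolding test_law_def
proof (rule density_eq_on_space)
  fix z :: "'a \<times> bool \<times> real \<times> real" assume "z \<in> space test_base"
  then show "(case z of (x, y, s) \<Rightarrow> ennreal (pmf (bernoulli_pmf (f x)) y * score_kernel h (m x, v x) s))
      = (case z of (x, y, s) \<Rightarrow> ennreal (label_prob x y * score_density x s))"
    by (auto simp: space_pair_measure pmf_label score_kernel_eq)
qed

lemma sigma_finite_labels: "sigma_finite_measure (count_space (UNIV :: bool set))"
  by (rule sigma_finite_measure_count_space_finite) simp

lemma nn_integral_labels: "(\<integral>\<^sup>+y. F y \<partial>count_space (UNIV :: bool set)) = F True + F False"
  by (simp add: nn_integral_count_space_finite UNIV_bool add.commute)

lemma nn_integral_snapshot_law:
  fixes F :: "'a snapshot \<Rightarrow> ennreal"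
  assumes F[measurable]: "F \<in> borel_measurable snapshot_base"
  shows "(\<integral>\<^sup>+z. F z \<partial>snap) = (\<integral>\<^sup>+x. \<integral>\<^sup>+y1. \<integral>\<^sup>+y2. \<integral>\<^sup>+s.
      ennreal (label_prob x y1 * label_prob x y2 * score_density x s) * F (x, y1, y2, s)
      \<partial>lborel \<partial>count_space UNIV \<partial>count_space UNIV \<partial>\<mu>)"
proof -
  interpret S1: pair_sigma_finite "count_space (UNIV :: bool set)" "lborel :: (real \<times> real) measure"
    by (intro pair_sigma_finite.intro sigma_finite_labels lborel.sigma_finite_measure_axioms)
  interpret S2: pair_sigma_finite "count_space (UNIV :: bool set)" "count_space (UNIV :: bool set) \<Otimes>\<^sub>M (lborel :: (real \<times> real) measure)"
    by (intro pair_sigma_finite.intro sigma_finite_labels S1.sigma_finite_measure_axioms)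
  let ?G = "\<lambda>(x, y1, y2, s). ennreal (label_prob x y1 * label_prob x y2 * score_density x s) * F (x, y1, y2, s)"
  have d[measurable]: "(\<lambda>(x, y1, y2, s). ennreal (label_prob x y1 * label_prob x y2 * score_density x s)) \<in> borel_measurable snapshot_base"
    by measurable
  have G[measurable]: "?G \<in> borel_measurable snapshot_base" by measurable
  have "(\<integral>\<^sup>+z. F z \<partial>snap) = (\<integral>\<^sup>+z. ?G z \<partial>snapshot_base)"
    unfolding snapshot_law_eq by (subst nn_integral_density[OF d F]) (auto intro!: nn_integral_cong)
  also have "\<dots> = (\<integral>\<^sup>+x. \<integral>\<^sup>+r. ?G (x, r) \<partial>(count_space UNIV \<Otimes>\<^sub>M count_space UNIV \<Otimes>\<^sub>M lborel) \<partial>\<mu>)"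
    by (rule S2.nn_integral_fst[symmetric, OF G])
  also have "\<dots> = (\<integral>\<^sup>+x. \<integral>\<^sup>+y1. \<integral>\<^sup>+r. ?G (x, y1, r) \<partial>(count_space UNIV \<Otimes>\<^sub>M lborel) \<partial>count_space UNIV \<partial>\<mu>)"
    by (intro nn_integral_cong S1.nn_integral_fst[symmetric]) measurable
  also have "\<dots> = (\<integral>\<^sup>+x. \<integral>\<^sup>+y1. \<integral>\<^sup>+y2. \<integral>\<^sup>+s. ?G (x, y1, y2, s) \<partial>lborel \<partial>count_space UNIV \<partial>count_space UNIV \<partial>\<mu>)"
    by (intro nn_integral_cong lborel.nn_integral_fst[symmetric]) measurable
  finally show ?thesis by simp
qed

lemma nn_integral_test_law:
  fixes F :: "'a \<times> bool \<times> real \<times> real \<Rightarrow> ennreal"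
  assumes F[measurable]: "F \<in> borel_measurable test_base"
  shows "(\<integral>\<^sup>+z. F z \<partial>test) = (\<integral>\<^sup>+x. \<integral>\<^sup>+y. \<integral>\<^sup>+s.
      ennreal (label_prob x y * score_density x s) * F (x, y, s) \<partial>lborel \<partial>count_space UNIV \<partial>\<mu>)"
proof -
  interpret S1: pair_sigma_finite "count_space (UNIV :: bool set)" "lborel :: (real \<times> real) measure"
    by (intro pair_sigma_finite.intro sigma_finite_labels lborel.sigma_finite_measure_axioms)
  let ?G = "\<lambda>(x, y, s). ennreal (label_prob x y * score_density x s) * F (x, y, s)"
  have d[measurable]: "(\<lambda>(x, y, s). ennreal (label_prob x y * score_density x s)) \<in> borel_measurable test_base"
    by measurable
  have G[measurable]: "?G \<in> borel_measurable test_base" by measurable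
  have "(\<integral>\<^sup>+z. F z \<partial>test) = (\<integral>\<^sup>+z. ?G z \<partial>test_base)"
    unfolding test_law_eq by (subst nn_integral_density[OF d F]) (auto intro!: nn_integral_cong)
  also have "\<dots> = (\<integral>\<^sup>+x. \<integral>\<^sup>+r. ?G (x, r) \<partial>(count_space UNIV \<Otimes>\<^sub>M lborel) \<partial>\<mu>)"
    by (rule S1.nn_integral_fst[symmetric, OF G])
  also have "\<dots> = (\<integral>\<^sup>+x. \<integral>\<^sup>+y. \<integral>\<^sup>+s. ?G (x, y, s) \<partial>lborel \<partial>count_space UNIV \<partial>\<mu>)"
    by (intro nn_integral_cong lborel.nn_integral_fst[symmetric]) measurable
  finally show ?thesis by simp
qed

text \<open>Labels and score are independent given the input, so the labels can be summed out first;
  \<open>g\<close> is the conditional mean of \<open>A\<close> that remains.\<close>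

lemma nn_integral_snapshot_score:
  fixes u :: "real \<times> real \<Rightarrow> ennreal" and A :: "'a \<Rightarrow> bool \<Rightarrow> bool \<Rightarrow> real"
  assumes [measurable]: "(\<lambda>(x, y1, y2, s). A x y1 y2) \<in> borel_measurable snapshot_base" "u \<in> borel_measurable borel"
    and A: "\<And>x y1 y2. x \<in> space \<mu> \<Longrightarrow> 0 \<le> A x y1 y2"
    and g: "\<And>x. x \<in> space \<mu> \<Longrightarrow> g x = (\<Sum>y1\<in>UNIV. \<Sum>y2\<in>UNIV. label_prob x y1 * label_prob x y2 * A x y1 y2)"
  shows "(\<integral>\<^sup>+(x, y1, y2, s). ennreal (A x y1 y2) * u s \<partial>snap) = weighted_score_integral g u"
proof -
  have [measurable]: "(\<lambda>z. A (fst z) (fst (snd z)) (fst (snd (snd z)))) \<in> borel_measurable snapshot_base"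
    using assms(1) by (simp add: case_prod_beta')
  have "(\<lambda>(x, y1, y2, s). ennreal (A x y1 y2) * u s) \<in> borel_measurable snapshot_base"
    unfolding case_prod_beta' by measurable
  then have "(\<integral>\<^sup>+(x, y1, y2, s). ennreal (A x y1 y2) * u s \<partial>snap)
    = (\<integral>\<^sup>+x. \<integral>\<^sup>+y1. \<integral>\<^sup>+y2. \<integral>\<^sup>+s. ennreal (label_prob x y1 * label_prob x y2 * score_density x s)
         * (ennreal (A x y1 y2) * u s) \<partial>lborel \<partial>count_space UNIV \<partial>count_space UNIV \<partial>\<mu>)"
    by (subst nn_integral_snapshot_law) auto
  also have "\<dots> = weighted_score_integral g u"
    unfolding weighted_score_integral_def
  proof (intro nn_integral_cong)
    fix x assume x: "x \<in> space \<mu>"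
    let ?I = "\<integral>\<^sup>+s. ennreal (score_density x s) * u s \<partial>lborel"
    have [measurable]: "(\<lambda>s. smooth_kernel x s) \<in> borel_measurable borel" using x by measurable
    have i: "(\<integral>\<^sup>+s. ennreal (label_prob x y1 * label_prob x y2 * score_density x s) * (ennreal (A x y1 y2) * u s) \<partial>lborel)
      = ennreal (label_prob x y1 * label_prob x y2 * A x y1 y2) * ?I" for y1 y2
      using label_prob_nonneg[OF x] score_density_nonneg[OF x] A[OF x]
      by (subst nn_integral_cmult[symmetric]) (auto intro!: nn_integral_cong simp: ennreal_mult mult_ac)
    show "(\<integral>\<^sup>+y1. \<integral>\<^sup>+y2. \<integral>\<^sup>+s. ennreal (label_prob x y1 * label_prob x y2 * score_density x s)
         * (ennreal (A x y1 y2) * u s) \<partial>lborel \<partial>count_space UNIV \<partial>count_space UNIV) = ennreal (g x) * ?I"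
      unfolding i nn_integral_labels
      unfolding g[OF x] UNIV_bool
      using label_prob_nonneg[OF x] A[OF x]
      by (simp add: ennreal_plus[symmetric] distrib_right[symmetric] add_ac del: ennreal_plus)
  qed
  finally show ?thesis .
qed

lemma nn_integral_test_score:
  fixes u :: "real \<times> real \<Rightarrow> ennreal" and A :: "'a \<Rightarrow> bool \<Rightarrow> real"
  assumes [measurable]: "(\<lambda>(x, y, s). A x y) \<in> borel_measurable test_base" "u \<in> borel_measurable borel"
    and A: "\<And>x y. x \<in> space \<mu> \<Longrightarrow> 0 \<le> A x y"
    and g: "\<And>x. x \<in> space \<mu> \<Longrightarrow> g x = (\<Sum>y\<in>UNIV. label_prob x y * A x y)"
  shows "(\<integral>\<^sup>+(x, y, s). ennreal (A x y) * u s \<partial>test) = weighted_score_integral g u"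
proof -
  have [measurable]: "(\<lambda>z. A (fst z) (fst (snd z))) \<in> borel_measurable test_base"
    using assms(1) by (simp add: case_prod_beta')
  have "(\<lambda>(x, y, s). ennreal (A x y) * u s) \<in> borel_measurable test_base"
    unfolding case_prod_beta' by measurable
  then have "(\<integral>\<^sup>+(x, y, s). ennreal (A x y) * u s \<partial>test)
    = (\<integral>\<^sup>+x. \<integral>\<^sup>+y. \<integral>\<^sup>+s. ennreal (label_prob x y * score_density x s) * (ennreal (A x y) * u s)
        \<partial>lborel \<partial>count_space UNIV \<partial>\<mu>)"
    by (subst nn_integral_test_law) auto
  also have "\<dots> = weighted_score_integral g u"
    unfolding weighted_score_integral_def
  proof (intro nn_integral_cong)
    fix x assume x: "x \<in> space \<mu>"
    let ?I = "\<integral>\<^sup>+s. ennreal (score_density x s) * u s \<partial>lborel"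
    have [measurable]: "(\<lambda>s. smooth_kernel x s) \<in> borel_measurable borel" using x by measurable
    have i: "(\<integral>\<^sup>+s. ennreal (label_prob x y * score_density x s) * (ennreal (A x y) * u s) \<partial>lborel)
      = ennreal (label_prob x y * A x y) * ?I" for y
      using label_prob_nonneg[OF x] score_density_nonneg[OF x] A[OF x]
      by (subst nn_integral_cmult[symmetric]) (auto intro!: nn_integral_cong simp: ennreal_mult mult_ac)
    show "(\<integral>\<^sup>+y. \<integral>\<^sup>+s. ennreal (label_prob x y * score_density x s) * (ennreal (A x y) * u s)
         \<partial>lborel \<partial>count_space UNIV) = ennreal (g x) * ?I"
      unfolding i nn_integral_labels
      unfolding g[OF x] UNIV_bool
      using label_prob_nonneg[OF x] A[OF x]
      by (simp add: ennreal_plus[symmetric] distrib_right[symmetric] add_ac del: ennreal_plus)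
  qed
  finally show ?thesis .
qed

lemma weighted_score_integral_1: "weighted_score_integral (\<lambda>_. 1) (\<lambda>_. 1) = 1"
  unfolding weighted_score_integral_def using nn_integral_score_kernel
  by (simp add: emeasure_space_1 cong: nn_integral_cong_simp)

lemma sum_label_prob: "(\<Sum>y\<in>UNIV. label_prob x y) = 1"
  by (simp add: UNIV_bool label_prob_def)

lemma prob_space_snapshot_law: "prob_space snap"
proof
  have "emeasure snap (space snap)
    = (\<integral>\<^sup>+(x, y1, y2, s). ennreal 1 * 1 \<partial>snap)"
    by (simp add: case_prod_beta')
  also have "\<dots> = weighted_score_integral (\<lambda>_. 1) (\<lambda>_. 1)"
    by (rule nn_integral_snapshot_score) (auto simp: sum_distrib_left[symmetric] sum_label_prob)
  finally show "emeasure snap (space snap) = 1"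
    by (simp add: weighted_score_integral_1)
qed

lemma prob_space_test_law: "prob_space test"
proof
  have "emeasure test (space test)
    = (\<integral>\<^sup>+(x, y, s). ennreal 1 * 1 \<partial>test)"
    by (simp add: case_prod_beta')
  also have "\<dots> = weighted_score_integral (\<lambda>_. 1) (\<lambda>_. 1)"
    by (rule nn_integral_test_score) (auto simp: sum_label_prob)
  finally show "emeasure test (space test) = 1"
    by (simp add: weighted_score_integral_1)
qed

lemma sets_snapshot_law [measurable_cong]: "sets snap = sets snapshot_base"
  by (simp add: snapshot_law_def)

lemma sets_test_law [measurable_cong]: "sets test = sets test_base"
  by (simp add: test_law_def)

lemma perturbed_score_measurable [measurable]: "perturbed_score \<in> snap \<rightarrow>\<^sub>M borel"
  unfolding perturbed_score_def case_prod_beta' by measurable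

lemma first_label_measurable [measurable]: "first_label \<in> borel_measurable snap"
  unfolding first_label_def case_prod_beta' by measurable

lemma label_product_measurable [measurable]: "label_product \<in> borel_measurable snap"
  unfolding label_product_def case_prod_beta' by measurable

lemma f2_01: "x \<in> space \<mu> \<Longrightarrow> (f x)\<^sup>2 \<in> {0..1}"
  using f01[of x] by (auto simp: abs_square_le_1)

lemma nn_integral_snapshot_marginal:
  assumes [measurable]: "u \<in> borel_measurable borel"
  shows "(\<integral>\<^sup>+z. u (perturbed_score z) \<partial>snap) = weighted_score_integral (\<lambda>_. 1) u"
proof -
  have "(\<integral>\<^sup>+z. u (perturbed_score z) \<partial>snap)
    = (\<integral>\<^sup>+(x, y1, y2, s). ennreal 1 * u s \<partial>snap)"
    by (simp add: perturbed_score_def case_prod_beta')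
  also have "\<dots> = weighted_score_integral (\<lambda>_. 1) u"
    by (rule nn_integral_snapshot_score) (auto simp: sum_distrib_left[symmetric] sum_label_prob)
  finally show ?thesis .
qed

lemma weighted_score_integral_snap:
  assumes [measurable]: "g \<in> borel_measurable \<mu>" "u \<in> borel_measurable borel"
    and g: "\<And>x. x \<in> space \<mu> \<Longrightarrow> g x \<in> {0..1}"
  shows "weighted_score_integral g u = (\<integral>\<^sup>+z. ennreal (reg g (perturbed_score z)) * u (perturbed_score z) \<partial>snap)"
proof -
  have "weighted_score_integral g u = weighted_score_integral (\<lambda>_. 1) (\<lambda>s. ennreal (reg g s) * u s)"
    by (rule weighted_score_integral_reg[OF assms])
  also have "\<dots> = (\<integral>\<^sup>+z. ennreal (reg g (perturbed_score z)) * u (perturbed_score z) \<partial>snap)"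
    by (rule nn_integral_snapshot_marginal[symmetric]) measurable
  finally show ?thesis .
qed

lemma nn_integral_first_label:
  assumes [measurable]: "u \<in> borel_measurable borel"
  shows "(\<integral>\<^sup>+z. ennreal (first_label z) * u (perturbed_score z) \<partial>snap)
    = (\<integral>\<^sup>+z. ennreal (reg f (perturbed_score z)) * u (perturbed_score z) \<partial>snap)"
proof -
  have "(\<integral>\<^sup>+z. ennreal (first_label z) * u (perturbed_score z) \<partial>snap)
    = (\<integral>\<^sup>+(x, y1, y2, s). ennreal (of_bool y1) * u s \<partial>snap)"
    by (simp add: perturbed_score_def first_label_def case_prod_beta')
  also have "\<dots> = weighted_score_integral f u"
  proof (rule nn_integral_snapshot_score)
    show "(\<lambda>(x, y1, y2, s). of_bool y1) \<in> borel_measurable snapshot_base"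
      unfolding case_prod_beta' by measurable
  qed (auto simp: UNIV_bool label_prob_def algebra_simps)
  also have "\<dots> = (\<integral>\<^sup>+z. ennreal (reg f (perturbed_score z)) * u (perturbed_score z) \<partial>snap)"
    by (rule weighted_score_integral_snap) (auto dest: f01)
  finally show ?thesis .
qed

text \<open>The point of 2-snapshots: two labels that are independent given the input have a product
  with mean \<open>(f x)\<^sup>2\<close>, so the second moment becomes an observable regression
  target.\<close>

lemma nn_integral_label_product:
  assumes [measurable]: "u \<in> borel_measurable borel"
  shows "(\<integral>\<^sup>+z. ennreal (label_product z) * u (perturbed_score z) \<partial>snap)
    = (\<integral>\<^sup>+z. ennreal (reg (\<lambda>x. (f x)\<^sup>2) (perturbed_score z)) * u (perturbed_score z) \<partial>snap)"
proof -
  have "(\<integral>\<^sup>+z. ennreal (label_product z) * u (perturbed_score z) \<partial>snap)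
    = (\<integral>\<^sup>+(x, y1, y2, s). ennreal (of_bool y1 * of_bool y2) * u s \<partial>snap)"
    by (simp add: perturbed_score_def label_product_def case_prod_beta')
  also have "\<dots> = weighted_score_integral (\<lambda>x. (f x)\<^sup>2) u"
  proof (rule nn_integral_snapshot_score)
    show "(\<lambda>(x, y1, y2, s). of_bool y1 * of_bool y2) \<in> borel_measurable snapshot_base"
      unfolding case_prod_beta' by measurable
  qed (auto simp: UNIV_bool label_prob_def power2_eq_square)
  also have "\<dots> = (\<integral>\<^sup>+z. ennreal (reg (\<lambda>x. (f x)\<^sup>2) (perturbed_score z)) * u (perturbed_score z) \<partial>snap)"
    by (rule weighted_score_integral_snap) (auto dest: f2_01)
  finally show ?thesis .
qed

lemma nn_integral_test_marginal:
  assumes [measurable]: "u \<in> borel_measurable borel"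
  shows "(\<integral>\<^sup>+(x, y, s). u s \<partial>test) = weighted_score_integral (\<lambda>_. 1) u"
proof -
  have "(\<integral>\<^sup>+(x, y, s). u s \<partial>test) = (\<integral>\<^sup>+(x, y, s). ennreal 1 * u s \<partial>test)"
    by simp
  also have "\<dots> = weighted_score_integral (\<lambda>_. 1) u"
    by (rule nn_integral_test_score) (auto simp: sum_label_prob)
  finally show ?thesis .
qed

lemma weighted_score_integral_test:
  assumes [measurable]: "g \<in> borel_measurable \<mu>" "u \<in> borel_measurable borel"
    and g: "\<And>x. x \<in> space \<mu> \<Longrightarrow> g x \<in> {0..1}"
  shows "weighted_score_integral g u = (\<integral>\<^sup>+(x, y, s). ennreal (reg g s) * u s \<partial>test)"
proof -
  have "weighted_score_integral g u = weighted_score_integral (\<lambda>_. 1) (\<lambda>s. ennreal (reg g s) * u s)"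
    by (rule weighted_score_integral_reg[OF assms])
  also have "\<dots> = (\<integral>\<^sup>+(x, y, s). ennreal (reg g s) * u s \<partial>test)"
    by (rule nn_integral_test_marginal[symmetric]) measurable
  finally show ?thesis .
qed

lemma nn_integral_test_label:
  assumes [measurable]: "u \<in> borel_measurable borel"
  shows "(\<integral>\<^sup>+(x, y, s). ennreal (of_bool y) * u s \<partial>test)
    = (\<integral>\<^sup>+(x, y, s). ennreal (reg f s) * u s \<partial>test)"
proof -
  have "(\<integral>\<^sup>+(x, y, s). ennreal (of_bool y) * u s \<partial>test) = weighted_score_integral f u"
  proof (rule nn_integral_test_score)
    show "(\<lambda>(x, y, s). of_bool y) \<in> borel_measurable test_base"
      unfolding case_prod_beta' by measurable
  qed (auto simp: UNIV_bool label_prob_def)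
  also have "\<dots> = (\<integral>\<^sup>+(x, y, s). ennreal (reg f s) * u s \<partial>test)"
    by (rule weighted_score_integral_test) (auto dest: f01)
  finally show ?thesis .
qed

lemma nn_integral_test_second_moment:
  assumes [measurable]: "u \<in> borel_measurable borel"
  shows "(\<integral>\<^sup>+(x, y, s). ennreal ((f x)\<^sup>2) * u s \<partial>test)
    = (\<integral>\<^sup>+(x, y, s). ennreal (reg (\<lambda>x. (f x)\<^sup>2) s) * u s \<partial>test)"
proof -
  have "(\<integral>\<^sup>+(x, y, s). ennreal ((f x)\<^sup>2) * u s \<partial>test) = weighted_score_integral (\<lambda>x. (f x)\<^sup>2) u"
  proof (rule nn_integral_test_score)
    show "(\<lambda>(x, y, s). (f x)\<^sup>2) \<in> borel_measurable test_base"
      unfolding case_prod_beta' by measurable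
  qed (auto simp: UNIV_bool label_prob_def algebra_simps)
  also have "\<dots> = (\<integral>\<^sup>+(x, y, s). ennreal (reg (\<lambda>x. (f x)\<^sup>2) s) * u s \<partial>test)"
    by (rule weighted_score_integral_test) (auto dest: f2_01)
  finally show ?thesis .
qed

text \<open>The conditional variance is nonnegative: expand the weighted mean square of
  \<open>f - reg f s\<close>.\<close>

lemma reg_square_le: "(reg f s)\<^sup>2 \<le> reg (\<lambda>x. (f x)\<^sup>2) s"
proof -
  let ?r = "reg f s"
  have f2: "(\<lambda>x. (f x)\<^sup>2) \<in> borel_measurable \<mu>" by measurable
  note i = integrable_smooth_kernel[OF f_measurable f01, of s] integrable_smooth_kernel[OF f2 f2_01, of s]
    integrable_smooth_kernel[of "\<lambda>_. 1" s, simplified]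
  have "0 \<le> (\<integral>x. (f x - ?r)\<^sup>2 * smooth_kernel x s \<partial>\<mu>)"
    using smooth_kernel_nonneg by (intro integral_nonneg_AE AE_I2) auto
  also have "\<dots> = (\<integral>x. (f x)\<^sup>2 * smooth_kernel x s - 2 * ?r * (f x * smooth_kernel x s)
      + ?r\<^sup>2 * smooth_kernel x s \<partial>\<mu>)"
    by (intro Bochner_Integration.integral_cong refl) (simp add: power2_eq_square algebra_simps)
  also have "\<dots> = numerator (\<lambda>x. (f x)\<^sup>2) s - 2 * ?r * numerator f s + ?r\<^sup>2 * numerator (\<lambda>_. 1) s"
    unfolding numerator_def using i by simp
  also have "numerator f s = ?r * numerator (\<lambda>_. 1) s"
    unfolding reg_def using numerator_pos[of s] by simp
  finally have "?r\<^sup>2 * numerator (\<lambda>_. 1) s \<le> numerator (\<lambda>x. (f x)\<^sup>2) s"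
    by (simp add: power2_eq_square algebra_simps)
  then show ?thesis unfolding reg_def[of "\<lambda>x. (f x)\<^sup>2"] using numerator_pos[of s] by (simp add: le_divide_eq)
qed

end

text \<open>Extends the identity from nonnegative to bounded test functions by applying it to
  \<open>\<psi> + 1\<close> and to 1.\<close>

lemma integral_eq_of_nn_integral_eq:
  fixes Z W :: "'z \<Rightarrow> real" and \<psi> :: "'s \<Rightarrow> real"
  assumes "prob_space L" and [measurable]: "S \<in> L \<rightarrow>\<^sub>M N" "Z \<in> borel_measurable L" "W \<in> borel_measurable L"
      "\<psi> \<in> borel_measurable N"
    and Z: "\<And>z. z \<in> space L \<Longrightarrow> Z z \<in> {0..1}" and W: "\<And>z. z \<in> space L \<Longrightarrow> W z \<in> {0..1}"
    and \<psi>: "\<And>s. \<bar>\<psi> s\<bar> \<le> 1"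
    and eq: "\<And>u. u \<in> borel_measurable N \<Longrightarrow>
      (\<integral>\<^sup>+z. ennreal (Z z) * u (S z) \<partial>L) = (\<integral>\<^sup>+z. ennreal (W z) * u (S z) \<partial>L)"
  shows "(\<integral>z. Z z * \<psi> (S z) \<partial>L) = (\<integral>z. W z * \<psi> (S z) \<partial>L)"
proof -
  interpret prob_space L by fact
  have int: "integrable L (\<lambda>z. V z * \<phi> (S z))"
    if [measurable]: "V \<in> borel_measurable L" "\<phi> \<in> borel_measurable N"
      and V: "\<And>z. z \<in> space L \<Longrightarrow> V z \<in> {0..1}" and "\<And>s. \<bar>\<phi> s\<bar> \<le> 2" for V :: "'z \<Rightarrow> real" and \<phi> :: "'s \<Rightarrow> real"
  proof (rule integrable_const_bound[where B = "1 * 2"])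
    show "AE z in L. norm (V z * \<phi> (S z)) \<le> 1 * 2"
      unfolding real_norm_def abs_mult using V that(4) by (intro AE_I2 mult_mono) auto
  qed measurable
  have nonneg: "(\<integral>z. Z z * \<phi> (S z) \<partial>L) = (\<integral>z. W z * \<phi> (S z) \<partial>L)"
    if [measurable]: "\<phi> \<in> borel_measurable N" and \<phi>: "\<And>s. 0 \<le> \<phi> s" for \<phi> :: "'s \<Rightarrow> real"
  proof -
    have n: "(\<integral>z. V z * \<phi> (S z) \<partial>L) = enn2real (\<integral>\<^sup>+z. ennreal (V z) * ennreal (\<phi> (S z)) \<partial>L)"
      if [measurable]: "V \<in> borel_measurable L" and V: "\<And>z. z \<in> space L \<Longrightarrow> V z \<in> {0..1}" for V :: "'z \<Rightarrow> real"
    proof -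
      have "(\<integral>z. V z * \<phi> (S z) \<partial>L) = enn2real (\<integral>\<^sup>+z. ennreal (V z * \<phi> (S z)) \<partial>L)"
        using V \<phi> by (intro integral_eq_nn_integral AE_I2 mult_nonneg_nonneg) auto
      also have "(\<integral>\<^sup>+z. ennreal (V z * \<phi> (S z)) \<partial>L) = (\<integral>\<^sup>+z. ennreal (V z) * ennreal (\<phi> (S z)) \<partial>L)"
        using V \<phi> by (intro nn_integral_cong ennreal_mult) auto
      finally show ?thesis .
    qed
    show ?thesis using eq[of "\<lambda>s. ennreal (\<phi> s)"] n[OF assms(3) Z] n[OF assms(4) W] by simp
  qed
  have p1: "(\<integral>z. Z z * (\<psi> (S z) + 1) \<partial>L) = (\<integral>z. W z * (\<psi> (S z) + 1) \<partial>L)"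
  proof (rule nonneg[of "\<lambda>s. \<psi> s + 1"])
    show "0 \<le> \<psi> s + 1" for s using \<psi>[of s] by linarith
  qed measurable
  have p2: "(\<integral>z. Z z * 1 \<partial>L) = (\<integral>z. W z * 1 \<partial>L)"
    by (intro nonneg[of "\<lambda>_. 1"]) auto
  have \<psi>2: "\<bar>\<psi> s\<bar> \<le> 2" for s using \<psi>[of s] by simp
  show ?thesis using p1 p2 int[of Z \<psi>] int[of W \<psi>] int[of Z "\<lambda>_. 1"] int[of W "\<lambda>_. 1"] Z W \<psi>2
    by (simp add: distrib_left)
qed

text \<open>\<open>Y\<close> and \<open>U\<close> have equal integrals over the sets of
  \<open>G\<close>, hence the same conditional expectation \<open>E\<close>. The sign of
  \<open>E - V\<close> is \<open>G\<close>-measurable; testing with it gives the integral of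
  \<open>\<bar>E - V\<bar>\<close>, and in this test \<open>E\<close> may be replaced by
  \<open>U\<close>.\<close>

lemma integral_abs_cond_exp_diff_le:
  fixes Y U V :: "'w \<Rightarrow> real"
  assumes "prob_space M" "subalgebra M G"
    and Y: "integrable M Y" and U: "integrable M U" and V: "integrable M V" "V \<in> borel_measurable G"
    and eq: "\<And>A. A \<in> sets G \<Longrightarrow> (\<integral>x\<in>A. Y x \<partial>M) = (\<integral>x\<in>A. U x \<partial>M)"
  shows "(\<integral>x. \<bar>real_cond_exp M G Y x - V x\<bar> \<partial>M) \<le> (\<integral>x. \<bar>U x - V x\<bar> \<partial>M)"
proof -
  interpret prob_space M by fact
  interpret finite_measure_subalgebra M G by unfold_locales fact
  define E where "E = real_cond_exp M G Y"
  have EG[measurable]: "E \<in> borel_measurable G" unfolding E_def by simp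
  have VG[measurable]: "V \<in> borel_measurable G" by fact
  have E_int: "integrable M E" unfolding E_def by (rule real_cond_exp_int(1)[OF Y])
  have "AE x in M. real_cond_exp M G U x = E x"
  proof (rule real_cond_exp_charact)
    show "(\<integral>x\<in>A. U x \<partial>M) = (\<integral>x\<in>A. E x \<partial>M)" if "A \<in> sets G" for A
      unfolding E_def using eq[OF that] real_cond_exp_intA[OF Y that] by simp
  qed (use U E_int EG in auto)
  define \<sigma> where "\<sigma> x = sgn (E x - V x)" for x
  have \<sigma>G: "\<sigma> \<in> borel_measurable G" unfolding \<sigma>_def[abs_def] by measurable
  have \<sigma>M[measurable]: "\<sigma> \<in> borel_measurable M" by (rule measurable_from_subalg[OF subalg \<sigma>G])
  have \<sigma>1: "\<bar>\<sigma> x\<bar> \<le> 1" for x unfolding \<sigma>_def by (simp add: sgn_if)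
  have \<sigma>int: "integrable M (\<lambda>x. \<sigma> x * q x)" if q: "integrable M q" for q
  proof (rule Bochner_Integration.integrable_bound[OF q])
    show "(\<lambda>x. \<sigma> x * q x) \<in> borel_measurable M" using q by measurable
    show "AE x in M. norm (\<sigma> x * q x) \<le> norm (q x)"
      using \<sigma>1 by (intro AE_I2) (simp add: abs_mult mult_left_le_one_le)
  qed
  have "(\<integral>x. \<sigma> x * E x \<partial>M) = (\<integral>x. \<sigma> x * real_cond_exp M G U x \<partial>M)"
  proof (rule integral_cong_AE)
    show "(\<lambda>x. \<sigma> x * E x) \<in> borel_measurable M" using E_int by measurable
    show "AE x in M. \<sigma> x * E x = \<sigma> x * real_cond_exp M G U x"
      using \<open>AE x in M. real_cond_exp M G U x = E x\<close> by eventually_elim simp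
  qed measurable
  also have "\<dots> = (\<integral>x. \<sigma> x * U x \<partial>M)"
    using U by (intro real_cond_exp_intg(2) \<sigma>int \<sigma>G) auto
  finally have s: "(\<integral>x. \<sigma> x * E x \<partial>M) = (\<integral>x. \<sigma> x * U x \<partial>M)" .
  have "(\<integral>x. \<bar>E x - V x\<bar> \<partial>M) = (\<integral>x. \<sigma> x * E x - \<sigma> x * V x \<partial>M)"
    by (intro Bochner_Integration.integral_cong refl) (simp add: \<sigma>_def abs_sgn algebra_simps)
  also have "\<dots> = (\<integral>x. \<sigma> x * (U x - V x) \<partial>M)"
    using \<sigma>int[OF E_int] \<sigma>int[OF U] \<sigma>int[OF V(1)] s by (simp add: right_diff_distrib)
  also have "\<dots> \<le> (\<integral>x. \<bar>U x - V x\<bar> \<partial>M)"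
  proof (rule integral_mono)
    show "integrable M (\<lambda>x. \<sigma> x * (U x - V x))" using U V by (intro \<sigma>int) auto
    show "\<sigma> x * (U x - V x) \<le> \<bar>U x - V x\<bar>" for x
    proof -
      have "\<sigma> x * (U x - V x) \<le> \<bar>\<sigma> x\<bar> * \<bar>U x - V x\<bar>" by (metis abs_ge_self abs_mult)
      also have "\<dots> \<le> 1 * \<bar>U x - V x\<bar>" using \<sigma>1 by (intro mult_right_mono) auto
      finally show ?thesis by simp
    qed
  qed (use U V in auto)
  finally show ?thesis unfolding E_def .
qed

subsection \<open>Calibration error\<close>

context snapshot_model
begin

abbreviation "reg2 \<equiv> reg (\<lambda>x. (f x)\<^sup>2)"

lemma f2_measurable: "(\<lambda>x. (f x)\<^sup>2) \<in> borel_measurable \<mu>"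
  by measurable

lemma reg2_measurable [measurable]: "reg2 \<in> borel_measurable borel"
  by (rule reg_measurable[OF f2_measurable])

lemma integral_test_marginal:
  fixes \<phi> :: "real \<times> real \<Rightarrow> real"
  assumes [measurable]: "\<phi> \<in> borel_measurable borel" and "\<And>s. 0 \<le> \<phi> s"
  shows "(\<integral>z. \<phi> (snd (snd z)) \<partial>test) = (\<integral>z. \<phi> (perturbed_score z) \<partial>snap)"
proof -
  have "(\<integral>z. \<phi> (snd (snd z)) \<partial>test) = enn2real (\<integral>\<^sup>+z. ennreal (\<phi> (snd (snd z))) \<partial>test)"
    using assms(2) by (intro integral_eq_nn_integral) auto
  also have "(\<integral>\<^sup>+z. ennreal (\<phi> (snd (snd z))) \<partial>test) = weighted_score_integral (\<lambda>_. 1) (\<lambda>s. ennreal (\<phi> s))"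
    using nn_integral_test_marginal[of "\<lambda>s. ennreal (\<phi> s)"] by (simp add: case_prod_beta')
  also have "\<dots> = (\<integral>\<^sup>+z. ennreal (\<phi> (perturbed_score z)) \<partial>snap)"
    by (rule nn_integral_snapshot_marginal[symmetric]) measurable
  also have "enn2real \<dots> = (\<integral>z. \<phi> (perturbed_score z) \<partial>snap)"
    using assms(2) by (intro integral_eq_nn_integral[symmetric]) auto
  finally show ?thesis .
qed

text \<open>The sets of the sigma-algebra of the prediction are events of the score, so on them
  \<open>Y\<close> may be exchanged for its mean \<open>\<zeta>\<close> given the score. As a
  function \<open>p\<close> of the prediction, \<open>q\<close> is measurable for that algebra;
  \<open>p\<close> will be the mean for the first term of \<open>CE2\<close> and the predicted
  second moment for the other.\<close>

lemma cond_exp_error_le: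
  fixes R :: "real \<times> real \<Rightarrow> real \<times> real" and \<zeta> q :: "real \<times> real \<Rightarrow> real"
  assumes R[measurable]: "R \<in> borel \<rightarrow>\<^sub>M borel" and p[measurable]: "p \<in> borel_measurable borel"
    and q: "\<And>s. q s = p (R s)" "\<And>s. q s \<in> {0..1}"
    and Y[measurable]: "Y \<in> borel_measurable test"
    and Y01: "\<And>z. z \<in> space test \<Longrightarrow> Y z \<in> {0..1}"
    and \<zeta>[measurable]: "\<zeta> \<in> borel_measurable borel" and \<zeta>01: "\<And>s. \<zeta> s \<in> {0..1}"
    and eq: "\<And>u. u \<in> borel_measurable borel \<Longrightarrow>
      (\<integral>\<^sup>+z. ennreal (Y z) * u (snd (snd z)) \<partial>test)
      = (\<integral>\<^sup>+z. ennreal (\<zeta> (snd (snd z))) * u (snd (snd z)) \<partial>test)"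
  shows "(\<integral>z. \<bar>real_cond_exp test
        (vimage_algebra (space test) (\<lambda>(x, y, s). R s) borel) Y z - q (snd (snd z))\<bar> \<partial>test)
    \<le> (\<integral>z. \<bar>q (perturbed_score z) - \<zeta> (perturbed_score z)\<bar> \<partial>snap)"
proof -
  let ?M = test and ?T = "\<lambda>(x, y, s). R s"
  let ?G = "vimage_algebra (space ?M) ?T borel"
  interpret M: prob_space ?M by (rule prob_space_test_law)
  have S[measurable]: "(\<lambda>z. snd (snd z)) \<in> ?M \<rightarrow>\<^sub>M borel" by measurable
  have T: "?T \<in> ?M \<rightarrow>\<^sub>M borel" unfolding case_prod_beta' by measurable
  have qm[measurable]: "q \<in> borel_measurable borel" unfolding q(1)[abs_def] by measurable
  have sub: "subalgebra ?M ?G"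
    unfolding subalgebra_def using measurable_sets[OF T] by (auto simp: sets_vimage_algebra2)
  have "(\<integral>z. \<bar>real_cond_exp ?M ?G Y z - q (snd (snd z))\<bar> \<partial>?M) \<le> (\<integral>z. \<bar>\<zeta> (snd (snd z)) - q (snd (snd z))\<bar> \<partial>?M)"
  proof (rule integral_abs_cond_exp_diff_le[OF prob_space_test_law sub])
    show "integrable ?M Y" using Y01 by (intro M.integrable_const_bound[where B = 1] AE_I2 Y) auto
    show "integrable ?M (\<lambda>z. \<zeta> (snd (snd z)))"
      using \<zeta>01 by (intro M.integrable_const_bound[where B = 1] AE_I2) auto
    show "integrable ?M (\<lambda>z. q (snd (snd z)))"
      using q(2) by (intro M.integrable_const_bound[where B = 1] AE_I2) auto
    have "?T \<in> ?G \<rightarrow>\<^sub>M borel" by (rule measurable_vimage_algebra1) auto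
    then have "(\<lambda>z. p (?T z)) \<in> borel_measurable ?G" by (rule measurable_compose) (rule p)
    then show "(\<lambda>z. q (snd (snd z))) \<in> borel_measurable ?G" by (simp add: q(1) case_prod_beta')
    fix A assume "A \<in> sets ?G"
    then obtain B where B[measurable]: "B \<in> sets borel" and A: "A = ?T -` B \<inter> space ?M"
      by (auto simp: sets_vimage_algebra2)
    have ind: "indicator A z = (indicator B (R (snd (snd z))) :: real)" if "z \<in> space ?M" for z
      using that unfolding A by (cases z) (auto simp: indicator_def)
    have "(\<integral>z\<in>A. Y z \<partial>?M) = (\<integral>z. Y z * indicator B (R (snd (snd z))) \<partial>?M)"
      unfolding set_lebesgue_integral_def by (intro Bochner_Integration.integral_cong refl) (simp add: ind)
    also have "\<dots> = (\<integral>z. \<zeta> (snd (snd z)) * indicator B (R (snd (snd z))) \<partial>?M)"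
    proof (rule integral_eq_of_nn_integral_eq[where \<psi> = "\<lambda>s. indicator B (R s)", OF prob_space_test_law S Y _ _ Y01 _ _ eq])
      show "(\<lambda>z. \<zeta> (snd (snd z))) \<in> borel_measurable ?M" by measurable
      show "(\<lambda>s. indicator B (R s)) \<in> borel_measurable borel" by measurable
      show "\<bar>indicator B (R s) :: real\<bar> \<le> 1" for s by (simp add: indicator_def)
    qed (use \<zeta>01 in auto)
    also have "\<dots> = (\<integral>z\<in>A. \<zeta> (snd (snd z)) \<partial>?M)"
      unfolding set_lebesgue_integral_def by (intro Bochner_Integration.integral_cong refl) (simp add: ind)
    finally show "(\<integral>z\<in>A. Y z \<partial>?M) = (\<integral>z\<in>A. \<zeta> (snd (snd z)) \<partial>?M)" .
  qed
  also have "\<dots> = (\<integral>z. \<bar>q (snd (snd z)) - \<zeta> (snd (snd z))\<bar> \<partial>?M)" by (simp add: abs_minus_commute)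
  also have "\<dots> = (\<integral>z. \<bar>q (perturbed_score z) - \<zeta> (perturbed_score z)\<bar> \<partial>snap)"
    by (rule integral_test_marginal[of "\<lambda>s. \<bar>q s - \<zeta> s\<bar>"]) auto
  finally show ?thesis .
qed

text \<open>Since \<open>(E[f | S])\<^sup>2 \<le> E[f\<^sup>2 | S]\<close>, truncating the variance at zero does not
  increase the error.\<close>

lemma recalibration_error_le:
  assumes g1[measurable]: "g1 \<in> borel_measurable borel" and g2[measurable]: "g2 \<in> borel_measurable borel"
    and g1_01: "\<And>s. g1 s \<in> {0..1}" and g2_01: "\<And>s. g2 s \<in> {0..1}"
  shows "recalibration_error h \<mu> f m v g1 g2 \<le>
    3 * (\<integral>z. \<bar>g1 (perturbed_score z) - reg f (perturbed_score z)\<bar> \<partial>snap)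
    + (\<integral>z. \<bar>g2 (perturbed_score z) - reg2 (perturbed_score z)\<bar> \<partial>snap)"
proof -
  let ?M = test and ?L = snap
  interpret L: prob_space ?L by (rule prob_space_snapshot_law)
  define R where "R = recalibrated g1 g2"
  have "R \<in> borel \<rightarrow>\<^sub>M borel \<Otimes>\<^sub>M borel"
    unfolding R_def recalibrated_def[abs_def] by measurable
  then have R[measurable]: "R \<in> borel \<rightarrow>\<^sub>M borel" by (simp add: borel_prod)
  \<comment> \<open>The predicted second moment: adding the squared mean to the truncated variance
    gives a maximum.\<close>
  define q where "q s = max ((g1 s)\<^sup>2) (g2 s)" for s
  have qR: "q s = (fst (R s))\<^sup>2 + snd (R s)" for s
    unfolding q_def R_def recalibrated_def by (simp add: max_def)
  have g1sq: "(g1 s)\<^sup>2 \<in> {0..1}" for s using g1_01[of s] by (auto simp: abs_square_le_1)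
  have q01: "q s \<in> {0..1}" for s using g1sq[of s] g2_01[of s] unfolding q_def by auto
  have qm[measurable]: "q \<in> borel_measurable borel" unfolding q_def[abs_def] by measurable
  note r1 = reg_bounds(2,3)[OF f_measurable f01] and r2 = reg_bounds(2,3)[OF f2_measurable f2_01]
  have e1: "(\<integral>z. \<bar>real_cond_exp ?M (vimage_algebra (space ?M) (\<lambda>(x, y, s). R s) borel) (\<lambda>(x, y, s). of_bool y) z
        - g1 (snd (snd z))\<bar> \<partial>?M) \<le> (\<integral>z. \<bar>g1 (perturbed_score z) - reg f (perturbed_score z)\<bar> \<partial>?L)"
  proof (rule cond_exp_error_le[OF R])
    show "fst \<in> borel_measurable (borel :: (real \<times> real) measure)" unfolding borel_prod[symmetric] by measurable
    show "(\<lambda>(x, y, s). of_bool y) \<in> borel_measurable ?M" unfolding case_prod_beta' by measurable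
    fix u :: "real \<times> real \<Rightarrow> ennreal" assume "u \<in> borel_measurable borel"
    from nn_integral_test_label[OF this]
    show "(\<integral>\<^sup>+z. ennreal ((\<lambda>(x, y, s). of_bool y) z) * u (snd (snd z)) \<partial>?M)
      = (\<integral>\<^sup>+z. ennreal (reg f (snd (snd z))) * u (snd (snd z)) \<partial>?M)" by (simp add: case_prod_beta')
  qed (use g1_01 r1 in \<open>auto simp: R_def recalibrated_def\<close>)
  have e2: "(\<integral>z. \<bar>real_cond_exp ?M (vimage_algebra (space ?M) (\<lambda>(x, y, s). R s) borel) (\<lambda>(x, y, s). (f x)\<^sup>2) z
        - q (snd (snd z))\<bar> \<partial>?M) \<le> (\<integral>z. \<bar>q (perturbed_score z) - reg2 (perturbed_score z)\<bar> \<partial>?L)"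
  proof (rule cond_exp_error_le[OF R])
    show "(\<lambda>t. (fst t)\<^sup>2 + snd t) \<in> borel_measurable (borel :: (real \<times> real) measure)"
      unfolding borel_prod[symmetric] by measurable
    show "(\<lambda>(x, y, s). (f x)\<^sup>2) \<in> borel_measurable ?M" unfolding case_prod_beta' by measurable
    show "(\<lambda>(x, y, s). (f x)\<^sup>2) z \<in> {0..1}" if "z \<in> space ?M" for z
      using that f2_01[of "fst z"] by (auto simp: test_law_def space_pair_measure)
    fix u :: "real \<times> real \<Rightarrow> ennreal" assume "u \<in> borel_measurable borel"
    from nn_integral_test_second_moment[OF this]
    show "(\<integral>\<^sup>+z. ennreal ((\<lambda>(x, y, s). (f x)\<^sup>2) z) * u (snd (snd z)) \<partial>?M)
      = (\<integral>\<^sup>+z. ennreal (reg2 (snd (snd z))) * u (snd (snd z)) \<partial>?M)" by (simp add: case_prod_beta')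
  qed (use q01 qR r2 in auto)
  have int: "integrable ?L (\<lambda>z. \<bar>a (perturbed_score z) - b (perturbed_score z)\<bar>)"
    if [measurable]: "a \<in> borel_measurable borel" "b \<in> borel_measurable borel"
      and "\<And>s. a s \<in> {0..1}" "\<And>s. b s \<in> {0..1}" for a b :: "real \<times> real \<Rightarrow> real"
  proof (rule L.integrable_const_bound[where B = 1])
    show "AE z in ?L. norm \<bar>a (perturbed_score z) - b (perturbed_score z)\<bar> \<le> 1"
    proof (rule AE_I2)
      fix z
      show "norm \<bar>a (perturbed_score z) - b (perturbed_score z)\<bar> \<le> 1"
        using that(3)[of "perturbed_score z"] that(4)[of "perturbed_score z"] by (simp add: abs_le_iff)
    qed
  qed measurable
  have R1: "reg f s \<in> {0..1}" "reg2 s \<in> {0..1}" for s using r1 r2 by auto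
  \<comment> \<open>The maximum with \<open>(g1 s)\<^sup>2\<close> is compared with
    \<open>reg2 s\<close>, which dominates \<open>(reg f s)\<^sup>2\<close>. The factor 2 comes from
    a difference of squares in [0, 1]; with the error of the first moment it makes up the 3 of the
    statement.\<close>
  have ptw: "\<bar>q s - reg2 s\<bar> \<le> 2 * \<bar>g1 s - reg f s\<bar> + \<bar>g2 s - reg2 s\<bar>" for s
  proof -
    have max_le: "\<bar>max a b - d\<bar> \<le> \<bar>a - c\<bar> + \<bar>b - d\<bar>" if "c \<le> d" for a b c d :: real
      using that by (auto simp: max_def abs_if)
    have "\<bar>q s - reg2 s\<bar> \<le> \<bar>(g1 s)\<^sup>2 - (reg f s)\<^sup>2\<bar> + \<bar>g2 s - reg2 s\<bar>"
      unfolding q_def by (rule max_le[OF reg_square_le])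
    also have "\<bar>(g1 s)\<^sup>2 - (reg f s)\<^sup>2\<bar> = \<bar>g1 s - reg f s\<bar> * \<bar>g1 s + reg f s\<bar>"
      by (simp add: abs_mult[symmetric] power2_eq_square algebra_simps)
    also have "\<dots> \<le> \<bar>g1 s - reg f s\<bar> * 2" using g1_01[of s] R1[of s] by (intro mult_left_mono) auto
    finally show ?thesis by simp
  qed
  have "(\<integral>z. \<bar>q (perturbed_score z) - reg2 (perturbed_score z)\<bar> \<partial>?L)
    \<le> (\<integral>z. 2 * \<bar>g1 (perturbed_score z) - reg f (perturbed_score z)\<bar> + \<bar>g2 (perturbed_score z) - reg2 (perturbed_score z)\<bar> \<partial>?L)"
    using int[OF qm reg2_measurable q01 R1(2)] int[OF g1 reg_measurable[OF f_measurable] g1_01 R1(1)]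
      int[OF g2 reg2_measurable g2_01 R1(2)] ptw by (intro integral_mono) auto
  also have "\<dots> = 2 * (\<integral>z. \<bar>g1 (perturbed_score z) - reg f (perturbed_score z)\<bar> \<partial>?L)
    + (\<integral>z. \<bar>g2 (perturbed_score z) - reg2 (perturbed_score z)\<bar> \<partial>?L)"
    using int[OF g1 reg_measurable[OF f_measurable] g1_01 R1(1)] int[OF g2 reg2_measurable g2_01 R1(2)] by simp
  finally have e3: "(\<integral>z. \<bar>q (perturbed_score z) - reg2 (perturbed_score z)\<bar> \<partial>?L) \<le> \<dots>" .
  have "recalibration_error h \<mu> f m v g1 g2 =
     (\<integral>z. \<bar>real_cond_exp ?M (vimage_algebra (space ?M) (\<lambda>(x, y, s). R s) borel) (\<lambda>(x, y, s). of_bool y) z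
        - g1 (snd (snd z))\<bar> \<partial>?M)
     + (\<integral>z. \<bar>real_cond_exp ?M (vimage_algebra (space ?M) (\<lambda>(x, y, s). R s) borel) (\<lambda>(x, y, s). (f x)\<^sup>2) z
        - q (snd (snd z))\<bar> \<partial>?M)"
    unfolding recalibration_error_def CE2_def Let_def R_def[symmetric] qR
    by (simp add: case_prod_beta' R_def recalibrated_def)
  then show ?thesis using e1 e2 e3 by linarith
qed

text \<open>The polynomial approximation is controlled on the unit square only; this allows it to be
  used under the law of the score.\<close>

lemma AE_score_domain: "AE z in snap. perturbed_score z \<in> score_domain"
proof -
  have "(\<integral>\<^sup>+z. indicator (- score_domain) (perturbed_score z) \<partial>snap)
    = weighted_score_integral (\<lambda>_. 1) (indicator (- score_domain))"
    by (rule nn_integral_snapshot_marginal) measurable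
  also have "\<dots> = 0"
  proof -
    have z: "ennreal (smooth_kernel x s * indicator score_domain s) * indicator (- score_domain) s = 0" for x s
      by (simp add: indicator_def)
    show ?thesis unfolding weighted_score_integral_def z by simp
  qed
  finally have "AE z in snap. (indicator (- score_domain) (perturbed_score z) :: ennreal) = 0"
    by (subst (asm) nn_integral_0_iff_AE) measurable
  then show ?thesis by eventually_elim (simp add: indicator_def split: if_splits)
qed

lemma poly_regression:
  assumes Z: "Z \<in> borel_measurable snap" "\<And>z. 0 \<le> Z z" "\<And>z. Z z \<le> 1"
    and g: "g \<in> borel_measurable \<mu>" "\<And>x. x \<in> space \<mu> \<Longrightarrow> g x \<in> {0..1}"
    and eq: "\<And>u. u \<in> borel_measurable borel \<Longrightarrow>
      (\<integral>\<^sup>+z. ennreal (Z z) * u (perturbed_score z) \<partial>snap)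
      = (\<integral>\<^sup>+z. ennreal (reg g (perturbed_score z)) * u (perturbed_score z) \<partial>snap)"
  shows "clipped_regression snap borel perturbed_score Z (reg g)
    (\<lambda>(i, j) s. fst s ^ i * snd s ^ j) ({..l} \<times> {..l})"
proof -
  interpret L: prob_space "snap" by (rule prob_space_snapshot_law)
  have rm: "reg g \<in> borel_measurable borel" by (rule reg_measurable[OF g(1)])
  show ?thesis
  proof
    fix k :: "nat \<times> nat"
    show "(case k of (i, j) \<Rightarrow> \<lambda>s. fst s ^ i * snd s ^ j) \<in> borel_measurable (borel :: (real \<times> real) measure)"
      unfolding borel_prod[symmetric] by (cases k) simp
  next
    fix \<psi> :: "real \<times> real \<Rightarrow> real"
    assume "\<psi> \<in> borel_measurable borel" "\<And>s. \<bar>\<psi> s\<bar> \<le> 1"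
    then show "(\<integral>z. Z z * \<psi> (perturbed_score z) \<partial>snap)
      = (\<integral>z. reg g (perturbed_score z) * \<psi> (perturbed_score z) \<partial>snap)"
      using Z rm reg_bounds(2,3)[OF g] by (intro integral_eq_of_nn_integral_eq[OF prob_space_snapshot_law _ _ _ _ _ _ _ eq]) auto
  qed (use Z rm reg_bounds[OF g] in auto)
qed

lemma clipped_polys_eq_range:
  assumes "clipped_regression snap borel perturbed_score Z \<zeta>
    (\<lambda>(i, j) s. fst s ^ i * snd s ^ j) ({..l} \<times> {..l})"
  shows "clipped_polys l = range (clipped_regression.clin (\<lambda>(i, j) s. fst s ^ i * snd s ^ j) ({..l} \<times> {..l}))"
proof -
  have "clipped_regression.clin (\<lambda>(i, j) s. fst s ^ i * snd s ^ j) ({..l} \<times> {..l}) \<beta>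
    = (\<lambda>(s, t). clip01 (\<Sum>(i, j)\<in>{..l} \<times> {..l}. \<beta> (i, j) * (s ^ i * t ^ j)))" for \<beta>
    unfolding clipped_regression.clin_def[OF assms, abs_def] by (simp add: fun_eq_iff case_prod_beta')
  then have "clipped_regression.clin (\<lambda>(i, j) s. fst s ^ i * snd s ^ j) ({..l} \<times> {..l})
    = (\<lambda>\<beta> (s, t). clip01 (\<Sum>(i, j)\<in>{..l} \<times> {..l}. \<beta> (i, j) * (s ^ i * t ^ j)))"
    by (rule ext)
  then show ?thesis unfolding clipped_polys_def by (simp only: full_SetCompr_eq)
qed

text \<open>The \<open>L\<^sup>1\<close> error is controlled by the risk through \<open>x \<le> r / 2 + x\<^sup>2 / (2 r)\<close>.\<close>

lemma expected_L1_error_le: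
  fixes \<eta>' :: "(nat \<Rightarrow> 'a snapshot) \<Rightarrow> real \<times> real \<Rightarrow> real" and r :: real
  assumes Z: "Z \<in> borel_measurable snap" "\<And>z. 0 \<le> Z z" "\<And>z. Z z \<le> 1"
    and g: "g \<in> borel_measurable \<mu>" "\<And>x. x \<in> space \<mu> \<Longrightarrow> g x \<in> {0..1}"
    and eq: "\<And>u. u \<in> borel_measurable borel \<Longrightarrow>
      (\<integral>\<^sup>+z. ennreal (Z z) * u (perturbed_score z) \<partial>snap)
      = (\<integral>\<^sup>+z. ennreal (reg g (perturbed_score z)) * u (perturbed_score z) \<partial>snap)"
    and n: "n \<ge> 1" and erm: "erm_estimator (sample_law h \<mu> f m v n) Z n l \<eta>'"
    and approx: "\<And>s t. s \<in> {0..1} \<Longrightarrow> t \<in> {0..1} \<Longrightarrow>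
      \<bar>reg g (s, t) - (\<Sum>i<l+1. \<Sum>j<l+1. d i j * s ^ i * t ^ j)\<bar> \<le> \<epsilon>"
    and r: "r > 0"
    and bound: "2 * \<epsilon>\<^sup>2 + (10 + 80 * (real ((l + 1)\<^sup>2) * ln (2 * real n * real n + 1))) / real n \<le> B * r\<^sup>2"
  shows "integrable (sample_law h \<mu> f m v n)
      (\<lambda>D. \<integral>z. \<bar>\<eta>' D (perturbed_score z) - reg g (perturbed_score z)\<bar> \<partial>snap)"
    and "(\<integral>D. (\<integral>z. \<bar>\<eta>' D (perturbed_score z) - reg g (perturbed_score z)\<bar> \<partial>snap)
      \<partial>sample_law h \<mu> f m v n) \<le> (1 + B) / 2 * r"
    and "\<And>D. D \<in> space (sample_law h \<mu> f m v n) \<Longrightarrow> \<eta>' D \<in> borel_measurable borel"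
    and "\<And>D s. D \<in> space (sample_law h \<mu> f m v n) \<Longrightarrow> \<eta>' D s \<in> {0..1}"
proof -
  let ?L = snap
  let ?\<phi> = "\<lambda>(i, j) s. fst s ^ i * snd s ^ j :: real" and ?K = "{..l} \<times> {..l}"
  interpret C: clipped_regression ?L borel perturbed_score Z "reg g" ?\<phi> ?K
    by (rule poly_regression[OF Z g eq])
  let ?P = "sample_law h \<mu> f m v n"
  have P: "?P = (\<Pi>\<^sub>M i\<in>{..<n}. ?L)" by (simp add: sample_law_def)
  interpret P: prob_space ?P unfolding P by (intro prob_space_PiM C.prob_space_axioms)
  have poly: "clipped_polys l = range C.clin" by (rule clipped_polys_eq_range[OF C.clipped_regression_axioms])
  have jm[measurable]: "(\<lambda>(D, s). \<eta>' D s) \<in> borel_measurable (?P \<Otimes>\<^sub>M borel)"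
    and am: "\<And>D. D \<in> space ?P \<Longrightarrow> is_arg_min (emp_risk Z n D) (\<lambda>g. g \<in> clipped_polys l) (\<eta>' D)"
    using erm by (auto simp: erm_estimator_def)
  have clin: "\<eta>' D \<in> range C.clin" if "D \<in> space ?P" for D
    using am[OF that] unfolding poly is_arg_min_def by blast
  have erm': "(\<Sum>i<n. (Z (D i) - \<eta>' D (perturbed_score (D i)))\<^sup>2) \<le> (\<Sum>i<n. (Z (D i) - C.clin \<beta> (perturbed_score (D i)))\<^sup>2)"
    if "D \<in> space ?P" for D \<beta>
  proof -
    have "\<not> emp_risk Z n D (C.clin \<beta>) < emp_risk Z n D (\<eta>' D)"
      using am[OF that] unfolding poly is_arg_min_def by blast
    then show ?thesis using n unfolding emp_risk_def by (simp add: not_less divide_right_mono divide_le_cancel)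
  qed
  show em: "\<eta>' D \<in> borel_measurable borel" if "D \<in> space ?P" for D
    using clin[OF that] C.clin_measurable by auto
  show e01: "\<eta>' D s \<in> {0..1}" if D: "D \<in> space ?P" for D s
  proof -
    obtain \<beta> where "\<eta>' D = C.clin \<beta>" using clin[OF D] by blast
    then show ?thesis using C.clin01[of \<beta> s] by simp
  qed
  define \<beta> where "\<beta> = (\<lambda>(i, j). d i j)"
  \<comment> \<open>\<open>i < l + 1\<close> in the approximation and \<open>..l\<close> in the
    class both mean degree at most \<open>l\<close> in each variable.\<close>
  have cl: "C.clin \<beta> (s, t) = clip01 (\<Sum>i<l+1. \<Sum>j<l+1. d i j * s ^ i * t ^ j)" for s t
    unfolding C.clin_def \<beta>_def by (simp add: sum.cartesian_product lessThan_Suc_atMost mult.assoc case_prod_beta')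
  have eps0: "0 \<le> \<epsilon>" using approx[of 0 0] by force
  have "C.risk (C.clin \<beta>) \<le> (\<integral>z. \<epsilon>\<^sup>2 \<partial>?L)"
    unfolding C.risk_def
  proof (rule integral_mono_AE)
    have b: "\<bar>C.clin \<beta> s - reg g s\<bar> \<le> 1" for s
      using C.clin01[of \<beta> s] reg_bounds(2,3)[OF g, of s] by (simp add: abs_le_iff)
    show "integrable ?L (\<lambda>z. (C.clin \<beta> (perturbed_score z) - reg g (perturbed_score z))\<^sup>2)"
      using b by (intro C.integrable_const_bound[where B = 1] AE_I2 borel_measurable_power borel_measurable_diff
          measurable_compose[OF perturbed_score_measurable C.clin_measurable]
          measurable_compose[OF perturbed_score_measurable reg_measurable[OF g(1)]]) (auto simp: abs_square_le_1)
    show "AE z in ?L. (C.clin \<beta> (perturbed_score z) - reg g (perturbed_score z))\<^sup>2 \<le> \<epsilon>\<^sup>2"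
      using AE_score_domain
    proof eventually_elim
      fix z :: "'a snapshot" assume "perturbed_score z \<in> score_domain"
      then obtain s t where st: "perturbed_score z = (s, t)" "s \<in> {0..1}" "t \<in> {0..1}"
        unfolding score_domain_def by (cases "perturbed_score z") auto
      have "\<bar>C.clin \<beta> (s, t) - reg g (s, t)\<bar> \<le> \<bar>(\<Sum>i<l+1. \<Sum>j<l+1. d i j * s ^ i * t ^ j) - reg g (s, t)\<bar>"
        unfolding cl using reg_bounds(2,3)[OF g] by (intro abs_clip01_diff_le)
      also have "\<dots> \<le> \<epsilon>" using approx[OF st(2,3)] by (simp add: abs_minus_commute)
      finally show "(C.clin \<beta> (perturbed_score z) - reg g (perturbed_score z))\<^sup>2 \<le> \<epsilon>\<^sup>2"
        unfolding st(1) using eps0 by (subst abs_le_square_iff[symmetric]) simp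
    qed
  qed simp
  then have rstar: "C.risk (C.clin \<beta>) \<le> \<epsilon>\<^sup>2" by (simp add: C.prob_space)
  have "(\<integral>D. C.risk (\<eta>' D) \<partial>?P)
    \<le> 2 * C.risk (C.clin \<beta>) + (10 + 80 * (real (card ?K) * ln (2 * real n * real n + 1))) / real n"
    unfolding P using jm clin erm' by (intro C.expected_risk_le n) (auto simp: P)
  also have "\<dots> \<le> 2 * \<epsilon>\<^sup>2 + (10 + 80 * (real ((l + 1)\<^sup>2) * ln (2 * real n * real n + 1))) / real n"
    using rstar by (simp add: card_cartesian_product power2_eq_square)
  also have "\<dots> \<le> B * r\<^sup>2" by (rule bound)
  finally have ER: "(\<integral>D. C.risk (\<eta>' D) \<partial>?P) \<le> B * r\<^sup>2" .
  have jS: "(\<lambda>p. \<eta>' (fst p) (perturbed_score (snd p))) \<in> borel_measurable (?P \<Otimes>\<^sub>M ?L)"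
    using measurable_compose[of "\<lambda>p. (fst p, perturbed_score (snd p))" "?P \<Otimes>\<^sub>M ?L" "?P \<Otimes>\<^sub>M borel", OF _ jm] by simp
  have rS: "(\<lambda>p. reg g (perturbed_score (snd p))) \<in> borel_measurable (?P \<Otimes>\<^sub>M ?L)"
    using measurable_compose[OF measurable_snd measurable_compose[OF perturbed_score_measurable reg_measurable[OF g(1)]]] .
  have abs1: "\<bar>\<eta>' D s - reg g s\<bar> \<le> 1" if "D \<in> space ?P" for D s
    using e01[OF that, of s] reg_bounds(2,3)[OF g, of s] by (simp add: abs_le_iff)
  have m1: "(\<lambda>D. \<integral>z. \<bar>\<eta>' D (perturbed_score z) - reg g (perturbed_score z)\<bar> \<partial>?L) \<in> borel_measurable ?P"
    using jS rS by (intro C.borel_measurable_lebesgue_integral) (simp add: case_prod_beta')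
  have m2: "(\<lambda>D. C.risk (\<eta>' D)) \<in> borel_measurable ?P"
    unfolding C.risk_def using jS rS by (intro C.borel_measurable_lebesgue_integral) (simp add: case_prod_beta')
  have mD: "(\<lambda>z. \<eta>' D (perturbed_score z) - reg g (perturbed_score z)) \<in> borel_measurable ?L" if "D \<in> space ?P" for D
    by (intro borel_measurable_diff measurable_compose[OF perturbed_score_measurable em[OF that]]
        measurable_compose[OF perturbed_score_measurable reg_measurable[OF g(1)]])
  have i1: "integrable ?L (\<lambda>z. \<bar>\<eta>' D (perturbed_score z) - reg g (perturbed_score z)\<bar>)" if "D \<in> space ?P" for D
    using abs1[OF that] mD[OF that] by (intro C.integrable_const_bound[where B = 1] AE_I2) auto
  have i2: "integrable ?L (\<lambda>z. (\<eta>' D (perturbed_score z) - reg g (perturbed_score z))\<^sup>2)" if "D \<in> space ?P" for D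
    using abs1[OF that] mD[OF that] by (intro C.integrable_const_bound[where B = 1] AE_I2) (auto simp: abs_square_le_1)
  have b1: "(\<integral>z. \<bar>\<eta>' D (perturbed_score z) - reg g (perturbed_score z)\<bar> \<partial>?L) \<in> {0..1}" if "D \<in> space ?P" for D
    using C.integral_le_const[OF i1[OF that], of 1] abs1[OF that] by (auto intro!: AE_I2)
  have b2: "C.risk (\<eta>' D) \<in> {0..1}" if "D \<in> space ?P" for D
    unfolding C.risk_def using C.integral_le_const[OF i2[OF that], of 1] abs1[OF that]
    by (auto intro!: AE_I2 simp: abs_square_le_1)
  show I1: "integrable ?P (\<lambda>D. \<integral>z. \<bar>\<eta>' D (perturbed_score z) - reg g (perturbed_score z)\<bar> \<partial>?L)"
    using b1 by (intro P.integrable_const_bound[where B = 1] AE_I2 m1) auto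
  have I2: "integrable ?P (\<lambda>D. C.risk (\<eta>' D))"
    using b2 by (intro P.integrable_const_bound[where B = 1] AE_I2 m2) auto
  have amgm: "\<bar>x\<bar> \<le> r / 2 + x\<^sup>2 / (2 * r)" for x :: real
  proof -
    have "0 \<le> (\<bar>x\<bar> - r)\<^sup>2" by simp
    then have "2 * \<bar>x\<bar> * r \<le> r\<^sup>2 + x\<^sup>2" by (simp add: power2_diff)
    then show ?thesis using r by (simp add: field_simps power2_eq_square)
  qed
  have "(\<integral>D. (\<integral>z. \<bar>\<eta>' D (perturbed_score z) - reg g (perturbed_score z)\<bar> \<partial>?L) \<partial>?P)
    \<le> (\<integral>D. r / 2 + C.risk (\<eta>' D) / (2 * r) \<partial>?P)"
  proof (rule integral_mono[OF I1])
    show "integrable ?P (\<lambda>D. r / 2 + C.risk (\<eta>' D) / (2 * r))" using I2 by simp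
    fix D assume D: "D \<in> space ?P"
    have "(\<integral>z. \<bar>\<eta>' D (perturbed_score z) - reg g (perturbed_score z)\<bar> \<partial>?L)
      \<le> (\<integral>z. r / 2 + (\<eta>' D (perturbed_score z) - reg g (perturbed_score z))\<^sup>2 / (2 * r) \<partial>?L)"
      using i1[OF D] i2[OF D] amgm by (intro integral_mono) auto
    also have "\<dots> = r / 2 + C.risk (\<eta>' D) / (2 * r)" unfolding C.risk_def using i2[OF D] by (simp add: C.prob_space)
    finally show "(\<integral>z. \<bar>\<eta>' D (perturbed_score z) - reg g (perturbed_score z)\<bar> \<partial>?L) \<le> r / 2 + C.risk (\<eta>' D) / (2 * r)" .
  qed
  also have "\<dots> = r / 2 + (\<integral>D. C.risk (\<eta>' D) \<partial>?P) / (2 * r)" using I2 by (simp add: P.prob_space)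
  also have "\<dots> \<le> r / 2 + B * r\<^sup>2 / (2 * r)" using ER r by (intro add_left_mono divide_right_mono) auto
  also have "\<dots> = (1 + B) / 2 * r" using r by (simp add: power2_eq_square field_simps)
  finally show "(\<integral>D. (\<integral>z. \<bar>\<eta>' D (perturbed_score z) - reg g (perturbed_score z)\<bar> \<partial>?L) \<partial>?P) \<le> (1 + B) / 2 * r" .
qed

end

section \<open>Choice of the degree and the final rate\<close>

lemma poly_degree_bounds:
  assumes h: "h > 0" and n: "n \<ge> 3"
  shows "real (poly_degree h n + 1) \<le> (2 / ln (analyticity_param h) + 2) * ln (real n)"
    and "inverse (sqrt (analyticity_param h)) ^ (poly_degree h n + 1) \<le> 1 / real n"
proof -
  define \<theta> where "\<theta> = analyticity_param h"
  have \<theta>: "\<theta> > 1" unfolding \<theta>_def by (rule analyticity_param(1)[OF h])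
  then have L: "ln \<theta> > 0" by simp
  define l where "l = poly_degree h n"
  have l: "l = nat \<lceil>2 * ln (real n) / ln \<theta>\<rceil>"
    unfolding l_def poly_degree_def \<theta>_def analyticity_param_def Let_def by simp
  have "exp 1 \<le> (3 :: real)" by (rule exp_le)
  then have ln1: "1 \<le> ln (real n)" using n by (subst ln_ge_iff) auto
  have x0: "0 \<le> 2 * ln (real n) / ln \<theta>" using ln1 L by simp
  have rl: "real l = of_int \<lceil>2 * ln (real n) / ln \<theta>\<rceil>" unfolding l using x0 by simp
  have "real l \<le> 2 * ln (real n) / ln \<theta> + 1" unfolding rl by linarith
  \<comment> \<open>\<open>ln n \<ge> 1\<close> absorbs both the rounding and the shift from
    \<open>l\<close> to \<open>l + 1\<close>; this is the reason for
    \<open>n \<ge> 3\<close>.\<close>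
  then have "real (l + 1) \<le> 2 * ln (real n) / ln \<theta> + 2 * ln (real n)" using ln1 by simp
  also have "\<dots> = (2 / ln \<theta> + 2) * ln (real n)" by (simp add: algebra_simps)
  finally show "real (poly_degree h n + 1) \<le> (2 / ln (analyticity_param h) + 2) * ln (real n)"
    unfolding l_def \<theta>_def .
  have "2 * ln (real n) / ln \<theta> \<le> real l" unfolding rl by linarith
  then have "ln (real n) \<le> real l * (ln \<theta> / 2)" using L by (simp add: field_simps)
  also have "\<dots> = ln (sqrt \<theta> ^ l)" using \<theta> by (simp add: ln_realpow ln_sqrt)
  finally have "real n \<le> sqrt \<theta> ^ l" using n \<theta> by (subst (asm) ln_le_cancel_iff) auto
  also have "\<dots> \<le> sqrt \<theta> ^ (l + 1)" using \<theta> by (intro power_increasing) auto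
  finally have "inverse (sqrt \<theta> ^ (l + 1)) \<le> inverse (real n)" using n by (intro le_imp_inverse_le) auto
  then show "inverse (sqrt (analyticity_param h)) ^ (poly_degree h n + 1) \<le> 1 / real n"
    unfolding l_def \<theta>_def power_inverse by (simp only: inverse_eq_divide[of "real n"])
qed

theorem corollary2:
  fixes h :: real
  assumes "h > 0"
  shows "\<exists>(C :: real) (N :: nat).
    \<forall>(\<mu> :: 'a measure) f m v n \<eta>1 \<eta>2.
      prob_space \<mu> \<longrightarrow>
      f \<in> borel_measurable \<mu> \<longrightarrow>
      (\<forall>x\<in>space \<mu>. f x \<in> {0..1}) \<longrightarrow>
      ho_predictor \<mu> m v \<longrightarrow>
      N \<le> n \<longrightarrow>
      erm_estimator (sample_law h \<mu> f m v n) first_label n (poly_degree h n) \<eta>1 \<longrightarrow>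
      erm_estimator (sample_law h \<mu> f m v n) label_product n (poly_degree h n) \<eta>2 \<longrightarrow>
      (LINT D|sample_law h \<mu> f m v n. recalibration_error h \<mu> f m v (\<eta>1 D) (\<eta>2 D))
        \<le> C * (ln (real n) powr (3/2) / sqrt (real n))"
proof -
  obtain A where A: "A \<ge> 0" and approx: "\<And>k (\<mu> :: 'a measure) g m v \<omega> W. k \<ge> 1 \<Longrightarrow>
    prob_space \<mu> \<Longrightarrow> g \<in> borel_measurable \<mu> \<Longrightarrow> (\<forall>x\<in>space \<mu>. g x \<in> {0..1}) \<Longrightarrow>
    m \<in> borel_measurable \<mu> \<Longrightarrow> v \<in> borel_measurable \<mu> \<Longrightarrow> \<omega> \<in> borel_measurable \<mu> \<Longrightarrow>
    (\<forall>x\<in>space \<mu>. 0 < \<omega> x \<and> \<omega> x \<le> W) \<Longrightarrow>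
    (\<exists>d. \<forall>s\<in>{0..1}. \<forall>t\<in>{0..1}.
      \<bar>(\<integral>x. g x * (sech ((s - m x) / h) * sech ((t - v x) / h) * \<omega> x) \<partial>\<mu>)
        / (\<integral>x. sech ((s - m x) / h) * sech ((t - v x) / h) * \<omega> x \<partial>\<mu>)
       - (\<Sum>i<k. \<Sum>j<k. d i j * s ^ i * t ^ j)\<bar> \<le> A * inverse (sqrt (analyticity_param h)) ^ k)"
    using regression_function_approximation[OF assms, where 'a = 'a] by blast
  define c where "c = 2 / ln (analyticity_param h) + 2"
  \<comment> \<open>\<open>2 * A\<^sup>2\<close> comes from the approximation error, 10 from the
    additive constant of the risk bound, and 240 is 80 times the 3 in
    \<open>ln (2 * n * n + 1) \<le> 3 * ln n\<close>.\<close>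
  define B where "B = 2 * A\<^sup>2 + 10 + 240 * c\<^sup>2"
  show ?thesis
  \<comment> \<open>Three copies of the first error and one of the second, each at most
    \<open>(1 + B) / 2\<close> times the rate.\<close>
  proof (intro exI[of _ "2 * (1 + B)"] exI[of _ 3] allI impI)
    fix \<mu> :: "'a measure" and f m v :: "'a \<Rightarrow> real" and n :: nat
      and \<eta>1 \<eta>2 :: "(nat \<Rightarrow> 'a snapshot) \<Rightarrow> real \<times> real \<Rightarrow> real"
    assume hyp: "prob_space \<mu>" "f \<in> borel_measurable \<mu>" "\<forall>x\<in>space \<mu>. f x \<in> {0..1}" "ho_predictor \<mu> m v"
      and n: "3 \<le> n"
      and erm1: "erm_estimator (sample_law h \<mu> f m v n) first_label n (poly_degree h n) \<eta>1"
      and erm2: "erm_estimator (sample_law h \<mu> f m v n) label_product n (poly_degree h n) \<eta>2"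
    interpret prob_space \<mu> by fact
    interpret snapshot_model \<mu> h f m v
      using hyp assms by unfold_locales auto
    define l where "l = poly_degree h n"
    \<comment> \<open>The target rate. It is also the free parameter in the passage from squared to
      absolute error, which is balanced because the risk is of order
      \<open>r\<^sup>2\<close>.\<close>
    define r where "r = ln (real n) powr (3/2) / sqrt (real n)"
    have ln1: "1 \<le> ln (real n)" using n exp_le by (subst ln_ge_iff) auto
    have r: "r > 0" unfolding r_def using ln1 n by simp
    have r2: "r\<^sup>2 = ln (real n) ^ 3 / real n"
    proof -
      have "(ln (real n) powr (3/2))\<^sup>2 = ln (real n) powr (real 3)"
        using ln1 by (simp add: power2_eq_square flip: powr_add)
      also have "\<dots> = ln (real n) ^ 3" using ln1 by (subst powr_realpow) auto
      finally show ?thesis unfolding r_def power_divide by simp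
    qed
    define \<epsilon> where "\<epsilon> = A / real n"
    have d: "\<exists>d. \<forall>s\<in>{0..1}. \<forall>t\<in>{0..1}. \<bar>reg g (s, t) - (\<Sum>i<l+1. \<Sum>j<l+1. d i j * s ^ i * t ^ j)\<bar> \<le> \<epsilon>"
      if g: "g \<in> borel_measurable \<mu>" "\<And>x. x \<in> space \<mu> \<Longrightarrow> g x \<in> {0..1}" for g
    proof -
      have "A * inverse (sqrt (analyticity_param h)) ^ (l + 1) \<le> A * (1 / real n)"
        unfolding l_def by (intro mult_left_mono poly_degree_bounds assms n A)
      then have eps: "A * inverse (sqrt (analyticity_param h)) ^ (l + 1) \<le> \<epsilon>" unfolding \<epsilon>_def by simp
      have ex: "\<exists>d. \<forall>s\<in>{0..1}. \<forall>t\<in>{0..1}.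
        \<bar>(\<integral>x. g x * (sech ((s - m x) / h) * sech ((t - v x) / h) * scale x) \<partial>\<mu>)
          / (\<integral>x. sech ((s - m x) / h) * sech ((t - v x) / h) * scale x \<partial>\<mu>)
         - (\<Sum>i<l+1. \<Sum>j<l+1. d i j * s ^ i * t ^ j)\<bar> \<le> A * inverse (sqrt (analyticity_param h)) ^ (l + 1)"
        using scale_bounds g(2) by (intro approx[of "l + 1" \<mu> g m v scale scale_bound] hyp(1) g(1)) auto
      have rg: "reg g (s, t) = (\<integral>x. g x * (sech ((s - m x) / h) * sech ((t - v x) / h) * scale x) \<partial>\<mu>)
          / (\<integral>x. sech ((s - m x) / h) * sech ((t - v x) / h) * scale x \<partial>\<mu>)" for s t
        unfolding reg_def numerator_def smooth_kernel_def by simp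
      show ?thesis using ex eps unfolding rg by (meson order_trans)
    qed
    have bound: "2 * \<epsilon>\<^sup>2 + (10 + 80 * (real ((l + 1)\<^sup>2) * ln (2 * real n * real n + 1))) / real n \<le> B * r\<^sup>2"
    proof -
      have L3: "1 \<le> ln (real n) ^ 3" using ln1 by simp
      have n0: "real n > 0" using n by simp
      have c1: "(real (l + 1))\<^sup>2 \<le> (c * ln (real n))\<^sup>2"
        using poly_degree_bounds(1)[OF assms n] unfolding l_def c_def by (intro power_mono) auto
      have "2 * real n * real n + 1 \<le> real n ^ 3"
      proof -
        have "3 * (real n * real n) \<le> real n * (real n * real n)" using n by (intro mult_right_mono) auto
        moreover have "1 \<le> real n * real n" using n by (simp add: mult_ge1_I)
        ultimately show ?thesis by (simp add: power3_eq_cube mult.assoc)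
      qed
      then have "ln (2 * real n * real n + 1) \<le> ln (real n ^ 3)"
        using n0 by (subst ln_le_cancel_iff) (auto intro: add_nonneg_pos)
      then have c2: "ln (2 * real n * real n + 1) \<le> 3 * ln (real n)" using n0 by (simp add: ln_realpow)
      have "(real (l + 1))\<^sup>2 * ln (2 * real n * real n + 1) \<le> (c * ln (real n))\<^sup>2 * (3 * ln (real n))"
        using c1 c2 by (intro mult_mono) (auto intro: ln_ge_zero)
      also have "\<dots> = 3 * c\<^sup>2 * ln (real n) ^ 3" by (simp add: power2_eq_square power3_eq_cube)
      finally have k: "real ((l + 1)\<^sup>2) * ln (2 * real n * real n + 1) \<le> 3 * c\<^sup>2 * ln (real n) ^ 3" by simp
      have "2 * \<epsilon>\<^sup>2 \<le> 2 * A\<^sup>2 / real n"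
      proof -
        have "2 * A\<^sup>2 / (real n * real n) \<le> 2 * A\<^sup>2 / (real n * 1)"
          using n by (intro divide_left_mono mult_left_mono) auto
        then show ?thesis unfolding \<epsilon>_def by (simp add: power_divide power2_eq_square)
      qed
      then have "2 * \<epsilon>\<^sup>2 + (10 + 80 * (real ((l + 1)\<^sup>2) * ln (2 * real n * real n + 1))) / real n
        \<le> 2 * A\<^sup>2 / real n + (10 + 80 * (3 * c\<^sup>2 * ln (real n) ^ 3)) / real n"
        using k n0 by (intro add_mono divide_right_mono) auto
      also have "\<dots> = (2 * A\<^sup>2 + 10 + 240 * c\<^sup>2 * ln (real n) ^ 3) / real n" by (simp add: add_divide_distrib)
      also have "\<dots> \<le> B * ln (real n) ^ 3 / real n"
      proof (rule divide_right_mono)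
        have "(2 * A\<^sup>2 + 10) * 1 \<le> (2 * A\<^sup>2 + 10) * ln (real n) ^ 3" using L3 by (intro mult_left_mono) auto
        then show "2 * A\<^sup>2 + 10 + 240 * c\<^sup>2 * ln (real n) ^ 3 \<le> B * ln (real n) ^ 3"
          unfolding B_def by (simp add: distrib_right)
      qed simp
      finally show ?thesis unfolding r2 by simp
    qed
    have n1: "1 \<le> n" using n by simp
    obtain d1 where d1: "\<And>s t. s \<in> {0..1} \<Longrightarrow> t \<in> {0..1} \<Longrightarrow>
      \<bar>reg f (s, t) - (\<Sum>i<l+1. \<Sum>j<l+1. d1 i j * s ^ i * t ^ j)\<bar> \<le> \<epsilon>"
      using d[OF f_measurable f01] by blast
    obtain d2 where d2: "\<And>s t. s \<in> {0..1} \<Longrightarrow> t \<in> {0..1} \<Longrightarrow>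
      \<bar>reg2 (s, t) - (\<Sum>i<l+1. \<Sum>j<l+1. d2 i j * s ^ i * t ^ j)\<bar> \<le> \<epsilon>"
      using d[OF f2_measurable f2_01] by blast
    have Z1: "0 \<le> first_label z" "first_label z \<le> 1" for z :: "'a snapshot"
      by (auto simp: first_label_def split: prod.split)
    have Z2: "0 \<le> label_product z" "label_product z \<le> 1" for z :: "'a snapshot"
      by (auto simp: label_product_def split: prod.split)
    note E1 = expected_L1_error_le[OF first_label_measurable Z1 f_measurable f01 nn_integral_first_label n1
        erm1[folded l_def] d1 r bound]
    note E2 = expected_L1_error_le[OF label_product_measurable Z2 f2_measurable f2_01 nn_integral_label_product n1
        erm2[folded l_def] d2 r bound]
    let ?P = "sample_law h \<mu> f m v n" and ?L = "snapshot_law h \<mu> f m v"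
    let ?e1 = "\<lambda>D. \<integral>z. \<bar>\<eta>1 D (perturbed_score z) - reg f (perturbed_score z)\<bar> \<partial>?L"
    let ?e2 = "\<lambda>D. \<integral>z. \<bar>\<eta>2 D (perturbed_score z) - reg2 (perturbed_score z)\<bar> \<partial>?L"
    have "(\<integral>D. recalibration_error h \<mu> f m v (\<eta>1 D) (\<eta>2 D) \<partial>?P) \<le> (\<integral>D. 3 * ?e1 D + ?e2 D \<partial>?P)"
    \<comment> \<open>Integrability of the recalibration error in \<open>D\<close> is left open. A
      function that is not integrable has integral 0, and the nonnegativity of the right side covers
      this case.\<close>
    proof (rule integral_mono')
      show "integrable ?P (\<lambda>D. 3 * ?e1 D + ?e2 D)" using E1(1) E2(1) by simp
      show "recalibration_error h \<mu> f m v (\<eta>1 D) (\<eta>2 D) \<le> 3 * ?e1 D + ?e2 D" if "D \<in> space ?P" for D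
        using that by (intro recalibration_error_le E1(3,4) E2(3,4))
      show "0 \<le> 3 * ?e1 D + ?e2 D" for D by simp
    qed
    also have "\<dots> = 3 * (\<integral>D. ?e1 D \<partial>?P) + (\<integral>D. ?e2 D \<partial>?P)" using E1(1) E2(1) by simp
    also have "\<dots> \<le> 3 * ((1 + B) / 2 * r) + (1 + B) / 2 * r" using E1(2) E2(2) by linarith
    also have "\<dots> = 2 * (1 + B) * r" by simp
    finally show "(LINT D|?P. recalibration_error h \<mu> f m v (\<eta>1 D) (\<eta>2 D))
        \<le> 2 * (1 + B) * (ln (real n) powr (3/2) / sqrt (real n))" unfolding r_def .
  qed
qed

end
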